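(* Let $A$ be a $C^*$-algebra and $p,q$ projections in $A^{**}$ with $p$ closed, $q$ open, $\alpha(p)<\infty$, and $\|p-q\|<1$. Then $q$ is compact; in fact $q\in A$.
   Context: $A^{**}$ is the enveloping von Neumann algebra of $A$ (identity $1$). A projection is open if it is the support projection of a hereditary $C^*$-subalgebra of $A$, closed if $1-p$ is open. $Q(A)=\{f\in A^*: f\geq0,\|f\|\leq1\}$, $S(A)$ the state space, $F(p)=\{f\in Q(A): f(1-p)=0\}$; $p$ is compact if $F(p)\cap S(A)$ is weak$^*$ closed. For $p\neq0$: $\alpha(p)=\inf\{\|a\|: a\in A_{sa}, p\leq pap\}$ if nonempty, else $\infty$; $\alpha(0)=1$. *)

theory Defs
  imports Complex_Main "HOL-Library.Extended_Real"
begin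

class cstar_algebra = banach + real_normed_algebra +
  fixes cscale :: "complex \<Rightarrow> 'a \<Rightarrow> 'a"
    and cstar :: "'a \<Rightarrow> 'a"
  assumes cscale_of_real: "cscale (complex_of_real r) x = scaleR r x"
    and cscale_add_left: "cscale (c + d) x = cscale c x + cscale d x"
    and cscale_add_right: "cscale c (x + y) = cscale c x + cscale c y"
    and cscale_mult: "cscale c (cscale d x) = cscale (c * d) x"
    and cscale_one: "cscale 1 x = x"
    and cscale_norm: "norm (cscale c x) = cmod c * norm x"
    and cscale_left_mult: "cscale c (x * y) = cscale c x * y"
    and cscale_right_mult: "cscale c (x * y) = x * cscale c y"
    and cstar_cstar: "cstar (cstar x) = x"
    and cstar_add: "cstar (x + y) = cstar x + cstar y"
    and cstar_cscale: "cstar (cscale c x) = cscale (cnj c) (cstar x)"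
    and cstar_mult: "cstar (x * y) = cstar y * cstar x"
    and cstar_identity: "norm (cstar x * x) = (norm x)\<^sup>2"

definition dual :: "('a::cstar_algebra \<Rightarrow> complex) set" where
  "dual = {f. (\<forall>x y. f (x + y) = f x + f y) \<and> (\<forall>c x. f (cscale c x) = c * f x) \<and>
              (\<exists>K. \<forall>x. cmod (f x) \<le> K * norm x)}"

definition dnorm :: "('a::cstar_algebra \<Rightarrow> complex) \<Rightarrow> real" where
  "dnorm f = Sup {cmod (f x) | x. norm x \<le> 1}"

definition bidual :: "(('a::cstar_algebra \<Rightarrow> complex) \<Rightarrow> complex) set" where
  "bidual = {F. (\<forall>f\<in>dual. \<forall>g\<in>dual. F (\<lambda>x. f x + g x) = F f + F g) \<and>
                (\<forall>f\<in>dual. \<forall>c. F (\<lambda>x. c * f x) = c * F f) \<and>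
                (\<exists>K. \<forall>f\<in>dual. cmod (F f) \<le> K * dnorm f) \<and>
                (\<forall>f. f \<notin> dual \<longrightarrow> F f = 0)}"

definition bnorm :: "(('a::cstar_algebra \<Rightarrow> complex) \<Rightarrow> complex) \<Rightarrow> real" where
  "bnorm F = Sup {cmod (F f) | f. f \<in> dual \<and> dnorm f \<le> 1}"

definition iota :: "'a::cstar_algebra \<Rightarrow> (('a \<Rightarrow> complex) \<Rightarrow> complex)" where
  "iota a = (\<lambda>f. if f \<in> dual then f a else 0)"

text \<open>Arens product on A** (the first Arens product; a C*-algebra is Arens regular).\<close>
definition fmod :: "('a::cstar_algebra \<Rightarrow> complex) \<Rightarrow> 'a \<Rightarrow> ('a \<Rightarrow> complex)" where
  "fmod f a = (\<lambda>b. f (a * b))"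

definition Fmod :: "(('a::cstar_algebra \<Rightarrow> complex) \<Rightarrow> complex) \<Rightarrow> ('a \<Rightarrow> complex) \<Rightarrow> ('a \<Rightarrow> complex)" where
  "Fmod F f = (\<lambda>a. F (fmod f a))"

definition arens :: "(('a::cstar_algebra \<Rightarrow> complex) \<Rightarrow> complex) \<Rightarrow> (('a \<Rightarrow> complex) \<Rightarrow> complex)
     \<Rightarrow> (('a \<Rightarrow> complex) \<Rightarrow> complex)" where
  "arens F G = (\<lambda>f. if f \<in> dual then F (Fmod G f) else 0)"

definition dstar :: "('a::cstar_algebra \<Rightarrow> complex) \<Rightarrow> ('a \<Rightarrow> complex)" where
  "dstar f = (\<lambda>a. cnj (f (cstar a)))"

definition bstar :: "(('a::cstar_algebra \<Rightarrow> complex) \<Rightarrow> complex) \<Rightarrow> (('a \<Rightarrow> complex) \<Rightarrow> complex)" where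
  "bstar F = (\<lambda>f. if f \<in> dual then cnj (F (dstar f)) else 0)"

definition bone :: "('a::cstar_algebra \<Rightarrow> complex) \<Rightarrow> complex" where
  "bone = (THE E. E \<in> bidual \<and> (\<forall>X\<in>bidual. arens E X = X \<and> arens X E = X))"

definition bprojection :: "(('a::cstar_algebra \<Rightarrow> complex) \<Rightarrow> complex) \<Rightarrow> bool" where
  "bprojection P \<longleftrightarrow> P \<in> bidual \<and> bstar P = P \<and> arens P P = P"

definition bpositive :: "(('a::cstar_algebra \<Rightarrow> complex) \<Rightarrow> complex) \<Rightarrow> bool" where
  "bpositive X \<longleftrightarrow> (\<exists>Y\<in>bidual. X = arens (bstar Y) Y)"

definition ble :: "(('a::cstar_algebra \<Rightarrow> complex) \<Rightarrow> complex) \<Rightarrow> (('a \<Rightarrow> complex) \<Rightarrow> complex) \<Rightarrow> bool" where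
  "ble X Y \<longleftrightarrow> X \<in> bidual \<and> Y \<in> bidual \<and> bpositive (Y - X)"

definition apositive :: "'a::cstar_algebra \<Rightarrow> bool" where
  "apositive a \<longleftrightarrow> (\<exists>y. a = cstar y * y)"

definition hereditary_subalgebra :: "'a::cstar_algebra set \<Rightarrow> bool" where
  "hereditary_subalgebra B \<longleftrightarrow> 0 \<in> B \<and> closed B \<and>
     (\<forall>x\<in>B. \<forall>y\<in>B. x + y \<in> B \<and> x * y \<in> B) \<and>
     (\<forall>c. \<forall>x\<in>B. cscale c x \<in> B) \<and> (\<forall>x\<in>B. cstar x \<in> B) \<and>
     (\<forall>b\<in>B. \<forall>a. apositive a \<and> apositive (b - a) \<longrightarrow> a \<in> B)"

text \<open>Support projection of B: the projection that is the unit of the weak*-closure of B in A**,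
  i.e. a projection in the weak*-closure of iota(B) acting as a unit on iota(B).\<close>
definition support_projection :: "'a::cstar_algebra set \<Rightarrow> (('a \<Rightarrow> complex) \<Rightarrow> complex) \<Rightarrow> bool" where
  "support_projection B P \<longleftrightarrow> bprojection P \<and>
     (\<forall>b\<in>B. arens P (iota b) = iota b \<and> arens (iota b) P = iota b) \<and>
     (\<forall>K \<subseteq> dual. finite K \<longrightarrow> (\<forall>e>0. \<exists>b\<in>B. \<forall>f\<in>K. cmod (P f - f b) < e))"

definition open_proj :: "(('a::cstar_algebra \<Rightarrow> complex) \<Rightarrow> complex) \<Rightarrow> bool" where
  "open_proj P \<longleftrightarrow> (\<exists>B. hereditary_subalgebra B \<and> support_projection B P)"

definition closed_proj :: "(('a::cstar_algebra \<Rightarrow> complex) \<Rightarrow> complex) \<Rightarrow> bool" where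
  "closed_proj P \<longleftrightarrow> bprojection P \<and> open_proj (bone - P)"

definition fpositive :: "('a::cstar_algebra \<Rightarrow> complex) \<Rightarrow> bool" where
  "fpositive f \<longleftrightarrow> f \<in> dual \<and> (\<forall>a. Im (f (cstar a * a)) = 0 \<and> Re (f (cstar a * a)) \<ge> 0)"

definition QA :: "('a::cstar_algebra \<Rightarrow> complex) set" where
  "QA = {f. fpositive f \<and> dnorm f \<le> 1}"

definition SA :: "('a::cstar_algebra \<Rightarrow> complex) set" where
  "SA = {f. fpositive f \<and> dnorm f = 1}"

definition FP :: "(('a::cstar_algebra \<Rightarrow> complex) \<Rightarrow> complex) \<Rightarrow> ('a \<Rightarrow> complex) set" where
  "FP P = {f \<in> QA. (bone - P) f = 0}"

definition weakstar_closed :: "('a::cstar_algebra \<Rightarrow> complex) set \<Rightarrow> bool" where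
  "weakstar_closed S \<longleftrightarrow> S \<subseteq> dual \<and>
     (\<forall>f\<in>dual - S. \<exists>K. finite K \<and> (\<exists>e>0. \<forall>g\<in>S. \<exists>a\<in>K. cmod (g a - f a) \<ge> e))"

definition compact_proj :: "(('a::cstar_algebra \<Rightarrow> complex) \<Rightarrow> complex) \<Rightarrow> bool" where
  "compact_proj P \<longleftrightarrow> weakstar_closed (FP P \<inter> SA)"

definition alpha :: "(('a::cstar_algebra \<Rightarrow> complex) \<Rightarrow> complex) \<Rightarrow> ereal" where
  "alpha P = (if P = (\<lambda>_. 0) then 1 else
     Inf {ereal (norm a) | a. cstar a = a \<and> ble P (arens (arens P (iota a)) P)})"

end

theory Submission
  imports Defs "HOL-Analysis.Operator_Norm"
begin

text \<open>Let \<open>B\<close> and \<open>C\<close> be the hereditary subalgebras supported by \<open>q\<close> and \<open>1 - p\<close>. A functional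
  vanishing on \<open>A B + A C\<close> is fixed by the action of \<open>p - q\<close>, a strict contraction, so \<open>A B + A C\<close> is
  dense in \<open>A\<close>. Approximating an \<open>a\<close> with \<open>p \<le> p a p\<close> and compressing by \<open>p\<close>, which kills \<open>C\<close>,
  yields \<open>b \<in> B\<close> such that \<open>p b p\<close> dominates a multiple of \<open>p\<close>; as \<open>q p q\<close> is invertible in the corner
  of \<open>q\<close>, the element \<open>b\<close> dominates a multiple of \<open>q\<close>. Hence \<open>b\<close> is bounded below on \<open>B\<close>, so \<open>B\<close> has a
  unit, and this unit is \<open>q\<close>.

  To compute in \<open>A\<^sup>*\<^sup>*\<close> one needs that the Arens product is regular and has a unit, and that positive
  functionals are positive on \<open>Y\<^sup>*Y\<close>. These follow from an approximate Riesz representation in the GNS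
  seminorm of a positive functional and from the Jordan decomposition of functionals.\<close>

section \<open>Elementary identities\<close>

text \<open>A sum \<open>u\<close> from \<open>A B + A C\<close> cannot be used through its
  decomposition, since \<open>u* u\<close> has mixed terms. Only the consequence
  \<open>u* u \<le> b + c\<close> with \<open>b\<close> in \<open>B\<close> and \<open>c\<close> in
  \<open>C\<close>, tested on positive functionals, is retained; it survives sums and scalars, and
  compression by \<open>p\<close> removes \<open>c\<close>. The passage from \<open>a\<close> to
  \<open>a* a\<close> is Cauchy-Schwarz at the unit: a positive functional \<open>h\<close> with
  \<open>norm h \<le> h(a)\<close> also satisfies \<open>norm h \<le> h(a* a)\<close>. Invertibility
  of \<open>q p q\<close> in its corner rests on \<open>q - q p q = q (p - q)^2 q\<close>, where
  \<open>(p - q)^2\<close> has norm below 1. Inequalities in the bidual are tested on positive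
  functionals of \<open>A\<close>, without spectral theory and without a representation on a Hilbert
  space. That \<open>A\<close> may lack a unit shapes the rest: positivity is developed in a
  unitization, and limits along approximate units stand in for the unit.\<close>

lemma cscale_zero_right [simp]: "cscale c (0::'a::cstar_algebra) = 0"
  using cscale_add_right[of c 0 "0::'a"] by simp

lemma cscale_zero_left [simp]: "cscale 0 (x::'a::cstar_algebra) = 0"
  using cscale_of_real[of 0 x] by simp

lemma cscale_minus_right: "cscale c (- x) = - cscale c (x::'a::cstar_algebra)"
  using cscale_add_right[of c x "- x"] by (simp add: eq_neg_iff_add_eq_0 add.commute)

lemma cscale_minus_left: "cscale (- c) x = - cscale c (x::'a::cstar_algebra)"
  using cscale_add_left[of c "- c" x] by (simp add: eq_neg_iff_add_eq_0 add.commute)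

lemma cscale_diff_right: "cscale c (x - y) = cscale c x - cscale c (y::'a::cstar_algebra)"
  using cscale_add_right[of c x "- y"] by (simp add: cscale_minus_right)

lemma cscale_eq_mult_left: "cscale c x * y = cscale c (x * (y::'a::cstar_algebra))"
  by (simp add: cscale_left_mult)

lemma cscale_eq_mult_right: "x * cscale c y = cscale c (x * (y::'a::cstar_algebra))"
  by (simp add: cscale_right_mult)

lemma cscale_scaleR: "cscale c (r *\<^sub>R x) = r *\<^sub>R cscale c (x::'a::cstar_algebra)"
  by (metis cscale_mult cscale_of_real mult.commute)

lemma cstar_zero [simp]: "cstar (0::'a::cstar_algebra) = 0"
  using cstar_add[of 0 "0::'a"] by simp

lemma cstar_minus: "cstar (- x) = - cstar (x::'a::cstar_algebra)"
  using cstar_add[of x "- x"] by (simp add: eq_neg_iff_add_eq_0 add.commute)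

lemma cstar_diff: "cstar (x - y) = cstar x - cstar (y::'a::cstar_algebra)"
  using cstar_add[of x "- y"] by (simp add: cstar_minus)

lemma cstar_scaleR: "cstar (r *\<^sub>R x) = r *\<^sub>R cstar (x::'a::cstar_algebra)"
  using cstar_cscale[of "complex_of_real r" x] by (simp add: cscale_of_real)

lemma norm_cstar [simp]: "norm (cstar x) = norm (x::'a::cstar_algebra)"
proof -
  have *: "norm x \<le> norm (cstar x)" for x :: 'a
  proof (cases "x = 0")
    case False
    have "norm x * norm x \<le> norm (cstar x) * norm x"
      using norm_mult_ineq[of "cstar x" x] cstar_identity[of x] by (simp add: power2_eq_square)
    then show ?thesis using False by simp
  qed simp
  show ?thesis using *[of x] *[of "cstar x"] by (simp add: cstar_cstar)
qed

lemma norm_square_selfadjoint: "cstar x = x \<Longrightarrow> norm (x * x) = (norm (x::'a::cstar_algebra))\<^sup>2"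
  using cstar_identity[of x] by simp

lemma cstar_mult_self_eq_0: "cstar x * x = 0 \<Longrightarrow> x = (0::'a::cstar_algebra)"
  using cstar_identity[of x] by simp

lemma bounded_linear_cstar: "bounded_linear (cstar :: 'a::cstar_algebra \<Rightarrow> 'a)"
  by (rule bounded_linear_intro[where K=1]) (auto simp: cstar_add cstar_scaleR)

lemma bounded_linear_cscale: "bounded_linear (cscale c :: 'a::cstar_algebra \<Rightarrow> 'a)"
  by (rule bounded_linear_intro[where K="cmod c"])
     (auto simp: cscale_add_right cscale_scaleR cscale_norm mult.commute)

lemmas tendsto_cstar = bounded_linear.tendsto[OF bounded_linear_cstar]

section \<open>Square roots and positivity in unital C*-algebras\<close>

lemma cstar_one [simp]: "cstar 1 = (1::'a::{cstar_algebra,real_normed_algebra_1})"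
  by (metis cstar_cstar cstar_mult mult.right_neutral mult.left_neutral)

text \<open>The fixed point \<open>y = (x + y\<^sup>2) / 2\<close> satisfies \<open>(1 - y)\<^sup>2 = 1 - x\<close>; on the unit ball the
  increments are dominated by those of the same iteration started from the number 1.\<close>

primrec sqrt_iter :: "'a::real_normed_algebra \<Rightarrow> nat \<Rightarrow> 'a" where
  "sqrt_iter x 0 = 0"
| "sqrt_iter x (Suc n) = (1/2) *\<^sub>R (x + sqrt_iter x n * sqrt_iter x n)"

definition sqrt_lim :: "'a::real_normed_algebra \<Rightarrow> 'a" where
  "sqrt_lim x = lim (sqrt_iter x)"

text \<open>Two elements are linked by an intertwiner \<open>z\<close>, because the comparison of
  \<open>cstar y * y\<close> with \<open>y * cstar y\<close> later needs the root of each.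
  Commutation is the case \<open>x' = x\<close>.\<close>

lemma sqrt_iter_intertwine: "z * x = x' * z \<Longrightarrow> z * sqrt_iter x n = sqrt_iter x' n * z"
proof (induction n)
  case (Suc n)
  have "z * (sqrt_iter x n * sqrt_iter x n) = sqrt_iter x' n * sqrt_iter x' n * z"
    using Suc by (metis mult.assoc)
  then show ?case using Suc.prems by (simp add: algebra_simps)
qed simp

lemma sqrt_iter_real_bounds:
  "0 \<le> sqrt_iter (1::real) n \<and> sqrt_iter (1::real) n \<le> 1
     \<and> sqrt_iter (1::real) n \<le> sqrt_iter (1::real) (Suc n)"
proof (induction n)
  case (Suc n)
  let ?r = "sqrt_iter (1::real) n" and ?s = "sqrt_iter (1::real) (Suc n)"
  have s: "?s = (1 + ?r * ?r) / 2" by simp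
  have "?r * ?r \<le> 1" using Suc by (simp add: mult_le_one)
  then have "0 \<le> ?s" "?s \<le> 1" unfolding s by auto
  moreover have "?r * ?r \<le> ?s * ?s" using Suc by (intro mult_mono) auto
  then have "?s \<le> sqrt_iter (1::real) (Suc (Suc n))"
    using s by simp
  ultimately show ?case by blast
qed simp

lemma sqrt_iter_bounds:
  fixes x :: "'a::real_normed_algebra"
  assumes "norm x \<le> 1"
  shows "norm (sqrt_iter x n) \<le> sqrt_iter (1::real) n \<and>
    norm (sqrt_iter x (Suc n) - sqrt_iter x n) \<le> sqrt_iter (1::real) (Suc n) - sqrt_iter (1::real) n"
proof (induction n)
  case 0
  then show ?case using assms by simp
next
  case (Suc n)
  let ?y = "sqrt_iter x n" and ?z = "sqrt_iter x (Suc n)"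
  let ?r = "sqrt_iter (1::real) n" and ?s = "sqrt_iter (1::real) (Suc n)"
  have a: "norm ?z \<le> ?s"
    using norm_triangle_ineq[of ?y "?z - ?y"] Suc by (simp del: sqrt_iter.simps)
  \<comment> \<open>Consecutive iterates commute, so the difference of their squares factors; this
    carries the bound on the increments from \<open>n\<close> to \<open>n + 1\<close>.\<close>
  have "x * ?y = ?y * x" by (rule sqrt_iter_intertwine) simp
  then have "?y * ?z = ?z * ?y"
    by (intro sqrt_iter_intertwine) simp
  then have yz: "(1/2) *\<^sub>R (x + ?z * ?z) - (1/2) *\<^sub>R (x + ?y * ?y) = (1/2) *\<^sub>R ((?z - ?y) * (?z + ?y))"
    by (simp add: algebra_simps del: sqrt_iter.simps)
  have "sqrt_iter x (Suc (Suc n)) - ?z = (1/2) *\<^sub>R (x + ?z * ?z) - (1/2) *\<^sub>R (x + ?y * ?y)"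
    by (simp only: sqrt_iter.simps)
  also have "\<dots> = (1/2) *\<^sub>R ((?z - ?y) * (?z + ?y))" by (rule yz)
  also have "norm \<dots> = (1/2) * norm ((?z - ?y) * (?z + ?y))" by (simp del: sqrt_iter.simps)
  also have "\<dots> \<le> (1/2) * ((?s - ?r) * (?s + ?r))"
  proof -
    have "norm (?z + ?y) \<le> ?s + ?r"
      using norm_triangle_ineq[of ?z ?y] Suc a by linarith
    then have "norm (?z - ?y) * norm (?z + ?y) \<le> (?s - ?r) * (?s + ?r)"
      using Suc sqrt_iter_real_bounds[of n] by (intro mult_mono) (auto simp del: sqrt_iter.simps)
    then show ?thesis using norm_mult_ineq[of "?z - ?y" "?z + ?y"] by linarith
  qed
  also have "\<dots> = (1/2) * (1 + ?s * ?s) - (1/2) * (1 + ?r * ?r)"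
    by (simp add: algebra_simps del: sqrt_iter.simps)
  also have "\<dots> = sqrt_iter (1::real) (Suc (Suc n)) - ?s"
    by (simp only: sqrt_iter.simps real_scaleR_def)
  finally show ?case using a by blast
qed

lemma sqrt_iter_tendsto:
  fixes x :: "'a::{banach,real_normed_algebra}"
  assumes "norm x \<le> 1"
  shows "sqrt_iter x \<longlonglongrightarrow> sqrt_lim x"
proof -
  let ?r = "sqrt_iter (1::real)"
  have "incseq ?r" using sqrt_iter_real_bounds by (simp add: incseq_Suc_iff del: sqrt_iter.simps)
  then have "convergent ?r"
    using incseq_convergent[of ?r 1] sqrt_iter_real_bounds by (metis convergentI)
  then have "summable (\<lambda>n. ?r (Suc n) - ?r n)"
    using telescope_summable[of ?r] by (auto simp: convergent_def)
  then have "summable (\<lambda>n. sqrt_iter x (Suc n) - sqrt_iter x n)"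
    by (rule summable_comparison_test'[where N = 0]) (use sqrt_iter_bounds[OF assms] in blast)
  then have "convergent (\<lambda>n. \<Sum>k<n. sqrt_iter x (Suc k) - sqrt_iter x k)"
    by (rule iffD1[OF summable_iff_convergent])
  then show ?thesis
    by (simp add: sum_lessThan_telescope convergent_LIMSEQ_iff sqrt_lim_def del: sqrt_iter.simps(2))
qed

lemma sqrt_lim_intertwine:
  fixes x :: "'a::{banach,real_normed_algebra}"
  assumes "norm x \<le> 1" "norm x' \<le> 1" "z * x = x' * z"
  shows "z * sqrt_lim x = sqrt_lim x' * z"
proof -
  have "(\<lambda>n. z * sqrt_iter x n) \<longlonglongrightarrow> z * sqrt_lim x"
    by (intro tendsto_intros sqrt_iter_tendsto assms)
  moreover have "(\<lambda>n. sqrt_iter x' n * z) \<longlonglongrightarrow> sqrt_lim x' * z"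
    by (intro tendsto_intros sqrt_iter_tendsto assms)
  ultimately show ?thesis
    using sqrt_iter_intertwine[OF assms(3)] LIMSEQ_unique by (metis (no_types, lifting) ext)
qed

lemma norm_sqrt_lim:
  fixes x :: "'a::{banach,real_normed_algebra}"
  assumes "norm x \<le> 1" shows "norm (sqrt_lim x) \<le> 1"
proof (rule Lim_bounded)
  show "(\<lambda>n. norm (sqrt_iter x n)) \<longlonglongrightarrow> norm (sqrt_lim x)"
    by (intro tendsto_intros sqrt_iter_tendsto assms)
  show "\<forall>n\<ge>0. norm (sqrt_iter x n) \<le> 1"
    using sqrt_iter_bounds[OF assms] sqrt_iter_real_bounds by (meson order_trans)
qed

lemma sqrt_lim_selfadjoint:
  fixes x :: "'a::cstar_algebra"
  assumes "norm x \<le> 1" "cstar x = x"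
  shows "cstar (sqrt_lim x) = sqrt_lim x"
proof -
  have "cstar (sqrt_iter x n) = sqrt_iter x n" for n
    by (induction n) (auto simp: cstar_scaleR cstar_add cstar_mult assms)
  moreover have "(\<lambda>n. cstar (sqrt_iter x n)) \<longlonglongrightarrow> cstar (sqrt_lim x)"
    by (intro tendsto_cstar sqrt_iter_tendsto assms)
  ultimately show ?thesis
    using LIMSEQ_unique sqrt_iter_tendsto[OF assms(1)] by auto
qed

lemma sqrt_lim_square:
  fixes x :: "'a::{banach,real_normed_algebra_1}"
  assumes "norm x \<le> 1"
  shows "(1 - sqrt_lim x) * (1 - sqrt_lim x) = 1 - x"
proof -
  have 1: "(\<lambda>n. sqrt_iter x (Suc n)) \<longlonglongrightarrow> (1/2) *\<^sub>R (x + sqrt_lim x * sqrt_lim x)"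
    unfolding sqrt_iter.simps by (intro tendsto_intros sqrt_iter_tendsto assms)
  have 2: "(\<lambda>n. sqrt_iter x (Suc n)) \<longlonglongrightarrow> sqrt_lim x"
    by (rule LIMSEQ_Suc[OF sqrt_iter_tendsto[OF assms]])
  have "sqrt_lim x = (1/2) *\<^sub>R (x + sqrt_lim x * sqrt_lim x)"
    by (rule LIMSEQ_unique[OF 2 1])
  then have "2 *\<^sub>R sqrt_lim x = x + sqrt_lim x * sqrt_lim x"
    by (metis (no_types, lifting) scaleR_half_double scaleR_2 scaleR_right_distrib)
  then show ?thesis by (simp add: algebra_simps scaleR_2)
qed

text \<open>Positivity by a norm condition: for self-adjoint \<open>a\<close> it says that the
  spectrum lies in \<open>[0, 2t]\<close>. Sums are then immediate, and for \<open>t > 0\<close> the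
  element \<open>1 - a/t\<close> lies in the unit ball, where the root iteration converges.\<close>

definition cpos :: "'a::{cstar_algebra,real_normed_algebra_1} \<Rightarrow> bool" where
  "cpos a \<longleftrightarrow> cstar a = a \<and> (\<exists>t\<ge>0. norm (t *\<^sub>R 1 - a) \<le> t)"

lemma cpos_selfadjoint: "cpos a \<Longrightarrow> cstar a = a"
  by (simp add: cpos_def)

lemma cpos_add: assumes "cpos a" "cpos b" shows "cpos (a + b)"
proof -
  obtain s t where st: "s \<ge> 0" "norm (s *\<^sub>R 1 - a) \<le> s" "t \<ge> 0" "norm (t *\<^sub>R 1 - b) \<le> t"
    using assms by (auto simp: cpos_def)
  have "(s + t) *\<^sub>R 1 - (a + b) = (s *\<^sub>R 1 - a) + (t *\<^sub>R 1 - b)"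
    by (simp add: algebra_simps)
  moreover have "norm ((s *\<^sub>R 1 - a) + (t *\<^sub>R 1 - b)) \<le> s + t"
    by (intro norm_triangle_le add_mono st)
  ultimately have "norm ((s + t) *\<^sub>R 1 - (a + b)) \<le> s + t" by metis
  then show ?thesis using assms st unfolding cpos_def by (metis add_nonneg_nonneg cstar_add)
qed

lemma cpos_scaleR: assumes "cpos a" "r \<ge> 0" shows "cpos (r *\<^sub>R a)"
proof -
  obtain t where t: "t \<ge> 0" "norm (t *\<^sub>R 1 - a) \<le> t" using assms by (auto simp: cpos_def)
  have "norm ((r * t) *\<^sub>R 1 - r *\<^sub>R a) = r * norm (t *\<^sub>R 1 - a)"
    using assms(2) by (metis abs_of_nonneg norm_scaleR scaleR_diff_right scaleR_scaleR)
  also have "\<dots> \<le> r * t" using t assms by (simp add: mult_left_mono)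
  finally show ?thesis using assms t unfolding cpos_def by (metis cstar_scaleR mult_nonneg_nonneg)
qed

lemma cpos_sum: "(\<And>i. i \<in> S \<Longrightarrow> cpos (f i)) \<Longrightarrow> cpos (sum f S)"
proof (induction S rule: infinite_finite_induct)
  case (insert x F) then show ?case by (simp add: cpos_add)
qed (auto simp: cpos_def intro: exI[of _ 0])

lemma cpos_norm_diff: "cstar a = a \<Longrightarrow> norm a \<le> t \<Longrightarrow> cpos (t *\<^sub>R 1 - a)"
  unfolding cpos_def by (auto simp: cstar_diff cstar_scaleR intro!: exI[of _ t] order_trans[OF norm_ge_zero])

lemma cpos_one: "cpos 1"
  unfolding cpos_def by (auto intro: exI[of _ 1])

text \<open>The norm condition persists when \<open>t\<close> grows, so two positive elements can be
  rescaled by one common \<open>t\<close> before their roots are taken.\<close>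

lemma cpos_bounded: assumes "cpos a" obtains t where "t > 0" "\<And>s. s \<ge> t \<Longrightarrow> norm (s *\<^sub>R 1 - a) \<le> s"
proof -
  obtain t where t: "t \<ge> 0" "norm (t *\<^sub>R 1 - a) \<le> t" using assms by (auto simp: cpos_def)
  have "norm (s *\<^sub>R 1 - a) \<le> s" if "s \<ge> t + 1" for s
  proof -
    have "s *\<^sub>R 1 - a = (s - t) *\<^sub>R 1 + (t *\<^sub>R 1 - a)" by (simp add: algebra_simps)
    moreover have "norm ((s - t) *\<^sub>R 1 + (t *\<^sub>R 1 - a)) \<le> s"
      by (rule norm_triangle_le) (use t that in simp)
    ultimately show ?thesis by metis
  qed
  with t(1) show thesis by (intro that[of "t + 1"]) auto
qed

text \<open>Both roots come from the same iteration, applied to \<open>1 - a/t\<close> and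
  \<open>1 - a'/t\<close> with a common \<open>t\<close>, so an intertwiner of the elements also
  intertwines the roots.\<close>

lemma cpos_sqrt_intertwine:
  fixes a a' z :: "'a::{cstar_algebra,real_normed_algebra_1}"
  assumes "cpos a" "cpos a'" "z * a = a' * z"
  obtains s s' where "cpos s" "s * s = a" "\<And>w. w * a = a * w \<Longrightarrow> w * s = s * w"
    "cpos s'" "s' * s' = a'" "\<And>w. w * a' = a' * w \<Longrightarrow> w * s' = s' * w" "z * s = s' * z"
proof -
  obtain t1 where t1: "t1 > 0" "\<And>s. s \<ge> t1 \<Longrightarrow> norm (s *\<^sub>R 1 - a) \<le> s"
    using cpos_bounded[OF assms(1)] by metis
  obtain t2 where t2: "t2 > 0" "\<And>s. s \<ge> t2 \<Longrightarrow> norm (s *\<^sub>R 1 - a') \<le> s"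
    using cpos_bounded[OF assms(2)] by metis
  define t where "t = max t1 t2"
  have t: "t > 0" "norm (t *\<^sub>R 1 - a) \<le> t" "norm (t *\<^sub>R 1 - a') \<le> t"
    using t1 t2 by (auto simp: t_def)
  define f :: "'a \<Rightarrow> 'a" where "f b = 1 - (1/t) *\<^sub>R b" for b
  define g :: "'a \<Rightarrow> 'a" where "g b = sqrt t *\<^sub>R (1 - sqrt_lim (f b))" for b
  have nf: "norm (f b) \<le> 1" if "norm (t *\<^sub>R 1 - b) \<le> t" for b
  proof -
    have "f b = (1/t) *\<^sub>R (t *\<^sub>R 1 - b)" using t by (simp add: f_def algebra_simps)
    then show ?thesis using that t by (simp add: divide_le_eq)
  qed
  have sq: "g b * g b = b" if "norm (t *\<^sub>R 1 - b) \<le> t" for b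
    using sqrt_lim_square[OF nf[OF that]] t by (simp add: g_def f_def)
  have pos: "cpos (g b)" if "norm (t *\<^sub>R 1 - b) \<le> t" "cpos b" for b
    unfolding g_def
  proof (rule cpos_scaleR)
    have "cstar (f b) = f b" using that(2) by (simp add: f_def cpos_def cstar_diff cstar_scaleR)
    then show "cpos (1 - sqrt_lim (f b))"
      using cpos_norm_diff[OF sqrt_lim_selfadjoint norm_sqrt_lim] nf[OF that(1)] by simp
  qed (use t in simp)
  have tw: "w * g b = g b' * w"
    if "norm (t *\<^sub>R 1 - b) \<le> t" "norm (t *\<^sub>R 1 - b') \<le> t" "w * b = b' * w" for b b' w
    using sqrt_lim_intertwine[OF nf[OF that(1)] nf[OF that(2)], of w] that(3)
    by (simp add: g_def f_def algebra_simps)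
  show thesis
    by (rule that[of "g a" "g a'"]; (rule pos sq tw)?; (rule t assms)?; assumption?)
qed

lemma cpos_sqrt:
  assumes "cpos a"
  obtains s where "cpos s" "s * s = a" "\<And>w. w * a = a * w \<Longrightarrow> w * s = s * w"
proof -
  have "1 * a = a * 1" by simp
  then show thesis by (rule cpos_sqrt_intertwine[OF assms assms]) (rule that; assumption)
qed

text \<open>For \<open>norm y \<le> 1\<close> let \<open>s\<close> be the root of
  \<open>1 - y * y\<close> and \<open>u = y + i s\<close>. Then \<open>cstar u * u = 1\<close>,
  while \<open>u * u + cstar u * cstar u\<close> is twice \<open>2 y * y - 1\<close>. Hence
  \<open>norm (2 y * y - 1) \<le> 1\<close>, which is the positivity condition with
  \<open>t = 1/2\<close>. The general case is a rescaling.\<close>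

lemma cpos_square:
  assumes "cstar y = (y::'a::{cstar_algebra,real_normed_algebra_1})"
  shows "cpos (y * y)"
proof -
  have main: "cpos (y * y)" if y: "cstar y = y" "norm y \<le> 1" for y :: 'a
  proof -
    let ?x = "y * y"
    have x: "norm ?x \<le> 1" "cstar ?x = ?x"
      using y by (auto simp: cstar_mult norm_square_selfadjoint power_le_one)
    define s where "s = 1 - sqrt_lim ?x"
    have s: "cstar s = s" "s * s = 1 - ?x" "y * s = s * y"
      using sqrt_lim_selfadjoint[OF x] sqrt_lim_square[OF x(1)] sqrt_lim_intertwine[OF x(1) x(1), of y]
      by (auto simp: s_def cstar_diff mult.assoc algebra_simps)
    define u where "u = y + cscale \<i> s"
    have us: "cstar u = y - cscale \<i> s"
      using y s by (simp add: u_def cstar_add cstar_cscale cscale_minus_left)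
    have "cstar u * u = 1"
      unfolding us unfolding u_def using s by (simp add: algebra_simps cscale_eq_mult_left cscale_eq_mult_right
          cscale_mult cscale_minus_left cscale_one cscale_add_right cscale_diff_right)
    then have "(norm u)\<^sup>2 = 1" using cstar_identity[of u] by simp
    then have nu: "norm u = 1" by (metis norm_ge_zero one_power2 power2_eq_imp_eq zero_le_one)
    have "u * u + cstar u * cstar u = 2 *\<^sub>R (2 *\<^sub>R ?x - 1)"
      unfolding us unfolding u_def using s by (simp add: algebra_simps cscale_eq_mult_left cscale_eq_mult_right
          cscale_mult cscale_minus_left cscale_one cscale_add_right cscale_diff_right scaleR_2)
    moreover have "norm (u * u + cstar u * cstar u) \<le> 2"
      using norm_triangle_ineq[of "u * u" "cstar u * cstar u"] norm_mult_ineq[of u u]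
        norm_mult_ineq[of "cstar u" "cstar u"] nu by simp
    ultimately have "norm (2 *\<^sub>R ?x - 1) \<le> 1" by simp
    moreover have "(1/2) *\<^sub>R 1 - ?x = (- 1/2) *\<^sub>R (2 *\<^sub>R ?x - 1)" by (simp add: algebra_simps)
    ultimately have "norm ((1/2) *\<^sub>R 1 - ?x) \<le> 1/2" by simp
    then show ?thesis using x unfolding cpos_def by (intro conjI exI[of _ "1/2"]) auto
  qed
  define r where "r = norm y + 1"
  have r: "r > 0" "norm ((1/r) *\<^sub>R y) \<le> 1"
    by (auto simp: r_def divide_le_eq add_nonneg_pos)
  have "y * y = (r * r) *\<^sub>R (((1/r) *\<^sub>R y) * ((1/r) *\<^sub>R y))" using r by simp
  moreover have "cpos ((r * r) *\<^sub>R (((1/r) *\<^sub>R y) * ((1/r) *\<^sub>R y)))"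
    by (rule cpos_scaleR[OF main]) (use r assms in \<open>auto simp: cstar_scaleR\<close>)
  ultimately show ?thesis by metis
qed

lemma cpos_conj:
  assumes "cpos a" "cstar b = b" "a * b = b * a" shows "cpos (b * a * b)"
proof -
  obtain s where s: "cpos s" "s * s = a" "\<And>w. w * a = a * w \<Longrightarrow> w * s = s * w"
    using cpos_sqrt[OF assms(1)] by metis
  have "b * s = s * b" using s(3) assms(3) by metis
  then have "b * a * b = (s * b) * (s * b)" using s(2) by (metis mult.assoc)
  moreover have "cstar (s * b) = s * b"
    using s(1) assms(2) \<open>b * s = s * b\<close> by (simp add: cstar_mult cpos_selfadjoint)
  ultimately show ?thesis using cpos_square by metis
qed

lemma cpos_mult:
  assumes "cpos a" "cpos b" "a * b = b * a" shows "cpos (a * b)"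
proof -
  obtain s where s: "cpos s" "s * s = a" "\<And>w. w * a = a * w \<Longrightarrow> w * s = s * w"
    using cpos_sqrt[OF assms(1)] by metis
  have "b * s = s * b" using s(3) assms by metis
  then have "a * b = s * b * s" using s(2) by (metis mult.assoc)
  then show ?thesis using cpos_conj[OF assms(2), of s] s(1) \<open>b * s = s * b\<close> by (simp add: cpos_selfadjoint)
qed

text \<open>The roots \<open>y\<close> of \<open>a\<close> and \<open>z\<close> of
  \<open>t - a\<close> commute, so \<open>u = y + i z\<close> satisfies
  \<open>cstar u * u = t\<close>. Thus \<open>norm u\<close> is the square root of \<open>t\<close>,
  and \<open>y\<close> is the real part of \<open>u\<close>.\<close>

lemma cpos_norm_le:
  assumes "cpos a" "cpos (t *\<^sub>R 1 - a)" "t \<ge> 0" shows "norm a \<le> t"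
proof -
  obtain y where y: "cpos y" "y * y = a" "\<And>w. w * a = a * w \<Longrightarrow> w * y = y * w"
    using cpos_sqrt[OF assms(1)] by metis
  obtain z where z: "cpos z" "z * z = t *\<^sub>R 1 - a"
      "\<And>w. w * (t *\<^sub>R 1 - a) = (t *\<^sub>R 1 - a) * w \<Longrightarrow> w * z = z * w"
    using cpos_sqrt[OF assms(2)] by metis
  have "y * a = a * y" using y(2) by (metis mult.assoc)
  then have yz: "y * z = z * y" by (intro z(3)) (simp add: algebra_simps)
  define u where "u = y + cscale \<i> z"
  have us: "cstar u = y - cscale \<i> z"
    using y(1) z(1) by (simp add: u_def cstar_add cstar_cscale cscale_minus_left cpos_selfadjoint)
  have uu: "cstar u * u = t *\<^sub>R 1"
    unfolding us unfolding u_def using y(2) z(2) yz by (simp add: algebra_simps cscale_eq_mult_left cscale_eq_mult_right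
          cscale_mult cscale_minus_left cscale_one cscale_add_right cscale_diff_right)
  have t: "(norm u)\<^sup>2 = t" using cstar_identity[of u] uu assms(3) by simp
  have "u + cstar u = y + y" unfolding us unfolding u_def by simp
  then have "y = (1/2) *\<^sub>R (u + cstar u)" by (simp add: scaleR_half_double)
  then have "norm y \<le> norm u" using norm_triangle_ineq[of u "cstar u"] by simp
  then show ?thesis
    using t norm_square_selfadjoint[of y] y(1,2) power_mono[of "norm y" "norm u" 2]
    by (simp add: cpos_selfadjoint)
qed

lemma cpos_antisym: "cpos a \<Longrightarrow> cpos (- a) \<Longrightarrow> a = 0"
  using cpos_norm_le[of a 0] by simp

lemma cpos_norm_mono:
  assumes "cpos a" "cpos (b - a)" shows "norm a \<le> norm b"
proof (rule cpos_norm_le[OF assms(1)])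
  have "cstar b = b" using cpos_add[OF assms] by (simp add: cpos_selfadjoint)
  then show "cpos (norm b *\<^sub>R 1 - a)"
    using cpos_add[OF cpos_norm_diff[of b "norm b"] assms(2)] by simp
qed simp

text \<open>For \<open>d = a - b\<close> the product \<open>d (a + b)\<close> vanishes, so
  \<open>d a d\<close> and \<open>d b d\<close> are positive with sum zero and both vanish. Their
  difference is the cube of \<open>d\<close>, and a self-adjoint nilpotent is zero.\<close>

lemma cpos_square_inject:
  fixes a b :: "'a::{cstar_algebra,real_normed_algebra_1}"
  assumes "cpos a" "cpos b" "a * b = b * a" "a * a = b * b"
  shows "a = b"
proof -
  let ?d = "a - b"
  have d: "cstar ?d = ?d" using assms by (simp add: cstar_diff cpos_selfadjoint)
  have comm: "a * ?d = ?d * a" "b * ?d = ?d * b" using assms(3) by (simp_all add: algebra_simps)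
  have p: "cpos (?d * a * ?d)" "cpos (?d * b * ?d)"
    by (rule cpos_conj; use assms d comm in simp)+
  have "?d * (a + b) = 0" using assms(3,4) by (simp add: algebra_simps)
  then have "?d * a * ?d + ?d * b * ?d = 0"
    by (metis distrib_left distrib_right mult_zero_left)
  then have "?d * b * ?d = - (?d * a * ?d)" by (simp add: eq_neg_iff_add_eq_0 add.commute)
  then have "?d * a * ?d = 0" "?d * b * ?d = 0" using p cpos_antisym by auto
  moreover have "?d * ?d * ?d = ?d * a * ?d - ?d * b * ?d"
    by (simp only: right_diff_distrib[of ?d a b] left_diff_distrib[of "?d * a" "?d * b" ?d])
  ultimately have "?d * ?d * ?d = 0" by simp
  then have "(?d * ?d) * (?d * ?d) = 0" by (metis mult.assoc mult_zero_right)
  moreover have "cstar (?d * ?d) = ?d * ?d" using d by (metis cstar_mult)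
  ultimately have "?d * ?d = 0" using cstar_mult_self_eq_0 by metis
  then have "?d = 0" using cstar_mult_self_eq_0 d by metis
  then show ?thesis by simp
qed

text \<open>From \<open>y\<^sup>*y = - d\<close> the element \<open>g = yy\<^sup>*\<close> is positive as well and \<open>y d = - g y\<close>, so
  \<open>y d\<^sup>2 = g\<^sup>2 y\<close>; taking square roots gives \<open>y d = g y\<close>, hence \<open>y d = 0\<close>.\<close>

lemma cpos_neg_cstar_mult_self:
  fixes y :: "'a::{cstar_algebra,real_normed_algebra_1}"
  assumes "cstar y * y = - d" "cpos d"
  shows "y = 0"
proof -
  define g where "g = y * cstar y"
  \<comment> \<open>\<open>h\<close> and \<open>k\<close> are, up to sign, twice the real and
    imaginary parts of \<open>y\<close>. Half the sum of their squares is
    \<open>y * cstar y + cstar y * y\<close>, so \<open>g\<close> is that half plus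
    \<open>d\<close>.\<close>
  define h where "h = y + cstar y"
  define k where "k = cscale \<i> (y - cstar y)"
  have hk: "cstar h = h" "cstar k = k"
    by (simp_all add: h_def k_def cstar_add cstar_cscale cstar_cstar cstar_diff cscale_minus_left
        cscale_diff_right)
  have "h * h + k * k = 2 *\<^sub>R (y * cstar y + cstar y * y)"
    by (simp add: h_def k_def algebra_simps cscale_eq_mult_left cscale_eq_mult_right cscale_mult
        cscale_minus_left cscale_one cscale_diff_right scaleR_2)
  then have "g = (1/2) *\<^sub>R (h * h + k * k) + d" using assms(1) by (simp add: g_def)
  then have g: "cpos g"
    using cpos_add[OF cpos_scaleR[OF cpos_add[OF cpos_square[OF hk(1)] cpos_square[OF hk(2)]], of "1/2"] assms(2)]
    by simp
  have d: "d = - (cstar y * y)" using assms(1) by simp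
  have yd: "y * d = - (g * y)" by (simp add: d g_def mult.assoc)
  have "y * (d * d) = y * d * d" by (simp add: mult.assoc)
  also have "\<dots> = - (g * (y * d))" by (subst yd) (simp add: mult.assoc)
  also have "\<dots> = g * g * y" by (simp only: yd) (simp add: mult.assoc)
  finally have tw: "y * (d * d) = (g * g) * y" .
  have sd: "cpos (d * d)" "cpos (g * g)" by (intro cpos_square cpos_selfadjoint g assms)+
  obtain s s' where s: "cpos s" "s * s = d * d" "\<And>w. w * (d * d) = (d * d) * w \<Longrightarrow> w * s = s * w"
    "cpos s'" "s' * s' = g * g" "\<And>w. w * (g * g) = (g * g) * w \<Longrightarrow> w * s' = s' * w" "y * s = s' * y"
    using cpos_sqrt_intertwine[OF sd tw] by metis
  have "d * s = s * d" by (rule s(3)) (simp add: mult.assoc)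
  then have "s = d" by (intro cpos_square_inject[OF s(1) assms(2) _ s(2)]) simp
  moreover have "g * s' = s' * g" by (rule s(6)) (simp add: mult.assoc)
  then have "s' = g" by (intro cpos_square_inject[OF s(4) g _ s(5)]) simp
  ultimately have "y * d = g * y" using s(7) by simp
  then have "y * d + y * d = 0" using yd by (metis add.left_inverse)
  then have "y * d = 0" by (simp flip: scaleR_2)
  moreover have "d * d = - (cstar y * (y * d))" by (subst (1) d) (simp add: mult.assoc)
  ultimately have "d * d = 0" by simp
  then have "d = 0" using cstar_mult_self_eq_0[of d] assms(2) by (simp add: cpos_selfadjoint)
  then show ?thesis using assms(1) cstar_mult_self_eq_0[of y] by simp
qed

text \<open>With \<open>m = |c|\<close> for \<open>c = x\<^sup>*x\<close> and \<open>y = x (m - c)\<close> one finds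
  \<open>y\<^sup>*y = - (m - c) m (m - c)\<close>, so \<open>y = 0\<close> and \<open>c = m\<close>.\<close>

lemma cpos_cstar_mult_self:
  fixes x :: "'a::{cstar_algebra,real_normed_algebra_1}"
  shows "cpos (cstar x * x)"
proof -
  define c where "c = cstar x * x"
  have c: "cstar c = c" by (simp add: c_def cstar_mult cstar_cstar)
  obtain m where m: "cpos m" "m * m = c * c" "\<And>w. w * (c * c) = (c * c) * w \<Longrightarrow> w * m = m * w"
    using cpos_sqrt[OF cpos_square[OF c]] by metis
  have cm: "c * m = m * c" by (rule m(3)) (simp add: mult.assoc)
  let ?d = "m - c"
  have d: "cstar ?d = ?d" using m(1) c by (simp add: cstar_diff cpos_selfadjoint)
  have mc: "m * ?d = - (c * ?d)" using cm m(2) by (simp add: algebra_simps)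
  have "cstar (x * ?d) * (x * ?d) = ?d * c * ?d" using d by (simp add: cstar_mult c_def mult.assoc)
  also have "\<dots> = - (?d * m * ?d)" using mc by (simp add: mult.assoc)
  finally have "x * ?d = 0"
    by (rule cpos_neg_cstar_mult_self) (rule cpos_conj, use m(1) d cm in \<open>auto simp: algebra_simps\<close>)
  then have "c * ?d = 0" by (simp add: c_def mult.assoc)
  then have "?d * ?d = 0" using mc by (simp add: left_diff_distrib)
  then have "?d = 0" using cstar_mult_self_eq_0 d by metis
  then show ?thesis using m(1) by (simp add: c_def)
qed

lemma cpos_conjugate:
  assumes "cpos a" shows "cpos (cstar x * a * x)"
proof -
  obtain s where s: "cpos s" "s * s = a" using cpos_sqrt[OF assms] by metis
  have "cstar x * a * x = cstar (s * x) * (s * x)"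
    unfolding s(2)[symmetric] using s(1) by (simp add: cstar_mult cpos_selfadjoint mult.assoc)
  then show ?thesis using cpos_cstar_mult_self by metis
qed

lemma cpos_power: assumes "cpos a" shows "cpos (a ^ n)"
proof (induction n)
  case (Suc n)
  then show ?case using cpos_mult[OF assms, of "a ^ n"] by (simp add: power_commutes)
qed (simp add: cpos_one)

text \<open>By induction, \<open>(1 - h)\<^sup>n (1 + n h) \<le> 1\<close>.\<close>

lemma norm_mult_one_minus_power:
  fixes h :: "'a::{cstar_algebra,real_normed_algebra_1}"
  assumes h: "cpos h" "cpos (1 - h)"
  shows "real n * norm (h * (1 - h) ^ n) \<le> 1"
proof -
  define s where "s = 1 - h"
  have s: "cpos (s ^ n)" for n using h by (simp add: s_def cpos_power)
  have hs: "h * s ^ n = s ^ n * h" for n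
  proof -
    have "h * s = s * h" by (simp add: s_def algebra_simps)
    then show ?thesis by (metis power_commuting_commutes)
  qed
  have *: "cpos (1 - s ^ n * (1 + real n *\<^sub>R h))" for n
  proof (induction n)
    case 0 show ?case by (simp add: cpos_def) (rule exI[of _ 0], simp)
  next
    case (Suc n)
    have "s ^ Suc n * (1 + real (Suc n) *\<^sub>R h) = s ^ n * (s * (1 + real (Suc n) *\<^sub>R h))"
      by (metis mult.assoc power_Suc2)
    also have "s * (1 + real (Suc n) *\<^sub>R h) = 1 + real n *\<^sub>R h - real (Suc n) *\<^sub>R (h * h)"
      by (simp add: s_def algebra_simps)
    finally have "1 - s ^ Suc n * (1 + real (Suc n) *\<^sub>R h)
        = (1 - s ^ n * (1 + real n *\<^sub>R h)) + real (Suc n) *\<^sub>R (s ^ n * (h * h))"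
      by (simp add: algebra_simps)
    moreover have "cpos (s ^ n * (h * h))"
      using h hs by (intro cpos_mult s cpos_square) (auto simp: cpos_selfadjoint, metis mult.assoc)
    ultimately show ?case using Suc cpos_add cpos_scaleR of_nat_0_le_iff by metis
  qed
  have hp: "cpos (real n *\<^sub>R (h * s ^ n))" using h hs s by (intro cpos_scaleR cpos_mult) auto
  have "cpos (1 *\<^sub>R 1 - real n *\<^sub>R (h * s ^ n))"
    using cpos_add[OF *[of n] s[of n]] hs by (simp add: algebra_simps)
  from cpos_norm_le[OF hp this] show ?thesis by (simp add: s_def)
qed

lemma cpos_one_minus_power:
  fixes s :: "'a::{cstar_algebra,real_normed_algebra_1}"
  assumes "cpos s" "cpos (1 - s)"
  shows "cpos (1 - s ^ n)"
proof (induction n)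
  case 0 show ?case by (simp add: cpos_def) (rule exI[of _ 0], simp)
next
  case (Suc n)
  have "1 - s ^ Suc n = (1 - s) + s * (1 - s ^ n)" by (simp add: algebra_simps)
  moreover have "cpos (s * (1 - s ^ n))"
    by (rule cpos_mult) (use assms Suc in \<open>auto simp: algebra_simps power_commutes\<close>)
  ultimately show ?case using assms cpos_add by metis
qed

section \<open>Unitization\<close>

datatype 'a unitz = Unitz (uscal: complex) (uelt: 'a)

definition lact :: "'a::cstar_algebra unitz \<Rightarrow> 'a \<Rightarrow> 'a" where
  "lact x z = cscale (uscal x) z + uelt x * z"

lemma bounded_linear_lact: "bounded_linear (lact x)"
  unfolding lact_def
  by (intro bounded_linear_add bounded_linear_cscale bounded_linear_mult_right)

instantiation unitz :: (cstar_algebra) real_algebra_1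
begin

definition zero_unitz :: "'a unitz" where "0 = Unitz 0 0"
definition one_unitz :: "'a unitz" where "1 = Unitz 1 0"
definition plus_unitz :: "'a unitz \<Rightarrow> 'a unitz \<Rightarrow> 'a unitz" where
  "x + y = Unitz (uscal x + uscal y) (uelt x + uelt y)"
definition minus_unitz :: "'a unitz \<Rightarrow> 'a unitz \<Rightarrow> 'a unitz" where
  "x - y = Unitz (uscal x - uscal y) (uelt x - uelt y)"
definition uminus_unitz :: "'a unitz \<Rightarrow> 'a unitz" where
  "- x = Unitz (- uscal x) (- uelt x)"
definition times_unitz :: "'a unitz \<Rightarrow> 'a unitz \<Rightarrow> 'a unitz" where
  "x * y = Unitz (uscal x * uscal y)
     (cscale (uscal x) (uelt y) + cscale (uscal y) (uelt x) + uelt x * uelt y)"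
definition scaleR_unitz :: "real \<Rightarrow> 'a unitz \<Rightarrow> 'a unitz" where
  "r *\<^sub>R x = Unitz (r *\<^sub>R uscal x) (r *\<^sub>R uelt x)"

lemmas unitz_ops_def = zero_unitz_def one_unitz_def plus_unitz_def minus_unitz_def
  uminus_unitz_def times_unitz_def scaleR_unitz_def

instance
  by standard
     (auto simp: unitz_ops_def algebra_simps cscale_add_left cscale_add_right cscale_mult
       cscale_eq_mult_left cscale_eq_mult_right cscale_one cscale_scaleR
       cscale_of_real[symmetric] scaleR_conv_of_real)

end

lemma unitz_sel [simp]:
  "uscal 0 = 0" "uelt (0::'a::cstar_algebra unitz) = 0"
  "uscal 1 = 1" "uelt (1::'a::cstar_algebra unitz) = 0"
  "uscal (x + y) = uscal x + uscal y" "uelt (x + y) = uelt x + uelt (y::'a::cstar_algebra unitz)"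
  "uscal (x - y) = uscal x - uscal y" "uelt (x - y) = uelt x - uelt (y::'a::cstar_algebra unitz)"
  "uscal (- x) = - uscal x" "uelt (- x) = - uelt x"
  "uscal (x * y) = uscal x * uscal y"
  "uelt (x * y) = cscale (uscal x) (uelt y) + cscale (uscal y) (uelt x) + uelt x * uelt y"
  "uscal (r *\<^sub>R x) = r *\<^sub>R uscal x" "uelt (r *\<^sub>R x) = r *\<^sub>R uelt x"
  by (simp_all add: unitz_ops_def)

lemma cscale_scaleR_left: "cscale (r *\<^sub>R c) x = r *\<^sub>R cscale c (x::'a::cstar_algebra)"
  by (metis cscale_mult cscale_of_real scaleR_conv_of_real)

lemma lact_simps:
  "lact (x + y) z = lact x z + lact y z" "lact (r *\<^sub>R x) z = r *\<^sub>R lact x z"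
  "lact (x * y) z = lact x (lact y z)" "lact 1 z = z" "lact 0 z = 0"
  by (simp_all add: lact_def algebra_simps cscale_add_left cscale_add_right cscale_mult cscale_one
       cscale_eq_mult_left cscale_eq_mult_right cscale_scaleR_left)

text \<open>Taking the maximum with the modulus of the scalar part makes this a C*-norm on
  \<open>\<complex> \<oplus> A\<close> whether or not \<open>A\<close> already has a unit.\<close>

instantiation unitz :: (cstar_algebra) real_normed_algebra_1
begin

definition norm_unitz where
  "norm (x :: 'a unitz) = max (cmod (uscal x)) (onorm (lact x))"
definition sgn_unitz where
  "sgn (x :: 'a unitz) = inverse (norm x) *\<^sub>R x"
definition dist_unitz where
  "dist (x :: 'a unitz) y = norm (x - y)"
definition uniformity_unitz where
  "(uniformity :: ('a unitz \<times> 'a unitz) filter) = (INF e\<in>{0 <..}. principal {(x, y). dist x y < e})"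
definition open_unitz where
  "open (U :: 'a unitz set) = (\<forall>x\<in>U. eventually (\<lambda>(x', y). x' = x \<longrightarrow> y \<in> U) uniformity)"

lemma norm_lact: "norm (lact (x :: 'a unitz) z) \<le> norm x * norm z"
proof -
  have "norm (lact x z) \<le> onorm (lact x) * norm z" by (rule onorm[OF bounded_linear_lact])
  also have "\<dots> \<le> norm x * norm z" by (intro mult_right_mono) (auto simp: norm_unitz_def)
  finally show ?thesis .
qed

lemma cmod_uscal_le: "cmod (uscal (x :: 'a unitz)) \<le> norm x"
  by (simp add: norm_unitz_def)

lemma norm_unitz_leI:
  assumes "cmod (uscal (x :: 'a unitz)) \<le> b" "\<And>z. norm (lact x z) \<le> b * norm z" shows "norm x \<le> b"
  unfolding norm_unitz_def
  by (rule max.boundedI[OF assms(1) onorm_bound])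
     (use assms order_trans[OF norm_ge_zero] in blast)+

text \<open>Testing the left action on \<open>cstar (uelt x)\<close> recovers
  \<open>norm (uelt x)\<close> through the C*-identity. This estimate yields definiteness of the
  norm, completeness and the lower bound for \<open>emb\<close>.\<close>

lemma norm_uelt_le_lact: "norm (uelt (x :: 'a unitz)) \<le> norm x + cmod (uscal x)"
proof (cases "uelt x = 0")
  case False
  let ?a = "uelt x"
  have "?a * cstar ?a = lact x (cstar ?a) - cscale (uscal x) (cstar ?a)" by (simp add: lact_def)
  then have "norm (?a * cstar ?a) \<le> norm x * norm ?a + cmod (uscal x) * norm ?a"
    using norm_triangle_ineq4[of "lact x (cstar ?a)" "cscale (uscal x) (cstar ?a)"]
      norm_lact[of x "cstar ?a"] by (simp add: cscale_norm)
  moreover have "norm (?a * cstar ?a) = norm ?a * norm ?a"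
    using cstar_identity[of "cstar ?a"] by (simp add: cstar_cstar power2_eq_square)
  ultimately have "norm ?a * norm ?a \<le> (norm x + cmod (uscal x)) * norm ?a" by (simp add: algebra_simps)
  then show ?thesis using False by simp
qed (simp add: norm_unitz_def le_max_iff_disj)

instance
proof
  fix x y :: "'a unitz" and r :: real
  show "dist x y = norm (x - y)" by (rule dist_unitz_def)
  show "sgn x = inverse (norm x) *\<^sub>R x" by (rule sgn_unitz_def)
  show "uniformity = (INF e\<in>{0 <..}. principal {(x, y :: 'a unitz). dist x y < e})"
    by (rule uniformity_unitz_def)
  show "open U = (\<forall>x\<in>U. eventually (\<lambda>(x', y). x' = x \<longrightarrow> y \<in> U) uniformity)" for U :: "'a unitz set"
    by (rule open_unitz_def)
  have nonneg: "norm z \<ge> 0" for z :: "'a unitz" by (simp add: norm_unitz_def le_max_iff_disj)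
  show "(norm x = 0) = (x = 0)"
  proof
    assume "norm x = 0"
    then have "uscal x = 0" "uelt x = 0"
      using cmod_uscal_le[of x] norm_uelt_le_lact[of x] by auto
    then show "x = 0" by (simp add: unitz.expand)
  next
    assume "x = 0"
    then have "norm x \<le> 0" by (intro norm_unitz_leI) (auto simp: lact_simps)
    then show "norm x = 0" using nonneg[of x] by simp
  qed
  show "norm (x + y) \<le> norm x + norm y"
  proof (rule norm_unitz_leI)
    show "cmod (uscal (x + y)) \<le> norm x + norm y"
      using cmod_uscal_le[of x] cmod_uscal_le[of y] by (simp add: norm_triangle_mono)
    show "norm (lact (x + y) z) \<le> (norm x + norm y) * norm z" for z
      using norm_lact[of x z] norm_lact[of y z] by (simp add: lact_simps distrib_right norm_triangle_mono)
  qed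
  have le: "norm (r *\<^sub>R x) \<le> \<bar>r\<bar> * norm x" for r and x :: "'a unitz"
  proof (rule norm_unitz_leI)
    show "cmod (uscal (r *\<^sub>R x)) \<le> \<bar>r\<bar> * norm x" using cmod_uscal_le[of x] by (simp add: mult_left_mono)
    show "norm (lact (r *\<^sub>R x) z) \<le> \<bar>r\<bar> * norm x * norm z" for z
      using norm_lact[of x z] by (simp add: lact_simps mult_left_mono mult.assoc)
  qed
  show "norm (r *\<^sub>R x) = \<bar>r\<bar> * norm x"
  proof (cases "r = 0")
    case True
    then show ?thesis using le[of r x] nonneg[of "r *\<^sub>R x"] by simp
  next
    case False
    have "norm x \<le> \<bar>inverse r\<bar> * norm (r *\<^sub>R x)" using le[of "inverse r" "r *\<^sub>R x"] False by simp
    then have "\<bar>r\<bar> * norm x \<le> norm (r *\<^sub>R x)" using False by (simp add: field_simps)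
    then show ?thesis using le[of r x] by simp
  qed
  show "norm (x * y) \<le> norm x * norm y"
  proof (rule norm_unitz_leI)
    show "cmod (uscal (x * y)) \<le> norm x * norm y"
      using cmod_uscal_le[of x] cmod_uscal_le[of y] nonneg by (simp add: norm_mult mult_mono)
    show "norm (lact (x * y) z) \<le> norm x * norm y * norm z" for z
    proof -
      have "norm (lact x (lact y z)) \<le> norm x * norm (lact y z)" by (rule norm_lact)
      also have "\<dots> \<le> norm x * (norm y * norm z)" by (intro mult_left_mono norm_lact nonneg)
      finally show ?thesis by (simp add: lact_simps mult.assoc)
    qed
  qed
  have "norm (1::'a unitz) \<le> 1" by (rule norm_unitz_leI) (auto simp: lact_simps)
  then show "norm (1::'a unitz) = 1" using cmod_uscal_le[of "1::'a unitz"] by simp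
qed

end

lemma norm_unitz_le: "norm x \<le> cmod (uscal x) + norm (uelt (x::'a::cstar_algebra unitz))"
proof (rule norm_unitz_leI)
  show "norm (lact x z) \<le> (cmod (uscal x) + norm (uelt x)) * norm z" for z
    unfolding lact_def
    by (rule order_trans[OF norm_triangle_ineq])
       (simp add: cscale_norm distrib_right norm_mult_ineq)
qed simp

lemma norm_uelt_le: "norm (uelt x) \<le> 2 * norm (x::'a::cstar_algebra unitz)"
  using norm_uelt_le_lact[of x] cmod_uscal_le[of x] by simp

instance unitz :: (cstar_algebra) banach
proof
  fix X :: "nat \<Rightarrow> 'a unitz"
  assume X: "Cauchy X"
  have "Cauchy (\<lambda>n. uscal (X n))"
  proof (rule CauchyI)
    fix e :: real assume "0 < e"
    then obtain M where M: "\<forall>m\<ge>M. \<forall>n\<ge>M. norm (X m - X n) < e" using CauchyD[OF X] by blast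
    have "norm (uscal (X m) - uscal (X n)) < e" if "m \<ge> M" "n \<ge> M" for m n
      using cmod_uscal_le[of "X m - X n"] M that by (simp add: le_less_trans)
    then show "\<exists>M. \<forall>m\<ge>M. \<forall>n\<ge>M. norm (uscal (X m) - uscal (X n)) < e" by blast
  qed
  then obtain l where l: "(\<lambda>n. uscal (X n)) \<longlonglongrightarrow> l" using Cauchy_convergent convergent_def by blast
  have "Cauchy (\<lambda>n. uelt (X n))"
  proof (rule CauchyI)
    fix e :: real assume "0 < e"
    then have "0 < e / 2" by simp
    then obtain M where M: "\<forall>m\<ge>M. \<forall>n\<ge>M. norm (X m - X n) < e / 2" using CauchyD[OF X] by blast
    have "norm (uelt (X m) - uelt (X n)) < e" if "m \<ge> M" "n \<ge> M" for m n
    proof -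
      have "norm (X m - X n) < e / 2" using M that by blast
      then show ?thesis using norm_uelt_le[of "X m - X n"] by simp
    qed
    then show "\<exists>M. \<forall>m\<ge>M. \<forall>n\<ge>M. norm (uelt (X m) - uelt (X n)) < e" by blast
  qed
  then obtain a where a: "(\<lambda>n. uelt (X n)) \<longlonglongrightarrow> a" using Cauchy_convergent convergent_def by blast
  have "(\<lambda>n. cmod (uscal (X n) - l) + norm (uelt (X n) - a)) \<longlonglongrightarrow> 0 + 0"
    by (intro tendsto_add tendsto_norm_zero LIM_zero l a)
  then have 0: "(\<lambda>n. cmod (uscal (X n) - l) + norm (uelt (X n) - a)) \<longlonglongrightarrow> 0" by simp
  have "(\<lambda>n. X n - Unitz l a) \<longlonglongrightarrow> 0"
    by (rule tendsto_0_le[OF 0, where K = 1])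
       (auto intro!: always_eventually order_trans[OF norm_unitz_le])
  then show "convergent X" using LIM_zero_cancel convergent_def by blast
qed

instantiation unitz :: (cstar_algebra) cstar_algebra
begin

definition cscale_unitz :: "complex \<Rightarrow> 'a unitz \<Rightarrow> 'a unitz" where
  "cscale c x = Unitz (c * uscal x) (cscale c (uelt x))"
definition cstar_unitz :: "'a unitz \<Rightarrow> 'a unitz" where
  "cstar x = Unitz (cnj (uscal x)) (cstar (uelt x))"

instance
proof
  fix x y :: "'a unitz" and c d :: complex and r :: real
  have lc: "lact (cscale c x) z = cscale c (lact x z)" for c and x :: "'a unitz" and z
    by (simp add: lact_def cscale_unitz_def cscale_add_right cscale_mult cscale_eq_mult_left)
  have le: "norm (cscale c x) \<le> cmod c * norm x" for c and x :: "'a unitz"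
  proof (rule norm_unitz_leI)
    show "cmod (uscal (cscale c x)) \<le> cmod c * norm x"
      using cmod_uscal_le[of x] by (simp add: cscale_unitz_def norm_mult mult_left_mono)
    show "norm (lact (cscale c x) z) \<le> cmod c * norm x * norm z" for z
      using norm_lact[of x z] by (simp add: lc cscale_norm mult_left_mono mult.assoc)
  qed
  have cc: "cscale c (cscale d x) = cscale (c * d) x" for c d and x :: "'a unitz"
    by (simp add: cscale_unitz_def cscale_mult)
  show "cscale c (cscale d x) = cscale (c * d) x" by (rule cc)
  have one: "cscale 1 x = x" for x :: "'a unitz" by (simp add: cscale_unitz_def cscale_one)
  show "cscale 1 x = x" by (rule one)
  show "norm (cscale c x) = cmod c * norm x"
  proof (cases "c = 0")
    case True
    then show ?thesis using le[of c x] by simp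
  next
    case False
    have "norm x \<le> cmod (inverse c) * norm (cscale c x)"
      using le[of "inverse c" "cscale c x"] False by (simp add: cc one)
    then have "cmod c * norm x \<le> norm (cscale c x)" using False by (simp add: norm_inverse norm_divide field_simps)
    then show ?thesis using le[of c x] by simp
  qed
  \<comment> \<open>The lower half of the C*-identity. It forces the involution to be isometric, and
    submultiplicativity then gives the upper half.\<close>
  have ge: "(norm x)\<^sup>2 \<le> norm (cstar x * x)" for x :: "'a unitz"
  proof -
    have "norm x \<le> sqrt (norm (cstar x * x))"
    proof (rule norm_unitz_leI)
      have "(cmod (uscal x))\<^sup>2 = cmod (uscal (cstar x * x))"
        by (simp add: cstar_unitz_def norm_mult power2_eq_square)
      then show "cmod (uscal x) \<le> sqrt (norm (cstar x * x))"
        using cmod_uscal_le[of "cstar x * x"] by (simp add: real_le_rsqrt)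
      show "norm (lact x z) \<le> sqrt (norm (cstar x * x)) * norm z" for z
      proof -
        \<comment> \<open>\<open>lact x z\<close> lies in \<open>A\<close>, so the C*-identity of
          \<open>A\<close> applies to it and bounds the action of \<open>x\<close> by that of
          \<open>cstar x * x\<close>.\<close>
        have "cstar (lact x z) * lact x z = cstar z * lact (cstar x * x) z"
          by (simp add: lact_simps) (simp add: lact_def cstar_unitz_def cstar_add cstar_mult cstar_cscale
              algebra_simps cscale_eq_mult_left cscale_eq_mult_right cscale_add_right cscale_mult)
        then have "(norm (lact x z))\<^sup>2 = norm (cstar z * lact (cstar x * x) z)"
          by (metis cstar_identity)
        also have "\<dots> \<le> norm z * (norm (cstar x * x) * norm z)"
          using norm_mult_ineq[of "cstar z" "lact (cstar x * x) z"] norm_lact[of "cstar x * x" z]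
          by (smt (verit) mult_left_mono norm_cstar norm_ge_zero)
        also have "\<dots> = (sqrt (norm (cstar x * x)) * norm z)\<^sup>2"
          by (simp add: power_mult_distrib power2_eq_square[of "norm z"])
        finally show ?thesis by (rule power2_le_imp_le) simp
      qed
    qed
    then show ?thesis by (metis norm_ge_zero power_mono real_sqrt_pow2)
  qed
  have ss: "cstar (cstar x) = x" for x :: "'a unitz" by (simp add: cstar_unitz_def cstar_cstar)
  have ns: "norm x \<le> norm (cstar x)" for x :: "'a unitz"
  proof (cases "x = 0")
    case False
    have "norm x * norm x \<le> norm (cstar x) * norm x"
      using ge[of x] norm_mult_ineq[of "cstar x" x] by (simp add: power2_eq_square)
    then show ?thesis using False by simp
  qed simp
  have "norm (cstar x) \<le> norm x" using ns[of "cstar x"] by (simp add: ss)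
  then have "norm (cstar x * x) \<le> norm x * norm x"
    using norm_mult_ineq[of "cstar x" x] by (meson mult_right_mono norm_ge_zero order_trans)
  then show "norm (cstar x * x) = (norm x)\<^sup>2" using ge[of x] by (simp add: power2_eq_square)
  show "cstar (cstar x) = x" by (rule ss)
  show "cscale (complex_of_real r) x = r *\<^sub>R x"
    by (simp add: cscale_unitz_def cscale_of_real unitz_ops_def scaleR_conv_of_real)
  show "cscale (c + d) x = cscale c x + cscale d x" "cscale c (x + y) = cscale c x + cscale c y"
    "cscale c (x * y) = cscale c x * y" "cscale c (x * y) = x * cscale c y"
    "cstar (x + y) = cstar x + cstar y" "cstar (cscale c x) = cscale (cnj c) (cstar x)"
    "cstar (x * y) = cstar y * cstar x"
    by (simp_all add: cscale_unitz_def cstar_unitz_def unitz_ops_def algebra_simps cscale_add_left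
        cscale_add_right cscale_mult cscale_eq_mult_left cscale_eq_mult_right
        cstar_add cstar_cscale cstar_mult)
qed

end

definition emb :: "'a::cstar_algebra \<Rightarrow> 'a unitz" where
  "emb a = Unitz 0 a"

lemma emb_simps:
  "emb (a + b) = emb a + emb b" "emb (a - b) = emb a - emb b" "emb (a * b) = emb a * emb b"
  "emb (r *\<^sub>R a) = r *\<^sub>R emb a" "emb (cstar a) = cstar (emb a)" "emb 0 = 0" "uelt (emb a) = a"
  "uscal (emb a) = 0"
  by (simp_all add: emb_def unitz_ops_def cstar_unitz_def)

lemma emb_eq_iff: "emb a = emb b \<longleftrightarrow> a = b"
  by (simp add: emb_def)

lemma emb_uelt: "uscal x = 0 \<Longrightarrow> emb (uelt x) = x"
  by (simp add: emb_def unitz.expand)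

lemma uscal_power: "uscal (x ^ n) = uscal (x::'a::cstar_algebra unitz) ^ n"
  by (induction n) auto

lemma norm_emb [simp]: "norm (emb a) = norm a"
proof (rule antisym)
  show "norm (emb a) \<le> norm a" using norm_unitz_le[of "emb a"] by (simp add: emb_simps)
  show "norm a \<le> norm (emb a)" using norm_uelt_le_lact[of "emb a"] by (simp add: emb_simps)
qed

section \<open>Positive elements and approximate units\<close>

text \<open>A root of \<open>emb a\<close> taken in the unitization has a scalar part with square 0,
  so it lies in \<open>A\<close>. This transfers the calculus of \<open>cpos\<close> to
  \<open>apositive\<close>.\<close>

lemma apositive_iff_cpos: "apositive a \<longleftrightarrow> cpos (emb a)"
proof
  assume "apositive a"
  then show "cpos (emb a)" by (auto simp: apositive_def emb_simps cpos_cstar_mult_self)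
next
  assume "cpos (emb a)"
  then obtain s where s: "cpos s" "s * s = emb a" using cpos_sqrt by metis
  have "uscal s * uscal s = 0" using s(2) by (metis emb_simps(8) unitz_sel(11))
  then have "emb (uelt s) = s" by (simp add: emb_uelt)
  then have "emb (cstar (uelt s) * uelt s) = emb a" using s by (simp add: emb_simps cpos_selfadjoint)
  then show "apositive a" unfolding apositive_def emb_eq_iff by metis
qed

lemma apositive_add: "apositive a \<Longrightarrow> apositive b \<Longrightarrow> apositive (a + b)"
  by (simp add: apositive_iff_cpos emb_simps cpos_add)

lemma apositive_scaleR: "apositive a \<Longrightarrow> r \<ge> 0 \<Longrightarrow> apositive (r *\<^sub>R a)"
  by (simp add: apositive_iff_cpos emb_simps cpos_scaleR)

lemma apositive_zero: "apositive 0"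
  by (auto simp: apositive_def intro: exI[of _ 0])

lemma apositive_cstar_mult_self: "apositive (cstar a * a)"
  by (auto simp: apositive_def)

lemma apositive_selfadjoint: "apositive a \<Longrightarrow> cstar a = a"
  by (auto simp: apositive_def cstar_mult cstar_cstar)

lemma apositive_norm_mono:
  assumes "apositive a" "apositive b" shows "norm a \<le> norm (a + b)"
proof -
  have "emb (a + b) - emb a = emb b" by (simp add: emb_simps)
  then have "norm (emb a) \<le> norm (emb (a + b))"
    using cpos_norm_mono[of "emb a" "emb (a + b)"] assms by (simp only: apositive_iff_cpos)
  then show ?thesis by simp
qed

text \<open>Conjugates the positive element \<open>(norm x)^2 - cstar x * x\<close> of the
  unitization by \<open>z\<close>. It makes left multiplication bounded in each GNS
  seminorm.\<close>

lemma apositive_compress: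
  "apositive ((norm x)\<^sup>2 *\<^sub>R (cstar z * z) - cstar (x * z) * (x * (z::'a::cstar_algebra)))"
proof -
  let ?x = "emb x" and ?z = "emb z"
  have "cpos ((norm x)\<^sup>2 *\<^sub>R 1 - cstar ?x * ?x)"
    by (rule cpos_norm_diff) (simp_all add: cstar_mult cstar_cstar cstar_identity)
  from cpos_conjugate[OF this, of ?z] show ?thesis
    unfolding apositive_iff_cpos emb_simps cstar_mult
    by (simp add: algebra_simps)
qed

text \<open>These sets will form the base of a filter, which takes the place of an approximate unit
  indexed by a net. The condition on \<open>e - e * e\<close> expresses
  \<open>0 \<le> e \<le> 1\<close> and gives \<open>g (e * e) \<le> g e\<close> for positive
  \<open>g\<close>.\<close>

definition aunit :: "'a::cstar_algebra set \<Rightarrow> real \<Rightarrow> 'a set" where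
  "aunit F \<epsilon> = {e. cstar e = e \<and> norm e \<le> 1 \<and> apositive (e - e * e) \<and> (\<forall>a\<in>F. norm (a - e * a) < \<epsilon>)}"

text \<open>With \<open>h\<close> proportional to \<open>\<Sum> a a\<^sup>*\<close> the element \<open>e = 1 - (1 - h)\<^sup>n\<close> works for large \<open>n\<close>.\<close>

lemma aunit_nonempty:
  fixes F :: "'a::cstar_algebra set"
  assumes "finite F" "\<epsilon> > 0"
  shows "aunit F \<epsilon> \<noteq> {}"
proof -
  define x where "x = (\<Sum>a\<in>F. emb a * cstar (emb a))"
  have pos1: "cpos (emb a * cstar (emb a))" for a :: 'a
    using cpos_cstar_mult_self[of "cstar (emb a)"] by (simp add: cstar_cstar)
  have x: "cpos x" unfolding x_def by (intro cpos_sum pos1)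
  define t where "t = norm x + 1"
  have t: "t > 0" "norm x \<le> t" by (auto simp: t_def add_nonneg_pos)
  define h where "h = (1/t) *\<^sub>R x"
  have h: "cpos h" using t x by (simp add: h_def cpos_scaleR)
  have "1 - h = (1/t) *\<^sub>R (t *\<^sub>R 1 - x)" using t by (simp add: h_def algebra_simps)
  then have s: "cpos (1 - h)" using t x by (simp add: cpos_scaleR cpos_norm_diff cpos_selfadjoint)
  define s where "s = 1 - h"
  \<comment> \<open>The estimate below amounts to
    \<open>norm ((1 - h)^n a)^2 \<le> t norm (h (1 - h)^n) \<le> t / n\<close>; this
    \<open>n\<close> pushes it below \<open>\<epsilon>^2\<close>.\<close>
  obtain n :: nat where n: "real n > t / \<epsilon>\<^sup>2" using reals_Archimedean2 by blast
  define e where "e = uelt (1 - s ^ n)"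
  have "uscal x = 0" unfolding x_def
    using assms(1) by (induction F rule: finite_induct) (auto simp: emb_simps)
  then have "uscal s = 1" by (simp add: s_def h_def)
  then have e: "emb e = 1 - s ^ n" unfolding e_def by (intro emb_uelt) (simp add: uscal_power)
  have sp: "cpos (s ^ n)" "cpos (1 - s ^ n)"
    using s h by (auto simp: s_def intro!: cpos_power cpos_one_minus_power)
  have "cstar (emb e) = emb e" using sp by (simp add: e cpos_selfadjoint)
  then have 1: "cstar e = e" by (metis emb_eq_iff emb_simps(5))
  have "norm (emb e) \<le> 1" unfolding e by (rule cpos_norm_le) (use sp in simp_all)
  then have 2: "norm e \<le> 1" by simp
  have "cpos ((1 - s ^ n) * s ^ n)" by (rule cpos_mult) (use sp in \<open>auto simp: algebra_simps\<close>)
  moreover have "emb (e - e * e) = (1 - s ^ n) * s ^ n" by (simp add: emb_simps e algebra_simps)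
  ultimately have 3: "apositive (e - e * e)" by (simp add: apositive_iff_cpos)
  have "norm (a - e * a) < \<epsilon>" if "a \<in> F" for a
  proof -
    let ?v = "s ^ n * emb a"
    have v: "emb (a - e * a) = ?v" by (simp add: emb_simps e algebra_simps)
    have sa: "cstar (s ^ n) = s ^ n" using sp by (simp add: cpos_selfadjoint)
    have le: "cpos (x - emb a * cstar (emb a))"
      using that assms(1) unfolding x_def by (subst sum.remove[of F a]) (auto intro!: cpos_sum pos1)
    have vv: "?v * cstar ?v = cstar (s ^ n) * (emb a * cstar (emb a)) * s ^ n"
      using sa by (simp add: cstar_mult mult.assoc)
    have "cpos (cstar (s ^ n) * x * s ^ n - ?v * cstar ?v)"
      unfolding vv using cpos_conjugate[OF le, of "s ^ n"] by (simp add: algebra_simps)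
    then have "norm (?v * cstar ?v) \<le> norm (cstar (s ^ n) * x * s ^ n)"
      using cpos_cstar_mult_self[of "cstar ?v"] by (intro cpos_norm_mono) (simp_all add: cstar_cstar)
    also have "cstar (s ^ n) * x * s ^ n = t *\<^sub>R (s ^ n * (h * s ^ n))"
      using t sa by (simp add: h_def mult.assoc)
    also have "norm \<dots> \<le> t * (1 * norm (h * s ^ n))"
    proof -
      have "norm (s ^ n) \<le> 1" using cpos_norm_le[of "s ^ n" 1] sp by simp
      then have "norm (s ^ n * (h * s ^ n)) \<le> 1 * norm (h * s ^ n)"
        by (intro order_trans[OF norm_mult_ineq] mult_right_mono) auto
      then show ?thesis using t by simp
    qed
    finally have "norm (?v * cstar ?v) \<le> t * norm (h * s ^ n)" by simp
    moreover have "real n * norm (h * s ^ n) \<le> 1"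
      unfolding s_def by (rule norm_mult_one_minus_power[OF h s])
    moreover have "t / \<epsilon>\<^sup>2 > 0" using t assms by simp
    ultimately have "real n * (norm ?v)\<^sup>2 \<le> t"
      using cstar_identity[of "cstar ?v"] t n
      by (simp add: cstar_cstar) (smt (verit, ccfv_SIG) mult.left_commute mult_left_le mult_left_mono of_nat_0_le_iff)
    moreover have "t < real n * \<epsilon>\<^sup>2" using n assms by (simp add: divide_less_eq)
    ultimately have "real n * (norm ?v)\<^sup>2 < real n * \<epsilon>\<^sup>2" by linarith
    then have "(norm ?v)\<^sup>2 < \<epsilon>\<^sup>2" by (simp add: mult_less_cancel_left)
    then have "norm ?v < \<epsilon>" using assms power_less_imp_less_base by fastforce
    then show ?thesis using v by (metis norm_emb)
  qed
  then show ?thesis using 1 2 3 unfolding aunit_def by blast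
qed

lemma norm_mult_one_minus_power_emb:
  fixes h :: "'a::cstar_algebra"
  assumes "apositive h" "norm h \<le> 1"
  shows "real n * norm (emb h * (1 - emb h) ^ n) \<le> 1"
  using assms cpos_norm_diff[of "emb h" 1]
  by (intro norm_mult_one_minus_power) (auto simp: apositive_iff_cpos cpos_selfadjoint)

section \<open>The Hahn-Banach theorem\<close>

definition sublin :: "('a::real_vector \<Rightarrow> real) \<Rightarrow> bool" where
  "sublin p \<longleftrightarrow> (\<forall>x y. p (x + y) \<le> p x + p y) \<and> (\<forall>c>0. \<forall>x. p (c *\<^sub>R x) = c * p x)"

lemma sublinI:
  assumes "\<And>x y. p (x + y) \<le> p x + p y" "\<And>c x. c > 0 \<Longrightarrow> p (c *\<^sub>R x) \<le> c * p x"
  shows "sublin p"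
  unfolding sublin_def
proof (intro conjI allI impI)
  fix c :: real and x assume c: "c > 0"
  have "p (inverse c *\<^sub>R (c *\<^sub>R x)) \<le> inverse c * p (c *\<^sub>R x)" using c by (intro assms) simp
  then have "c * p x \<le> p (c *\<^sub>R x)" using c by (simp add: field_simps)
  then show "p (c *\<^sub>R x) = c * p x" using assms(2)[OF c, of x] by simp
qed (rule assms)

lemma sublinD:
  assumes "sublin p"
  shows "p (x + y) \<le> p x + p y" "c \<ge> 0 \<Longrightarrow> p (c *\<^sub>R x) = c * p x" "p 0 = 0" "- p (- x) \<le> p x"
proof -
  show s: "p (x + y) \<le> p x + p y" for x y using assms by (simp add: sublin_def)
  have "p (2 *\<^sub>R 0) = 2 * p 0" using assms unfolding sublin_def by (metis zero_less_numeral)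
  then show 0: "p 0 = 0" by simp
  show "p (c *\<^sub>R x) = c * p x" if "c \<ge> 0"
    using assms 0 that by (cases "c = 0") (auto simp: sublin_def)
  show "- p (- x) \<le> p x" using s[of x "- x"] 0 by simp
qed

text \<open>For sublinear \<open>p\<close> this is the largest sublinear functional below
  \<open>p\<close> whose value at \<open>- h\<close> is at most \<open>- p h\<close>. A linear
  functional below it agrees with \<open>p\<close> at \<open>h\<close>.\<close>

definition sublin_shrink :: "('a::real_vector \<Rightarrow> real) \<Rightarrow> 'a \<Rightarrow> 'a \<Rightarrow> real" where
  "sublin_shrink p h u = (INF t\<in>{0..}. p (u + t *\<^sub>R h) - t * p h)"

lemma sublin_shrink:
  assumes "sublin p"
  shows "sublin (sublin_shrink p h)" "sublin_shrink p h u \<le> p u" "sublin_shrink p h (- h) \<le> - p h"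
proof -
  let ?q = "sublin_shrink p h"
  have lower: "- p (- u) \<le> p (u + t *\<^sub>R h) - t * p h" if "t \<ge> 0" for u t
    using sublinD(1)[OF assms, of "u + t *\<^sub>R h" "- u"] sublinD(2)[OF assms, of t h] that by simp
  have bdd: "bdd_below ((\<lambda>t. p (u + t *\<^sub>R h) - t * p h) ` {0..})" for u
    using lower[of _ u] by (intro bdd_belowI2) auto
  have le: "?q u \<le> p (u + t *\<^sub>R h) - t * p h" if "t \<ge> 0" for u t
    unfolding sublin_shrink_def using that by (intro cINF_lower bdd) auto
  have ge: "c \<le> ?q u" if "\<And>t. t \<ge> 0 \<Longrightarrow> c \<le> p (u + t *\<^sub>R h) - t * p h" for c u
    unfolding sublin_shrink_def using that by (intro cINF_greatest) auto
  show "?q u \<le> p u" using le[of 0 u] by simp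
  show "?q (- h) \<le> - p h" using le[of 1 "- h"] sublinD(3)[OF assms] by simp
  show "sublin ?q"
  proof (rule sublinI)
    fix x y
    have "?q (x + y) - (p (x + s *\<^sub>R h) - s * p h) \<le> ?q y" if s: "s \<ge> 0" for s
    proof (rule ge)
      fix t :: real assume t: "t \<ge> 0"
      have "?q (x + y) \<le> p ((x + s *\<^sub>R h) + (y + t *\<^sub>R h)) - (s + t) * p h"
        using le[of "s + t" "x + y"] s t by (simp add: algebra_simps)
      then show "?q (x + y) - (p (x + s *\<^sub>R h) - s * p h) \<le> p (y + t *\<^sub>R h) - t * p h"
        using sublinD(1)[OF assms, of "x + s *\<^sub>R h" "y + t *\<^sub>R h"] by (simp add: algebra_simps)
    qed
    then have "?q (x + y) - ?q y \<le> ?q x" by (intro ge) (simp add: algebra_simps)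
    then show "?q (x + y) \<le> ?q x + ?q y" by simp
  next
    fix c :: real and x assume c: "c > 0"
    have "?q (c *\<^sub>R x) / c \<le> ?q x"
    proof (rule ge)
      fix t :: real assume t: "t \<ge> 0"
      have "?q (c *\<^sub>R x) \<le> p (c *\<^sub>R (x + t *\<^sub>R h)) - (c * t) * p h"
        using le[of "c * t" "c *\<^sub>R x"] c t by (simp add: algebra_simps)
      also have "\<dots> = c * (p (x + t *\<^sub>R h) - t * p h)"
        using c sublinD(2)[OF assms, of c "x + t *\<^sub>R h"] by (simp add: right_diff_distrib)
      finally show "?q (c *\<^sub>R x) / c \<le> p (x + t *\<^sub>R h) - t * p h"
        using c by (simp add: divide_le_eq mult.commute)
    qed
    then show "?q (c *\<^sub>R x) \<le> c * ?q x" using c by (simp add: divide_le_eq mult.commute)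
  qed
qed

text \<open>A minimal sublinear functional coincides with each of its shrinkings, hence is odd.\<close>

lemma sublin_dominates_linear:
  assumes "sublin p"
  obtains f where "linear f" "\<And>x. f x \<le> p x"
proof -
  define A where "A = {q. sublin q \<and> (\<forall>x. q x \<le> p x)}"
  \<comment> \<open>The order is reversed, so that the maximal element supplied by Zorn's lemma is a
    minimal sublinear functional.\<close>
  define P where "P q r \<longleftrightarrow> (\<forall>x. r x \<le> q x)" for q r :: "'a \<Rightarrow> real"
  have "\<exists>m\<in>A. \<forall>a\<in>A. P m a \<longrightarrow> a = m"
  proof (rule predicate_Zorn)
    show "partial_order_on A (relation_of P A)"
      by (rule partial_order_on_relation_ofI) (auto simp: P_def fun_eq_iff intro: order_trans antisym)
  next
    fix C assume C: "C \<in> Chains (relation_of P A)"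
    then have CA: "C \<subseteq> A" and tot: "\<And>q r. q \<in> C \<Longrightarrow> r \<in> C \<Longrightarrow> P q r \<or> P r q"
      by (auto simp: Chains_def relation_of_def)
    show "\<exists>u\<in>A. \<forall>a\<in>C. P a u"
    proof (cases "C = {}")
      case True
      then show ?thesis using assms by (auto simp: A_def)
    next
      case False
      define u where "u x = (INF q\<in>C. q x)" for x
      have "- p (- x) \<le> q x" if "q \<in> C" for q x
      proof -
        have "sublin q" "q (- x) \<le> p (- x)" using CA that by (auto simp: A_def)
        then show ?thesis using sublinD(4)[of q x] by linarith
      qed
      then have bdd: "bdd_below ((\<lambda>q. q x) ` C)" for x by (intro bdd_belowI2)
      have le: "u x \<le> q x" if "q \<in> C" for q x unfolding u_def using that by (intro cINF_lower bdd)
      have ge: "c \<le> u x" if "\<And>q. q \<in> C \<Longrightarrow> c \<le> q x" for c x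
        unfolding u_def using that False by (intro cINF_greatest)
      have "sublin u"
      proof (rule sublinI)
        fix x y
        \<comment> \<open>Subadditivity of the infimum uses the chain condition: the smaller of
          \<open>q\<close> and \<open>r\<close> serves at both \<open>x\<close> and
          \<open>y\<close>.\<close>
        have key: "u (x + y) \<le> q x + r y" if qr: "q \<in> C" "r \<in> C" for q r
        proof -
          obtain s where "s \<in> C" "s x \<le> q x" "s y \<le> r y"
            using tot[OF qr] qr by (auto simp: P_def)
          moreover have "u (x + y) \<le> s x + s y"
          proof -
            have "sublin s" using CA \<open>s \<in> C\<close> by (auto simp: A_def)
            then show ?thesis using le[OF \<open>s \<in> C\<close>, of "x + y"] sublinD(1)[of s x y] by linarith
          qed
          ultimately show ?thesis by linarith
        qed
        have "u (x + y) - q x \<le> u y" if "q \<in> C" for q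
          by (rule ge) (use key[OF that] in \<open>simp add: algebra_simps\<close>)
        then have "u (x + y) - u y \<le> u x" by (intro ge) (simp add: algebra_simps)
        then show "u (x + y) \<le> u x + u y" by simp
      next
        fix c :: real and x assume c: "c > 0"
        have "u (c *\<^sub>R x) / c \<le> u x"
        proof (rule ge)
          fix q assume q: "q \<in> C"
          then have "q (c *\<^sub>R x) = c * q x" using CA c sublinD(2)[of q c x] by (auto simp: A_def)
          then show "u (c *\<^sub>R x) / c \<le> q x" using le[OF q, of "c *\<^sub>R x"] c by (simp add: divide_le_eq mult.commute)
        qed
        then show "u (c *\<^sub>R x) \<le> c * u x" using c by (simp add: divide_le_eq mult.commute)
      qed
      moreover have "u x \<le> p x" for x
      proof -
        obtain q where "q \<in> C" using False by blast
        moreover have "q x \<le> p x" using CA \<open>q \<in> C\<close> by (auto simp: A_def)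
        ultimately show ?thesis using le[of q x] by linarith
      qed
      ultimately show ?thesis using le by (auto simp: A_def P_def)
    qed
  qed
  then obtain m where m: "sublin m" "\<And>x. m x \<le> p x" and min: "\<And>a. a \<in> A \<Longrightarrow> P m a \<Longrightarrow> a = m"
    by (auto simp: A_def)
  have odd: "m (- h) = - m h" for h
  proof -
    have "sublin_shrink m h \<in> A"
      using sublin_shrink(1)[OF m(1)] order_trans[OF sublin_shrink(2)[OF m(1)] m(2)] by (auto simp: A_def)
    then have "sublin_shrink m h = m" using sublin_shrink(2)[OF m(1)] by (intro min) (auto simp: P_def)
    then show ?thesis using sublin_shrink(3)[OF m(1), of h] sublinD(4)[OF m(1), of h] by simp
  qed
  have "linear m"
  proof (rule linearI)
    show "m (x + y) = m x + m y" for x y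
      using sublinD(1)[OF m(1), of x y] sublinD(1)[OF m(1), of "- x" "- y"] odd[of "x + y"]
      by (simp add: odd)
    show "m (c *\<^sub>R x) = c *\<^sub>R m x" for c x
    proof (cases "c \<ge> 0")
      case False
      then have "m ((- c) *\<^sub>R x) = - c * m x" by (intro sublinD(2)[OF m(1)]) simp
      then show ?thesis by (simp add: odd)
    qed (use sublinD(2)[OF m(1)] in simp)
  qed
  then show thesis using m(2) that by blast
qed

theorem hahn_banach:
  assumes "sublin p"
  obtains f where "linear f" "\<And>x. f x \<le> p x" "f h = p h"
proof -
  obtain f where f: "linear f" "\<And>x. f x \<le> sublin_shrink p h x"
    using sublin_dominates_linear[OF sublin_shrink(1)[OF assms]] by metis
  have le: "f x \<le> p x" for x using f(2) sublin_shrink(2)[OF assms] order_trans by blast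
  moreover have "f (- h) \<le> - p h" using f(2) sublin_shrink(3)[OF assms] order_trans by blast
  then have "f h = p h" using le[of h] linear_neg[OF f(1), of h] by simp
  ultimately show thesis using f(1) that by blast
qed

section \<open>Bounded functionals\<close>

lemma dualI:
  assumes "\<And>x y. f (x + y) = f x + f y" "\<And>c x. f (cscale c x) = c * f x"
    "\<And>x. cmod (f x) \<le> K * norm x"
  shows "f \<in> dual"
  using assms by (auto simp: dual_def)

lemma dual_add: "f \<in> dual \<Longrightarrow> f (x + y) = f x + f y"
  and dual_cscale: "f \<in> dual \<Longrightarrow> f (cscale c x) = c * f x"
  by (auto simp: dual_def)

lemma dual_scaleR: "f \<in> dual \<Longrightarrow> f (r *\<^sub>R x) = r * f x"
  by (metis cscale_of_real dual_cscale)

lemma dual_zero: "f \<in> dual \<Longrightarrow> f 0 = 0"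
  using dual_scaleR[of f 0] by simp

lemma dual_minus: "f \<in> dual \<Longrightarrow> f (- x) = - f x"
  using dual_add[of f x "- x"] dual_zero[of f] by (simp add: eq_neg_iff_add_eq_0 add.commute)

lemma dual_diff: "f \<in> dual \<Longrightarrow> f (x - y) = f x - f y"
  using dual_add[of f x "- y"] dual_minus[of f y] by simp

lemma dual_bound:
  assumes f: "f \<in> dual" shows "cmod (f x) \<le> dnorm f * norm x"
proof (cases "x = 0")
  case True
  then show ?thesis using dual_zero[OF f] by simp
next
  case False
  obtain K where K: "\<And>x. cmod (f x) \<le> K * norm x" using f by (auto simp: dual_def)
  have "cmod (f z) \<le> \<bar>K\<bar>" if "norm z \<le> 1" for z
  proof -
    have "K * norm z \<le> \<bar>K\<bar> * 1" using that by (intro mult_mono) auto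
    then show ?thesis using K[of z] by simp
  qed
  then have bdd: "bdd_above {cmod (f x) | x. norm x \<le> 1}" by (intro bdd_aboveI[of _ "\<bar>K\<bar>"]) auto
  let ?z = "(1 / norm x) *\<^sub>R x"
  have "cmod (f ?z) \<le> dnorm f"
    unfolding dnorm_def by (rule cSup_upper[OF _ bdd]) (use False in auto)
  moreover have "cmod (f ?z) = cmod (f x) / norm x"
    by (simp add: dual_scaleR[OF f] norm_mult norm_divide)
  ultimately show ?thesis using False by (simp add: divide_le_eq)
qed

lemma dnorm_nonneg: assumes "f \<in> dual" shows "dnorm f \<ge> 0"
proof (cases "\<exists>x::'a. x \<noteq> 0")
  case True
  then obtain x :: 'a where "x \<noteq> 0" by blast
  have "0 \<le> dnorm f * norm x" using dual_bound[OF assms, of x] norm_ge_zero order_trans by blast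
  then show ?thesis using \<open>x \<noteq> 0\<close> by (simp add: zero_le_mult_iff)
next
  case False
  then have "{cmod (f x) | x. norm x \<le> 1} = {0}"
    using dual_zero[OF assms] by auto (metis norm_zero zero_le_one)
  then show ?thesis by (simp add: dnorm_def)
qed

lemma dnorm_leI: "(\<And>x. norm x \<le> 1 \<Longrightarrow> cmod (f x) \<le> K) \<Longrightarrow> dnorm f \<le> K"
  unfolding dnorm_def by (rule cSup_least) (auto intro: exI[of _ 0])

lemma dnorm_leI': "(\<And>x. cmod (f x) \<le> K * norm x) \<Longrightarrow> K \<ge> 0 \<Longrightarrow> dnorm f \<le> K"
  by (rule dnorm_leI) (metis mult.right_neutral mult_left_mono order_trans)

lemma dnorm_approx:
  assumes "f \<in> dual" "c < dnorm f" obtains x where "norm x \<le> 1" "c < cmod (f x)"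
  using assms dnorm_leI[of f c] by (meson not_le)

lemma dual_plus: "f \<in> dual \<Longrightarrow> g \<in> dual \<Longrightarrow> (\<lambda>x. f x + g x) \<in> dual"
  by (rule dualI[where K="dnorm f + dnorm g"])
     (auto simp: dual_add dual_cscale algebra_simps intro!: order_trans[OF norm_triangle_ineq] add_mono dual_bound)

lemma dual_mult: "f \<in> dual \<Longrightarrow> (\<lambda>x. c * f x) \<in> dual"
  by (rule dualI[where K="cmod c * dnorm f"])
     (auto simp: dual_add dual_cscale distrib_left mult.assoc norm_mult intro!: mult_left_mono dual_bound)

lemma dual_const_zero: "(\<lambda>x. 0) \<in> dual"
  by (rule dualI[where K=0]) auto

lemma dual_minus_fun: "f \<in> dual \<Longrightarrow> g \<in> dual \<Longrightarrow> (\<lambda>x. f x - g x) \<in> dual"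
  using dual_plus[of f "\<lambda>x. (-1) * g x"] dual_mult[of g "-1"] by simp

lemma dual_lmult: assumes f: "f \<in> dual" shows "(\<lambda>b. f (a * b)) \<in> dual"
proof (rule dualI)
  show "cmod (f (a * x)) \<le> (dnorm f * norm a) * norm x" for x
    using order_trans[OF dual_bound[OF f] mult_left_mono[OF norm_mult_ineq dnorm_nonneg[OF f]], of a x]
    by (simp add: mult.assoc)
qed (use f in \<open>auto simp: dual_add dual_cscale algebra_simps cscale_eq_mult_right\<close>)

lemma dual_rmult: assumes f: "f \<in> dual" shows "(\<lambda>b. f (b * a)) \<in> dual"
proof (rule dualI)
  show "cmod (f (x * a)) \<le> (dnorm f * norm a) * norm x" for x
    using order_trans[OF dual_bound[OF f] mult_left_mono[OF norm_mult_ineq dnorm_nonneg[OF f]], of x a]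
    by (simp add: mult_ac)
qed (use f in \<open>auto simp: dual_add dual_cscale algebra_simps cscale_eq_mult_left\<close>)

lemma dual_dstar: assumes f: "f \<in> dual" shows "dstar f \<in> dual"
proof (rule dualI)
  show "cmod (dstar f x) \<le> dnorm f * norm x" for x
    using dual_bound[OF f, of "cstar x"] by (simp add: dstar_def)
qed (use f in \<open>auto simp: dstar_def dual_add dual_cscale cstar_add cstar_cscale\<close>)

lemma tendsto_dual: assumes "f \<in> dual" shows "(g \<longlongrightarrow> l) F \<Longrightarrow> ((\<lambda>x. f (g x)) \<longlongrightarrow> f l) F"
  by (rule bounded_linear.tendsto)
     (auto intro!: bounded_linear_intro[where K="dnorm f"]
       simp: dual_add[OF assms] dual_scaleR[OF assms] scaleR_conv_of_real mult.commute dual_bound[OF assms])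

lemma complexify_dual:
  assumes "linear F" "\<And>x. F x \<le> K * norm x"
  defines "G \<equiv> \<lambda>x. Complex (F x) (- F (cscale \<i> x))"
  shows "G \<in> dual" "cmod (G x) \<le> K * norm x"
proof -
  have add: "G (x + y) = G x + G y" for x y
    by (simp add: G_def linear_add[OF assms(1)] cscale_add_right complex_eq_iff)
  have sc: "G (cscale c x) = c * G x" for c x
  proof -
    have c: "cscale c z = Re c *\<^sub>R z + Im c *\<^sub>R cscale \<i> z" for c and z :: 'a
      by (metis complex_eq cscale_add_left cscale_mult cscale_of_real mult.commute)
    have "cscale \<i> (cscale \<i> x) = - x" by (simp add: cscale_mult cscale_minus_left cscale_one)
    then show ?thesis
      unfolding G_def c[of c]
      by (simp add: complex_eq_iff linear_add[OF assms(1)] linear_scale[OF assms(1)] linear_neg[OF assms(1)] linear_diff[OF assms(1)]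
          cscale_add_right cscale_scaleR)
  qed
  have bound: "cmod (G x) \<le> K * norm x" for x
  proof (cases "G x = 0")
    case True
    have "0 \<le> F x + F (- x)" using linear_neg[OF assms(1), of x] by simp
    then have "0 \<le> K * norm x" using assms(2)[of x] assms(2)[of "- x"] by simp
    then show ?thesis using True by simp
  next
    case False
    \<comment> \<open>Multiplication by \<open>c\<close> rotates \<open>G x\<close> onto the
      positive real axis, where \<open>G\<close> equals its real part \<open>F\<close>.\<close>
    define c where "c = cnj (G x) / cmod (G x)"
    have "c * G x = cmod (G x)"
      using False by (simp add: c_def complex_norm_square[symmetric] mult.commute power2_eq_square)
    then have "G (cscale c x) = cmod (G x)" by (simp add: sc)
    then have "F (cscale c x) = cmod (G x)" by (simp add: G_def complex_eq_iff)
    moreover have "cmod c = 1" using False by (simp add: c_def norm_divide)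
    ultimately show ?thesis using assms(2)[of "cscale c x"] by (simp add: cscale_norm)
  qed
  show "cmod (G x) \<le> K * norm x" by (rule bound)
  show "G \<in> dual" by (rule dualI[OF add sc bound])
qed

text \<open>Hahn-Banach for the distance to \<open>D\<close>, with equality prescribed at
  \<open>a\<close>: the distance vanishes on \<open>D\<close> and is at least
  \<open>\<delta>\<close> at \<open>a\<close>.\<close>

lemma dual_separates_subspace:
  fixes a :: "'a::cstar_algebra"
  assumes D: "0 \<in> D" "\<And>x y. x \<in> D \<Longrightarrow> y \<in> D \<Longrightarrow> x + y \<in> D" "\<And>c x. x \<in> D \<Longrightarrow> cscale c x \<in> D"
    and a: "\<delta> > 0" "\<And>d. d \<in> D \<Longrightarrow> \<delta> \<le> norm (a - d)"
  obtains \<phi> where "\<phi> \<in> dual" "\<And>d. d \<in> D \<Longrightarrow> \<phi> d = 0" "\<phi> a \<noteq> 0"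
proof -
  define p where "p u = (INF d\<in>D. norm (u - d))" for u
  have bdd: "bdd_below ((\<lambda>d. norm (u - d)) ` D)" for u by (intro bdd_belowI2[of _ 0]) auto
  have le: "p u \<le> norm (u - d)" if "d \<in> D" for u d unfolding p_def using that by (intro cINF_lower bdd)
  have ge: "c \<le> p u" if "\<And>d. d \<in> D \<Longrightarrow> c \<le> norm (u - d)" for c u
    unfolding p_def using that D(1) by (intro cINF_greatest) auto
  have "sublin p"
  proof (rule sublinI)
    fix x y
    have "p (x + y) - norm (x - d) \<le> p y" if d: "d \<in> D" for d
    proof (rule ge)
      fix d' assume d': "d' \<in> D"
      have "p (x + y) \<le> norm ((x - d) + (y - d'))"
        using le[OF D(2)[OF d d'], of "x + y"] by (simp add: algebra_simps)
      then show "p (x + y) - norm (x - d) \<le> norm (y - d')"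
        using norm_triangle_ineq[of "x - d" "y - d'"] by simp
    qed
    then have "p (x + y) - p y \<le> p x" by (intro ge) (simp add: algebra_simps)
    then show "p (x + y) \<le> p x + p y" by simp
  next
    fix c :: real and x assume c: "c > 0"
    have "p (c *\<^sub>R x) / c \<le> p x"
    proof (rule ge)
      fix d assume "d \<in> D"
      then have "c *\<^sub>R d \<in> D" using D(3)[of d "complex_of_real c"] by (simp add: cscale_of_real)
      from le[OF this, of "c *\<^sub>R x"] have "p (c *\<^sub>R x) \<le> c * norm (x - d)"
        using c by (simp add: scaleR_diff_right[symmetric] del: scaleR_diff_right)
      then show "p (c *\<^sub>R x) / c \<le> norm (x - d)" using c by (simp add: divide_le_eq mult.commute)
    qed
    then show "p (c *\<^sub>R x) \<le> c * p x" using c by (simp add: divide_le_eq mult.commute)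
  qed
  then obtain F where F: "linear F" "\<And>x. F x \<le> p x" "F a = p a" using hahn_banach by blast
  have "F x \<le> 1 * norm x" for x using F(2)[of x] le[OF D(1), of x] by simp
  note G = complexify_dual[OF F(1) this]
  have "F d \<le> 0" if "d \<in> D" for d using F(2)[of d] le[OF that, of d] by simp
  then have F0: "F d = 0" if "d \<in> D" for d
  proof -
    have "- d \<in> D" using D(3)[OF that, of "-1"] by (simp add: cscale_minus_left cscale_one)
    then show ?thesis using \<open>\<And>d. d \<in> D \<Longrightarrow> F d \<le> 0\<close>[OF that] \<open>\<And>d. d \<in> D \<Longrightarrow> F d \<le> 0\<close>[of "- d"]
      linear_neg[OF F(1), of d] by simp
  qed
  have "p a \<ge> \<delta>" by (rule ge) (rule a)
  then have "F a \<noteq> 0" using F(3) a(1) by simp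
  show thesis
    by (rule that[OF G(1)]) (use F0 D(3) \<open>F a \<noteq> 0\<close> in \<open>auto simp: complex_eq_iff\<close>)
qed

section \<open>Positive functionals\<close>

lemma fpositive_dual: "fpositive g \<Longrightarrow> g \<in> dual"
  by (simp add: fpositive_def)

lemma fpositive_apositive: "fpositive g \<Longrightarrow> apositive a \<Longrightarrow> Im (g a) = 0 \<and> Re (g a) \<ge> 0"
  by (auto simp: fpositive_def apositive_def)

text \<open>A sublinear bound that sees \<open>u\<close> only through its self-adjoint part forces
  the functionals below it to vanish on skew-adjoint elements; after complexification their values
  on \<open>cstar a * a\<close> are real.\<close>

definition herm :: "'a::cstar_algebra \<Rightarrow> 'a" where
  "herm u = (1/2) *\<^sub>R (u + cstar u)"

lemma herm_simps: "herm (u + v) = herm u + herm v" "herm (c *\<^sub>R u) = c *\<^sub>R herm u"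
  "cstar u = u \<Longrightarrow> herm u = u" "cstar u = - u \<Longrightarrow> herm u = 0"
  by (simp_all add: herm_def cstar_add cstar_scaleR scaleR_half_double scaleR_add_right[symmetric]
      add_ac del: scaleR_add_right)

lemma norm_herm_le: "norm (herm u) \<le> norm u"
  using norm_triangle_ineq[of u "cstar u"] by (simp add: herm_def)

text \<open>The pairs in \<open>\<Gamma>\<close> are the lower bounds the functional has to respect; Hahn-Banach is applied to
  the sublinear functional that encodes them together with positivity and the norm bound.\<close>

lemma fpositive_exists:
  fixes \<Gamma> :: "('a::cstar_algebra \<times> real) set"
  assumes M: "M \<ge> 0"
    and \<Gamma>: "\<And>x r. (x, r) \<in> \<Gamma> \<Longrightarrow> apositive x \<and> r \<le> M * norm x"
    and add: "\<And>x r y s. (x, r) \<in> \<Gamma> \<Longrightarrow> (y, s) \<in> \<Gamma> \<Longrightarrow> (x + y, r + s) \<in> \<Gamma>"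
    and scale: "\<And>c x r. (x, r) \<in> \<Gamma> \<Longrightarrow> c > 0 \<Longrightarrow> (c *\<^sub>R x, c * r) \<in> \<Gamma>"
    and pos: "\<And>y. apositive y \<Longrightarrow> (y, 0) \<in> \<Gamma>"
  obtains G where "fpositive G" "\<And>x. cmod (G x) \<le> M * norm x"
    "\<And>x r. (x, r) \<in> \<Gamma> \<Longrightarrow> r \<le> Re (G x)"
proof -
  define p where "p u = (INF z\<in>\<Gamma>. M * norm (herm u + fst z) - snd z)" for u
  have ne: "\<Gamma> \<noteq> {}" using pos[OF apositive_zero] by blast
  have "- (M * norm u) \<le> M * norm (herm u + fst z) - snd z" if "z \<in> \<Gamma>" for u z
  proof -
    have "norm (fst z) \<le> norm (herm u + fst z) + norm u"
      using norm_triangle_ineq4[of "herm u + fst z" "herm u"] norm_herm_le[of u] by simp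
    then have "M * norm (fst z) \<le> M * norm (herm u + fst z) + M * norm u"
      using M by (metis distrib_left mult_left_mono)
    then show ?thesis using \<Gamma>[of "fst z" "snd z"] that by simp
  qed
  then have bdd: "bdd_below ((\<lambda>z. M * norm (herm u + fst z) - snd z) ` \<Gamma>)" for u by (intro bdd_belowI2)
  have le: "p u \<le> M * norm (herm u + x) - r" if "(x, r) \<in> \<Gamma>" for u x r
    unfolding p_def by (rule order_trans[OF cINF_lower[OF bdd that]]) simp
  have ge: "c \<le> p u" if "\<And>x r. (x, r) \<in> \<Gamma> \<Longrightarrow> c \<le> M * norm (herm u + x) - r" for c u
    unfolding p_def using that ne by (intro cINF_greatest) auto
  have "sublin p"
  proof (rule sublinI)
    fix u v
    have "p (u + v) - (M * norm (herm u + x) - r) \<le> p v" if x: "(x, r) \<in> \<Gamma>" for x r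
    proof (rule ge)
      fix y s assume y: "(y, s) \<in> \<Gamma>"
      have "p (u + v) \<le> M * norm ((herm u + x) + (herm v + y)) - (r + s)"
        using le[OF add[OF x y], of "u + v"] by (simp add: herm_simps algebra_simps)
      also have "\<dots> \<le> M * (norm (herm u + x) + norm (herm v + y)) - (r + s)"
        using M by (intro diff_right_mono mult_left_mono norm_triangle_ineq)
      finally show "p (u + v) - (M * norm (herm u + x) - r) \<le> M * norm (herm v + y) - s"
        by (simp add: algebra_simps)
    qed
    then have "p (u + v) - p v \<le> p u" by (intro ge) (simp add: algebra_simps)
    then show "p (u + v) \<le> p u + p v" by simp
  next
    fix c :: real and u assume c: "c > 0"
    have "p (c *\<^sub>R u) / c \<le> p u"
    proof (rule ge)
      fix x r assume x: "(x, r) \<in> \<Gamma>"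
      have "p (c *\<^sub>R u) \<le> M * norm (c *\<^sub>R (herm u + x)) - c * r"
        using le[OF scale[OF x c], of "c *\<^sub>R u"] by (simp add: herm_simps scaleR_add_right)
      also have "\<dots> = c * (M * norm (herm u + x) - r)"
        unfolding norm_scaleR using c by (simp add: right_diff_distrib)
      finally show "p (c *\<^sub>R u) / c \<le> M * norm (herm u + x) - r"
        using c by (simp add: divide_le_eq mult.commute)
    qed
    then show "p (c *\<^sub>R u) \<le> c * p u" using c by (simp add: divide_le_eq mult.commute)
  qed
  then obtain F where F: "linear F" "\<And>x. F x \<le> p x" using sublin_dominates_linear by blast
  have p0: "p u \<le> M * norm (herm u)" for u using le[OF pos[OF apositive_zero], of u] by simp
  have "F x \<le> M * norm x" for x
    using F(2)[of x] p0[of x] mult_left_mono[OF norm_herm_le[of x] M] by linarith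
  note G = complexify_dual[OF F(1) this]
  have lower: "r \<le> F x" if "(x, r) \<in> \<Gamma>" for x r
  proof -
    have "cstar x = x" using \<Gamma>[OF that] by (simp add: apositive_selfadjoint)
    then have "herm (- x) = - x" by (intro herm_simps) (simp add: cstar_minus)
    then have "F (- x) \<le> - r" using F(2)[of "- x"] le[OF that, of "- x"] by simp
    then show ?thesis using linear_neg[OF F(1), of x] by simp
  qed
  have skew: "F u = 0" if "cstar u = - u" for u
  proof -
    have "herm u = 0" "herm (- u) = 0" using that by (auto intro!: herm_simps simp: cstar_minus)
    then have "F u \<le> 0" "F (- u) \<le> 0" using F(2)[of u] F(2)[of "- u"] p0[of u] p0[of "- u"] by auto
    then show ?thesis using linear_neg[OF F(1), of u] by simp
  qed
  let ?G = "\<lambda>x. Complex (F x) (- F (cscale \<i> x))"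
  have "F (cscale \<i> (cstar a * a)) = 0" for a
    by (rule skew) (simp add: cstar_cscale cstar_mult cstar_cstar cscale_minus_left)
  then have "fpositive ?G"
    using G(1) lower[OF pos[OF apositive_cstar_mult_self]] by (auto simp: fpositive_def)
  then show thesis by (rule that) (use G(2) lower in auto)
qed

text \<open>The prescribed bounds are \<open>norm h\<close> at \<open>h\<close> and 0 on the
  positive cone. They are compatible with the norm bound 1 because the norm is monotone on positive
  elements.\<close>

lemma fpositive_norming:
  assumes "apositive h"
  obtains g where "fpositive g" "\<And>x. cmod (g x) \<le> norm x" "norm h \<le> Re (g h)"
proof -
  define \<Gamma> where "\<Gamma> = {(t *\<^sub>R h + y, t * norm h) | t y. t \<ge> 0 \<and> apositive y}"
  obtain g where "fpositive g" "\<And>x. cmod (g x) \<le> 1 * norm x" "\<And>x r. (x, r) \<in> \<Gamma> \<Longrightarrow> r \<le> Re (g x)"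
  proof (rule fpositive_exists[of 1 \<Gamma>])
    fix x r assume "(x, r) \<in> \<Gamma>"
    then obtain t y where ty: "x = t *\<^sub>R h + y" "r = t * norm h" "t \<ge> 0" "apositive y"
      by (auto simp: \<Gamma>_def)
    then show "apositive x \<and> r \<le> 1 * norm x"
      using apositive_add[OF apositive_scaleR[OF assms, of t] ty(4)]
        apositive_norm_mono[OF apositive_scaleR[OF assms, of t] ty(4)] by simp
  next
    fix x r y s assume "(x, r) \<in> \<Gamma>" "(y, s) \<in> \<Gamma>"
    then obtain t x' t' y' where "x = t *\<^sub>R h + x'" "r = t * norm h" "t \<ge> 0" "apositive x'"
      "y = t' *\<^sub>R h + y'" "s = t' * norm h" "t' \<ge> 0" "apositive y'" by (auto simp: \<Gamma>_def)
    then show "(x + y, r + s) \<in> \<Gamma>" unfolding \<Gamma>_def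
      by (intro CollectI exI[of _ "t + t'"] exI[of _ "x' + y'"]) (auto simp: algebra_simps apositive_add)
  next
    fix c x r assume "(x, r) \<in> \<Gamma>" "c > (0::real)"
    then obtain t x' where "x = t *\<^sub>R h + x'" "r = t * norm h" "t \<ge> 0" "apositive x'" by (auto simp: \<Gamma>_def)
    then show "(c *\<^sub>R x, c * r) \<in> \<Gamma>" unfolding \<Gamma>_def using \<open>c > 0\<close>
      by (intro CollectI exI[of _ "c * t"] exI[of _ "c *\<^sub>R x'"]) (auto simp: algebra_simps apositive_scaleR)
  next
    fix y assume "apositive (y::'a)"
    then show "(y, 0) \<in> \<Gamma>" unfolding \<Gamma>_def by (intro CollectI exI[of _ 0] exI[of _ y]) auto
  qed auto
  moreover have "(h, norm h) \<in> \<Gamma>" unfolding \<Gamma>_def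
    by (intro CollectI exI[of _ 1] exI[of _ 0]) (auto simp: apositive_zero)
  ultimately show thesis using that by auto
qed

text \<open>The bounds in \<open>\<Gamma>\<close> ask that \<open>g (x + y)\<close> dominate
  \<open>f x\<close> for positive \<open>x\<close> and \<open>y\<close>: the case
  \<open>x = 0\<close> is positivity of \<open>g\<close>, the case \<open>y = 0\<close> is
  \<open>f \<le> g\<close> on the cone. Monotonicity of the norm keeps them below
  \<open>dnorm f * norm (x + y)\<close>.\<close>

lemma jordan_decomposition:
  fixes f :: "'a::cstar_algebra \<Rightarrow> complex"
  assumes f: "f \<in> dual" "\<And>x. f (cstar x) = cnj (f x)"
  obtains g where "fpositive g" "fpositive (\<lambda>x. g x - f x)"
proof -
  define \<Gamma> where "\<Gamma> = {(x + y, Re (f x)) | x y. apositive x \<and> apositive y}"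
  obtain g where g: "fpositive g" "\<And>x. cmod (g x) \<le> dnorm f * norm x"
    "\<And>x r. (x, r) \<in> \<Gamma> \<Longrightarrow> r \<le> Re (g x)"
  proof (rule fpositive_exists[of "dnorm f" \<Gamma>])
    show "dnorm f \<ge> 0" by (rule dnorm_nonneg[OF f(1)])
  next
    fix x r assume "(x, r) \<in> \<Gamma>"
    then obtain x' y where *: "x = x' + y" "r = Re (f x')" "apositive x'" "apositive y" by (auto simp: \<Gamma>_def)
    have "r \<le> dnorm f * norm x'" using dual_bound[OF f(1), of x'] complex_Re_le_cmod[of "f x'"] * by linarith
    also have "\<dots> \<le> dnorm f * norm x"
      using apositive_norm_mono[OF *(3,4)] dnorm_nonneg[OF f(1)] *(1) by (simp add: mult_left_mono)
    finally show "apositive x \<and> r \<le> dnorm f * norm x" using * apositive_add by auto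
  next
    fix x r y s assume "(x, r) \<in> \<Gamma>" "(y, s) \<in> \<Gamma>"
    then obtain x1 x2 y1 y2 where "x = x1 + x2" "r = Re (f x1)" "apositive x1" "apositive x2"
      "y = y1 + y2" "s = Re (f y1)" "apositive y1" "apositive y2" by (auto simp: \<Gamma>_def)
    then show "(x + y, r + s) \<in> \<Gamma>" unfolding \<Gamma>_def
      by (intro CollectI exI[of _ "x1 + y1"] exI[of _ "x2 + y2"])
         (auto simp: algebra_simps apositive_add dual_add[OF f(1)])
  next
    fix c x r assume "(x, r) \<in> \<Gamma>" "c > (0::real)"
    then obtain x1 x2 where "x = x1 + x2" "r = Re (f x1)" "apositive x1" "apositive x2" by (auto simp: \<Gamma>_def)
    then show "(c *\<^sub>R x, c * r) \<in> \<Gamma>" unfolding \<Gamma>_def using \<open>c > 0\<close>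
      by (intro CollectI exI[of _ "c *\<^sub>R x1"] exI[of _ "c *\<^sub>R x2"])
         (auto simp: scaleR_add_right apositive_scaleR dual_scaleR[OF f(1)])
  next
    fix y assume "apositive (y::'a)"
    then show "(y, 0) \<in> \<Gamma>" unfolding \<Gamma>_def
      by (intro CollectI exI[of _ 0] exI[of _ y]) (auto simp: apositive_zero dual_zero[OF f(1)])
  qed auto
  have "fpositive (\<lambda>x. g x - f x)"
    unfolding fpositive_def
  proof (intro conjI allI)
    show "(\<lambda>x. g x - f x) \<in> dual" by (intro dual_minus_fun fpositive_dual g f)
    fix a
    have "f (cstar a * a) = cnj (f (cstar a * a))"
      using f(2)[of "cstar a * a"] by (simp add: cstar_mult cstar_cstar)
    then have "Im (f (cstar a * a)) = 0" by (simp add: complex_eq_iff)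
    moreover have "(cstar a * a, Re (f (cstar a * a))) \<in> \<Gamma>"
      unfolding \<Gamma>_def by (intro CollectI exI[of _ "cstar a * a"] exI[of _ 0])
        (auto simp: apositive_zero apositive_cstar_mult_self)
    ultimately show "Im (g (cstar a * a) - f (cstar a * a)) = 0" "0 \<le> Re (g (cstar a * a) - f (cstar a * a))"
      using g(3) g(1) by (auto simp: fpositive_def)
  qed
  with g(1) show thesis by (rule that)
qed

text \<open>Every functional is a linear combination of four positive ones.\<close>

lemma dual_induct [consumes 1, case_names pos add mult]:
  assumes f: "f \<in> dual"
    and pos: "\<And>g. fpositive g \<Longrightarrow> P g"
    and add: "\<And>f g. f \<in> dual \<Longrightarrow> g \<in> dual \<Longrightarrow> P f \<Longrightarrow> P g \<Longrightarrow> P (\<lambda>x. f x + g x)"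
    and mult: "\<And>c f. f \<in> dual \<Longrightarrow> P f \<Longrightarrow> P (\<lambda>x. c * f x)"
  shows "P f"
proof -
  have herm: "P f" if f: "f \<in> dual" "\<And>x. f (cstar x) = cnj (f x)" for f
  proof -
    obtain g where g: "fpositive g" "fpositive (\<lambda>x. g x - f x)" using jordan_decomposition[OF f] by blast
    have "P (\<lambda>x. g x + (-1) * (g x - f x))"
      by (intro add mult pos g dual_mult fpositive_dual)
    then show ?thesis by simp
  qed
  have s: "dstar f (cstar x) = cnj (f x)" for x by (simp add: dstar_def cstar_cstar)
  have s': "f (cstar x) = cnj (dstar f x)" for x by (simp add: dstar_def cstar_cstar)
  define f1 where "f1 = (\<lambda>x. (1/2) * (f x + dstar f x))"
  define f2 where "f2 = (\<lambda>x. (- \<i>/2) * (f x + (-1) * dstar f x))"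
  have d: "f1 \<in> dual" "f2 \<in> dual"
    unfolding f1_def f2_def by (intro dual_mult dual_plus f dual_dstar)+
  have "P f1" by (rule herm[OF d(1)]) (simp add: f1_def s s' algebra_simps)
  moreover have "P f2" by (rule herm[OF d(2)]) (simp add: f2_def s s' algebra_simps)
  ultimately have "P (\<lambda>x. f1 x + \<i> * f2 x)" by (intro add mult dual_mult d)
  moreover have "(\<lambda>x. f1 x + \<i> * f2 x) = f" by (rule ext) (simp add: f1_def f2_def field_simps)
  ultimately show ?thesis by simp
qed

lemma quadratic_discriminant_le:
  fixes A W B :: real
  assumes "\<And>s. A + 2 * s * W + s\<^sup>2 * B \<ge> 0" "B \<ge> 0"
  shows "W\<^sup>2 \<le> A * B"
proof (cases "B = 0")
  case True
  have "W = 0"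
  proof (rule ccontr)
    assume "W \<noteq> 0"
    \<comment> \<open>With \<open>B = 0\<close> the quadratic is affine in \<open>s\<close>, and
      this \<open>s\<close> gives it the value -1.\<close>
    then show False using assms(1)[of "- (A + 1) / (2 * W)"] True by (simp add: field_simps)
  qed
  then show ?thesis using True by simp
next
  case False
  have "0 \<le> B * (A + 2 * (- W / B) * W + (- W / B)\<^sup>2 * B)"
    by (intro mult_nonneg_nonneg assms)
  also have "\<dots> = A * B - W\<^sup>2" using False by (simp add: field_simps power2_eq_square)
  finally show ?thesis by simp
qed

lemma unimodular_rotation:
  obtains c where "c * w = complex_of_real (cmod w)" "cmod c = 1"
proof (cases "w = 0")
  case True
  then show thesis by (intro that[of 1]) auto
next
  case False
  have "cnj w * w = complex_of_real ((cmod w)\<^sup>2)" by (metis complex_norm_square mult.commute)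
  then have "cnj w / cmod w * w = complex_of_real (cmod w)"
    using False by (simp add: power2_eq_square)
  moreover have "cmod (cnj w / cmod w) = 1" using False by (simp add: norm_divide)
  ultimately show thesis by (rule that)
qed

lemma cnj_mult_unimodular:
  assumes "cmod c = 1" shows "cnj (complex_of_real s * c) * (complex_of_real s * c) = complex_of_real (s\<^sup>2)"
proof -
  have "cmod (s * c) ^ 2 = s\<^sup>2" using assms by (simp add: norm_mult)
  then show ?thesis by (metis complex_norm_square mult.commute)
qed

section \<open>The GNS seminorm and the Cauchy-Schwarz inequality\<close>

lemma fpositive_form_expand:
  assumes "fpositive g"
  shows "g (cstar (x + cscale t y) * (x + cscale t y)) =
    g (cstar x * x) + t * g (cstar x * y) + cnj t * g (cstar y * x) + cnj t * t * g (cstar y * y)"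
  by (simp add: cstar_add cstar_cscale distrib_left distrib_right cscale_eq_mult_left cscale_eq_mult_right
      cscale_mult dual_add[OF fpositive_dual[OF assms]] dual_cscale[OF fpositive_dual[OF assms]])

lemma fpositive_form_sym:
  assumes "fpositive g" shows "g (cstar y * x) = cnj (g (cstar x * y))"
proof -
  have r: "Im (g (cstar z * z)) = 0" for z using assms by (simp add: fpositive_def)
  have "Im (g (cstar x * y)) + Im (g (cstar y * x)) = 0"
    using r[of "x + cscale 1 y"] r[of x] r[of y] unfolding fpositive_form_expand[OF assms] by simp
  moreover have "Re (g (cstar x * y)) - Re (g (cstar y * x)) = 0"
    using r[of "x + cscale \<i> y"] r[of x] r[of y] unfolding fpositive_form_expand[OF assms] by simp
  ultimately show ?thesis by (simp add: complex_eq_iff)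
qed

text \<open>The length of the vector of \<open>x\<close> in the GNS space of \<open>g\<close>. It is
  used on \<open>A\<close> itself, without quotient or completion; the price is that representing
  vectors are obtained only approximately.\<close>

definition gnorm :: "('a::cstar_algebra \<Rightarrow> complex) \<Rightarrow> 'a \<Rightarrow> real" where
  "gnorm g x = sqrt (Re (g (cstar x * x)))"

lemma gnorm_nonneg: "fpositive g \<Longrightarrow> gnorm g x \<ge> 0"
  by (simp add: gnorm_def fpositive_def)

lemma gnorm_power2: "fpositive g \<Longrightarrow> (gnorm g x)\<^sup>2 = Re (g (cstar x * x))"
  by (simp add: gnorm_def fpositive_def)

lemma fpositive_self: "fpositive g \<Longrightarrow> g (cstar x * x) = complex_of_real ((gnorm g x)\<^sup>2)"
  by (simp add: gnorm_power2 complex_eq_iff fpositive_def)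

lemma cauchy_schwarz:
  assumes g: "fpositive g" shows "cmod (g (cstar y * x)) \<le> gnorm g y * gnorm g x"
proof -
  let ?w = "g (cstar y * x)"
  obtain d where d: "d * ?w = complex_of_real (cmod ?w)" "cmod d = 1" using unimodular_rotation by blast
  define c where "c = cnj d"
  have c: "cnj c * ?w = cmod ?w" "cmod c = 1" using d by (simp_all add: c_def)
  have c2: "c * g (cstar x * y) = cmod ?w"
    using arg_cong[OF c(1), of cnj] fpositive_form_sym[OF g, of x y] by simp
  have "0 \<le> (gnorm g x)\<^sup>2 + 2 * s * cmod ?w + s\<^sup>2 * (gnorm g y)\<^sup>2" for s :: real
  proof -
    let ?t = "s * c"
    have t: "?t * g (cstar x * y) = of_real (s * cmod ?w)" "cnj ?t * ?w = of_real (s * cmod ?w)"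
      using c2 c(1) by (simp_all add: mult.assoc)
    have "g (cstar (x + cscale ?t y) * (x + cscale ?t y))
        = g (cstar x * x) + of_real (s * cmod ?w) + of_real (s * cmod ?w) + of_real (s\<^sup>2) * g (cstar y * y)"
      by (simp only: fpositive_form_expand[OF g] t cnj_mult_unimodular[OF c(2)])
    then have "Re (g (cstar (x + cscale ?t y) * (x + cscale ?t y)))
        = (gnorm g x)\<^sup>2 + 2 * s * cmod ?w + s\<^sup>2 * (gnorm g y)\<^sup>2"
      by (simp add: gnorm_power2[OF g] del: of_real_power)
    then show ?thesis using g by (metis fpositive_def)
  qed
  then have "(cmod ?w)\<^sup>2 \<le> (gnorm g x)\<^sup>2 * (gnorm g y)\<^sup>2" by (rule quadratic_discriminant_le) simp
  then have "(cmod ?w)\<^sup>2 \<le> (gnorm g y * gnorm g x)\<^sup>2" by (simp add: power_mult_distrib mult.commute)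
  then show ?thesis by (rule power2_le_imp_le) (simp add: gnorm_nonneg g)
qed

lemma gnorm_le: assumes g: "fpositive g" shows "gnorm g x \<le> sqrt (dnorm g) * norm x"
proof -
  have "Re (g (cstar x * x)) \<le> dnorm g * (norm x)\<^sup>2"
    using dual_bound[OF fpositive_dual[OF g], of "cstar x * x"] complex_Re_le_cmod[of "g (cstar x * x)"]
    by (simp add: cstar_identity)
  then have "sqrt (Re (g (cstar x * x))) \<le> sqrt (dnorm g * (norm x)\<^sup>2)" by simp
  then show ?thesis by (simp add: gnorm_def real_sqrt_mult)
qed

lemma cauchy_schwarz_norm:
  assumes g: "fpositive g" shows "cmod (g (b * x)) \<le> sqrt (dnorm g) * norm b * gnorm g x"
  using cauchy_schwarz[OF g, of "cstar b" x] mult_right_mono[OF gnorm_le[OF g, of "cstar b"] gnorm_nonneg[OF g]]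
  by (simp add: cstar_cstar) (meson order_trans)

lemma gnorm_mult_le: assumes g: "fpositive g" shows "gnorm g (x * z) \<le> norm x * gnorm g z"
proof -
  have "0 \<le> Re (g ((norm x)\<^sup>2 *\<^sub>R (cstar z * z) - cstar (x * z) * (x * z)))"
    using fpositive_apositive[OF g apositive_compress] by blast
  then have "(gnorm g (x * z))\<^sup>2 \<le> (norm x * gnorm g z)\<^sup>2"
    using fpositive_dual[OF g] by (simp add: dual_diff dual_scaleR gnorm_power2[OF g] power_mult_distrib)
  then show ?thesis by (rule power2_le_imp_le) (simp add: gnorm_nonneg g)
qed

subsection \<open>The filter of approximate units\<close>

text \<open>Every bounded functional converges along this filter, and the limits define the unit of
  the bidual.\<close>

definition AU :: "'a::cstar_algebra filter" where
  "AU = (INF (F, \<epsilon>)\<in>{F. finite F} \<times> {0<..}. principal (aunit F \<epsilon>))"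

lemma eventually_AU:
  "eventually P AU \<longleftrightarrow> (\<exists>F \<epsilon>. finite F \<and> \<epsilon> > 0 \<and> (\<forall>e\<in>aunit F \<epsilon>. P e))"
proof -
  have "eventually P AU \<longleftrightarrow> (\<exists>b\<in>{F::'a set. finite F} \<times> {0<..}.
      eventually P (case b of (F, \<epsilon>) \<Rightarrow> principal (aunit F \<epsilon>)))"
    unfolding AU_def
  proof (rule eventually_INF_base)
    fix a b :: "'a set \<times> real"
    assume ab: "a \<in> {F. finite F} \<times> {0<..}" "b \<in> {F. finite F} \<times> {0<..}"
    then show "\<exists>x\<in>{F. finite F} \<times> {0<..}. (case x of (F, \<epsilon>) \<Rightarrow> principal (aunit F \<epsilon>)) \<le>
        inf (case a of (F, \<epsilon>) \<Rightarrow> principal (aunit F \<epsilon>)) (case b of (F, \<epsilon>) \<Rightarrow> principal (aunit F \<epsilon>))"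
      by (intro bexI[of _ "(fst a \<union> fst b, min (snd a) (snd b))"])
         (auto simp: aunit_def split: prod.splits)
  qed (auto intro: exI[of _ 1])
  then show ?thesis by (auto simp: eventually_principal)
qed

lemma AU_neq_bot: "AU \<noteq> bot"
  unfolding trivial_limit_def eventually_AU using aunit_nonempty by blast

lemma eventually_AU_basic: "eventually (\<lambda>e. cstar e = e \<and> norm e \<le> 1 \<and> apositive (e - e * e)) AU"
  unfolding eventually_AU by (intro exI[of _ "{}"] exI[of _ 1]) (auto simp: aunit_def)

lemma tendsto_AU_left: "((\<lambda>e. e * a) \<longlongrightarrow> a) AU"
proof (rule tendstoI)
  fix \<epsilon> :: real assume "\<epsilon> > 0"
  then show "eventually (\<lambda>e. dist (e * a) a < \<epsilon>) AU"
    unfolding eventually_AU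
    by (intro exI[of _ "{a}"] exI[of _ \<epsilon>]) (auto simp: aunit_def dist_norm norm_minus_commute)
qed

lemma tendsto_AU_right: "((\<lambda>e. a * e) \<longlongrightarrow> a) AU"
proof -
  have "((\<lambda>e. cstar (e * cstar a)) \<longlongrightarrow> cstar (cstar a)) AU" by (intro tendsto_cstar tendsto_AU_left)
  moreover have "eventually (\<lambda>e. cstar (e * cstar a) = a * e) AU"
    using eventually_AU_basic by eventually_elim (simp add: cstar_mult cstar_cstar)
  ultimately show ?thesis using Lim_transform_eventually by (simp add: cstar_cstar)
qed

text \<open>This is Cauchy-Schwarz against 1. Without a unit it is obtained from the inequality for
  \<open>e * x\<close> as \<open>e\<close> runs through the approximate units.\<close>

lemma cauchy_schwarz_unit:
  assumes g: "fpositive g" shows "cmod (g x) \<le> sqrt (dnorm g) * gnorm g x"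
proof (rule tendsto_upperbound[OF _ _ AU_neq_bot])
  show "((\<lambda>e. cmod (g (e * x))) \<longlongrightarrow> cmod (g x)) AU"
    by (intro tendsto_norm tendsto_dual[OF fpositive_dual[OF g]] tendsto_AU_left)
  show "eventually (\<lambda>e. cmod (g (e * x)) \<le> sqrt (dnorm g) * gnorm g x) AU"
    using eventually_AU_basic
  proof eventually_elim
    case (elim e)
    have "cmod (g (e * x)) \<le> sqrt (dnorm g) * norm e * gnorm g x" by (rule cauchy_schwarz_norm[OF g])
    also have "\<dots> \<le> sqrt (dnorm g) * 1 * gnorm g x"
      using elim by (intro mult_right_mono mult_left_mono gnorm_nonneg g)
        (auto simp: dnorm_nonneg fpositive_dual g)
    finally show ?case by simp
  qed
qed

text \<open>If \<open>x\<close> in the unit ball nearly attains the norm \<open>D\<close>,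
  Cauchy-Schwarz bounds \<open>cmod (g (e * x))\<close> by the square root of
  \<open>D * Re (g e)\<close>, since \<open>g (e * e) \<le> g e\<close>. As \<open>e * x\<close>
  tends to \<open>x\<close>, this forces \<open>g e\<close> up to \<open>D\<close>.\<close>

lemma fpositive_tendsto_dnorm:
  assumes g: "fpositive g" shows "(g \<longlongrightarrow> complex_of_real (dnorm g)) AU"
proof (rule tendstoI)
  fix \<epsilon> :: real assume "\<epsilon> > 0"
  note gd = fpositive_dual[OF g]
  define D where "D = dnorm g"
  have D0: "D \<ge> 0" unfolding D_def by (rule dnorm_nonneg[OF gd])
  \<comment> \<open>\<open>\<eta> \<le> D\<close> makes \<open>D - \<eta>\<close> nonnegative before
    squaring, and \<open>\<eta> \<le> \<epsilon> / 3\<close> absorbs the final loss of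
    \<open>2 * \<eta>\<close>.\<close>
  define \<eta> where "\<eta> = min (\<epsilon> / 3) D"
  show "eventually (\<lambda>e. dist (g e) (complex_of_real (dnorm g)) < \<epsilon>) AU"
  proof (cases "D = 0")
    case True
    then have "g x = 0" for x using dual_bound[OF gd, of x] by (simp add: D_def)
    then show ?thesis using True \<open>\<epsilon> > 0\<close> by (simp add: D_def)
  next
    case False
    then have "D > 0" using D0 by simp
    then have \<eta>: "\<eta> > 0" "\<eta> \<le> D" "\<eta> \<le> \<epsilon> / 3" using \<open>\<epsilon> > 0\<close> by (auto simp: \<eta>_def)
    then obtain x where x: "norm x \<le> 1" "D - \<eta> < cmod (g x)"
      using dnorm_approx[OF gd, of "D - \<eta>"] by (auto simp: D_def)
    have "((\<lambda>e. cmod (g (e * x))) \<longlongrightarrow> cmod (g x)) AU"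
      by (intro tendsto_norm tendsto_dual[OF gd] tendsto_AU_left)
    then have "eventually (\<lambda>e. D - \<eta> < cmod (g (e * x))) AU" using order_tendstoD(1) x(2) by blast
    then show ?thesis using eventually_AU_basic
    proof eventually_elim
      case (elim e)
      have "Im (g (e - e * e)) = 0" "Re (g (e - e * e)) \<ge> 0"
        using fpositive_apositive[OF g, of "e - e * e"] elim by blast+
      moreover have "Im (g (cstar e * e)) = 0" using g by (simp add: fpositive_def)
      ultimately have im: "Im (g e) = 0" and re: "(gnorm g e)\<^sup>2 \<le> Re (g e)"
        using elim by (auto simp: dual_diff[OF gd] gnorm_power2[OF g])
      have "cmod (g (e * x)) \<le> gnorm g e * gnorm g x"
        using cauchy_schwarz[OF g, of e x] elim by simp
      also have "\<dots> \<le> gnorm g e * sqrt D"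
        using order_trans[OF gnorm_le[OF g, of x] mult_left_le[OF x(1)]] D0
        by (intro mult_left_mono gnorm_nonneg g) (simp add: D_def)
      finally have "D - \<eta> < gnorm g e * sqrt D" using elim by simp
      then have "(D - \<eta>)\<^sup>2 \<le> (gnorm g e * sqrt D)\<^sup>2" using \<eta> by (intro power_mono) auto
      also have "\<dots> \<le> Re (g e) * D" using re D0 by (simp add: power_mult_distrib mult_right_mono)
      finally have "(D - \<eta>)\<^sup>2 \<le> D * Re (g e)" by (simp add: mult.commute)
      moreover have "D * (D - 2 * \<eta>) = (D - \<eta>)\<^sup>2 - \<eta>\<^sup>2"
        by (simp add: power2_eq_square algebra_simps)
      ultimately have "D * (D - 2 * \<eta>) \<le> D * Re (g e)" using zero_le_power2[of \<eta>] by linarith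
      then have "D - 2 * \<eta> \<le> Re (g e)" using \<open>D > 0\<close> by simp
      moreover have "Re (g e) \<le> D"
      proof -
        have "Re (g e) \<le> D * norm e"
          using dual_bound[OF gd, of e] complex_Re_le_cmod[of "g e"] by (simp add: D_def)
        also have "\<dots> \<le> D" using elim D0 by (simp add: mult_left_le)
        finally show ?thesis .
      qed
      moreover have "g e = complex_of_real (Re (g e))" using im by (simp add: complex_eq_iff)
      then have "dist (g e) (complex_of_real D) = \<bar>Re (g e) - D\<bar>"
        by (metis dist_norm norm_of_real of_real_diff)
      ultimately show ?case using \<eta> \<open>\<epsilon> > 0\<close> by (simp add: D_def)
    qed
  qed
qed

text \<open>An approximate Riesz representation: a near-minimiser \<open>a\<close> of the functional
  \<open>g(x\<^sup>*x) - 2 Re k(x)\<close> almost represents \<open>k\<close>.\<close>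

lemma riesz_approx:
  assumes g: "fpositive g"
    and add: "\<And>x y. k (x + y) = k x + k y" and scale: "\<And>c x. k (cscale c x) = c * k x"
    and bound: "\<And>x. cmod (k x) \<le> K * gnorm g x" and K: "K \<ge> 0" and \<delta>: "\<delta> > 0"
  obtains a where "\<And>x. cmod (k x - g (cstar a * x)) \<le> \<delta> * gnorm g x" "gnorm g a \<le> K + \<delta>"
proof -
  define J where "J x = (gnorm g x)\<^sup>2 - 2 * Re (k x)" for x
  have lower: "- K\<^sup>2 \<le> J x" for x
  proof -
    have "Re (k x) \<le> K * gnorm g x" using bound[of x] complex_Re_le_cmod[of "k x"] by linarith
    moreover have "0 \<le> (gnorm g x - K)\<^sup>2" by simp
    ultimately show ?thesis unfolding J_def power2_diff by (simp add: mult_ac)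
  qed
  have bdd: "bdd_below (range J)" using lower by (intro bdd_belowI2)
  \<comment> \<open>An exact minimum would call for a complete GNS space. A value within the square
    of \<open>\<delta>\<close> of the infimum suffices, and \<open>\<delta>\<close> reappears as the
    error of the representation.\<close>
  have "\<exists>a. J a < (INF x. J x) + \<delta>\<^sup>2"
  proof (rule ccontr)
    assume "\<nexists>a. J a < (INF x. J x) + \<delta>\<^sup>2"
    then have "(INF x. J x) + \<delta>\<^sup>2 \<le> (INF x. J x)" by (intro cINF_greatest) (auto simp: not_less)
    then show False using \<delta> by simp
  qed
  then obtain a where "J a < (INF x. J x) + \<delta>\<^sup>2" by blast
  then have a: "J a \<le> J x + \<delta>\<^sup>2" for x using cINF_lower[OF bdd, of x] by simp
  have main: "cmod (k x - g (cstar a * x)) \<le> \<delta> * gnorm g x" for x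
  proof -
    let ?w = "k x - g (cstar a * x)"
    obtain c where c: "c * ?w = complex_of_real (cmod ?w)" "cmod c = 1" using unimodular_rotation by blast
    \<comment> \<open>\<open>J\<close> at \<open>a\<close> is compared with \<open>J\<close> at
      \<open>a + s c x\<close>, where \<open>c\<close> makes the linear term real. The discriminant
      of this quadratic in \<open>s\<close> is the wanted estimate.\<close>
    have "\<delta>\<^sup>2 + 2 * s * (- cmod ?w) + s\<^sup>2 * (gnorm g x)\<^sup>2 \<ge> 0" for s :: real
    proof -
      let ?t = "s * c"
      have tt: "cnj ?t * ?t = of_real (s\<^sup>2)"
        by (rule cnj_mult_unimodular[OF c(2)])
      have sym: "cnj ?t * g (cstar x * a) = cnj (?t * g (cstar a * x))"
        using fpositive_form_sym[OF g, of x a] by simp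
      have "(gnorm g (a + cscale ?t x))\<^sup>2
          = (gnorm g a)\<^sup>2 + 2 * Re (?t * g (cstar a * x)) + s\<^sup>2 * (gnorm g x)\<^sup>2"
        unfolding gnorm_power2[OF g] fpositive_form_expand[OF g] tt sym by (simp add: gnorm_power2[OF g])
      then have "J (a + cscale ?t x) = J a + s\<^sup>2 * (gnorm g x)\<^sup>2 - 2 * Re (?t * ?w)"
        by (simp add: J_def add scale right_diff_distrib)
      moreover have "Re (?t * ?w) = s * cmod ?w" using c(1) by (simp add: mult.assoc)
      ultimately show ?thesis using a[of "a + cscale ?t x"] by simp
    qed
    then have "(- cmod ?w)\<^sup>2 \<le> \<delta>\<^sup>2 * (gnorm g x)\<^sup>2" by (rule quadratic_discriminant_le) simp
    then have "(cmod ?w)\<^sup>2 \<le> (\<delta> * gnorm g x)\<^sup>2" by (simp add: power_mult_distrib)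
    then show ?thesis by (rule power2_le_imp_le) (use \<delta> gnorm_nonneg[OF g] in simp)
  qed
  have "(gnorm g a)\<^sup>2 \<le> (K + \<delta>) * gnorm g a"
  proof -
    have "(gnorm g a)\<^sup>2 = cmod (g (cstar a * a))" using fpositive_self[OF g, of a] by (simp add: norm_power)
    also have "\<dots> \<le> cmod (k a) + cmod (k a - g (cstar a * a))"
      using norm_triangle_ineq4[of "k a" "k a - g (cstar a * a)"] by simp
    also have "\<dots> \<le> K * gnorm g a + \<delta> * gnorm g a" using bound main by (intro add_mono)
    finally show ?thesis by (simp add: distrib_right)
  qed
  then have "gnorm g a \<le> K + \<delta>"
    using gnorm_nonneg[OF g, of a] K \<delta> by (cases "gnorm g a = 0") (auto simp: power2_eq_square)
  with main show thesis by (rule that)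
qed

section \<open>The bidual\<close>

lemma bidualI:
  assumes "\<And>f g. f \<in> dual \<Longrightarrow> g \<in> dual \<Longrightarrow> F (\<lambda>x. f x + g x) = F f + F g"
    "\<And>f c. f \<in> dual \<Longrightarrow> F (\<lambda>x. c * f x) = c * F f"
    "\<And>f. f \<in> dual \<Longrightarrow> cmod (F f) \<le> K * dnorm f" "\<And>f. f \<notin> dual \<Longrightarrow> F f = 0"
  shows "F \<in> bidual"
  unfolding bidual_def by (intro CollectI conjI ballI allI impI exI[of _ K] assms)

lemma bidual_add: "F \<in> bidual \<Longrightarrow> f \<in> dual \<Longrightarrow> g \<in> dual \<Longrightarrow> F (\<lambda>x. f x + g x) = F f + F g"
  and bidual_mult: "F \<in> bidual \<Longrightarrow> f \<in> dual \<Longrightarrow> F (\<lambda>x. c * f x) = c * F f"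
  and bidual_outside: "F \<in> bidual \<Longrightarrow> f \<notin> dual \<Longrightarrow> F f = 0"
  by (auto simp: bidual_def)

lemma bidual_diff: "F \<in> bidual \<Longrightarrow> f \<in> dual \<Longrightarrow> g \<in> dual \<Longrightarrow> F (\<lambda>x. f x - g x) = F f - F g"
  using bidual_add[of F f "\<lambda>x. (-1) * g x"] bidual_mult[of F g "-1"] dual_mult[of g "-1"] by simp

lemma bidual_eqI:
  assumes "F \<in> bidual" "G \<in> bidual" "\<And>f. f \<in> dual \<Longrightarrow> F f = G f" shows "F = G"
  using assms bidual_outside by (metis ext)

lemma dnorm_mult_le: assumes "f \<in> dual" shows "dnorm (\<lambda>x. c * f x) \<le> cmod c * dnorm f"
  by (rule dnorm_leI') (auto simp: norm_mult mult.assoc dnorm_nonneg assms intro!: mult_left_mono dual_bound)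

lemma bidual_bound:
  assumes F: "F \<in> bidual" and f: "f \<in> dual" shows "cmod (F f) \<le> bnorm F * dnorm f"
proof -
  obtain K where K: "\<And>f. f \<in> dual \<Longrightarrow> cmod (F f) \<le> K * dnorm f" using F unfolding bidual_def by blast
  show ?thesis
  proof (cases "dnorm f = 0")
    case True
    then show ?thesis using K[OF f] by simp
  next
    case False
    then have d: "dnorm f > 0" using dnorm_nonneg[OF f] by simp
    have "cmod (F g) \<le> \<bar>K\<bar>" if "g \<in> dual" "dnorm g \<le> 1" for g
    proof -
      have "K * dnorm g \<le> \<bar>K\<bar> * 1" using that dnorm_nonneg[of g] by (intro mult_mono) auto
      then show ?thesis using K[OF that(1)] by simp
    qed
    then have bdd: "bdd_above {cmod (F f) | f. f \<in> dual \<and> dnorm f \<le> 1}" by (intro bdd_aboveI[of _ "\<bar>K\<bar>"]) auto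
    let ?g = "\<lambda>x. complex_of_real (1 / dnorm f) * f x"
    have g: "?g \<in> dual" by (rule dual_mult[OF f])
    have "dnorm ?g \<le> 1" using dnorm_mult_le[OF f, of "1 / dnorm f"] d by (simp add: norm_divide)
    then have "cmod (F ?g) \<le> bnorm F" unfolding bnorm_def using g by (intro cSup_upper[OF _ bdd]) blast
    moreover have "cmod (F ?g) = cmod (F f) / dnorm f"
      using d unfolding bidual_mult[OF F f] by (simp add: norm_mult norm_divide)
    ultimately show ?thesis using d by (simp add: divide_le_eq)
  qed
qed

lemma bnorm_leI:
  assumes "\<And>f. f \<in> dual \<Longrightarrow> cmod (F f) \<le> K * dnorm f" "K \<ge> 0" shows "bnorm F \<le> K"
  unfolding bnorm_def
proof (rule cSup_least)
  show "{cmod (F f) | f. f \<in> dual \<and> dnorm f \<le> 1} \<noteq> {}"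
    using dual_const_zero dnorm_leI'[of "\<lambda>x::'a. 0" 0] by (auto intro!: exI[of _ "\<lambda>x. 0"])
  fix c assume "c \<in> {cmod (F f) | f. f \<in> dual \<and> dnorm f \<le> 1}"
  then obtain f where "c = cmod (F f)" "f \<in> dual" "dnorm f \<le> 1" by blast
  then show "c \<le> K" using assms(1)[of f] mult_left_le[of "dnorm f" K] assms(2) by simp
qed

lemma bnorm_nonneg: assumes "F \<in> bidual" shows "bnorm F \<ge> 0"
proof (rule ccontr)
  assume "\<not> bnorm F \<ge> 0"
  then have neg: "bnorm F < 0" by simp
  have "F f = 0" if "f \<in> dual" for f
  proof -
    have "bnorm F * dnorm f \<le> 0" using neg dnorm_nonneg[OF that] by (simp add: mult_le_0_iff)
    then have "cmod (F f) \<le> 0" using bidual_bound[OF assms that] by linarith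
    then show ?thesis by simp
  qed
  then have "{cmod (F f) | f. f \<in> dual \<and> dnorm f \<le> 1} = {0}"
    using dual_const_zero dnorm_leI'[of "\<lambda>x::'a. 0" 0] by (auto intro!: exI[of _ "\<lambda>x. 0"])
  then show False using neg by (simp add: bnorm_def)
qed

lemma bidual_close:
  assumes "F \<in> bidual" "f \<in> dual" "h \<in> dual" "\<And>x. cmod (f x - h x) \<le> K * norm x" "K \<ge> 0"
  shows "cmod (F f - F h) \<le> bnorm F * K"
proof -
  have "cmod (F (\<lambda>x. f x - h x)) \<le> bnorm F * dnorm (\<lambda>x. f x - h x)"
    by (intro bidual_bound dual_minus_fun assms)
  also have "\<dots> \<le> bnorm F * K"
    by (intro mult_left_mono bnorm_nonneg assms dnorm_leI')
  finally show ?thesis using bidual_diff[OF assms(1-3)] by simp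
qed

lemma Fmod_dual:
  assumes F: "F \<in> bidual" and f: "f \<in> dual"
  shows "Fmod F f \<in> dual" "dnorm (Fmod F f) \<le> bnorm F * dnorm f"
proof -
  have m: "fmod f a \<in> dual" for a unfolding fmod_def by (rule dual_lmult[OF f])
  have b: "cmod (Fmod F f a) \<le> (bnorm F * dnorm f) * norm a" for a
  proof -
    have "dnorm (fmod f a) \<le> dnorm f * norm a"
    proof (rule dnorm_leI')
      show "cmod (fmod f a x) \<le> dnorm f * norm a * norm x" for x
        using order_trans[OF dual_bound[OF f] mult_left_mono[OF norm_mult_ineq dnorm_nonneg[OF f]], of a x]
        by (simp add: fmod_def mult.assoc)
    qed (simp add: dnorm_nonneg[OF f])
    then have "bnorm F * dnorm (fmod f a) \<le> bnorm F * (dnorm f * norm a)"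
      by (intro mult_left_mono bnorm_nonneg F)
    then show ?thesis using bidual_bound[OF F m, of a] by (simp add: Fmod_def mult.assoc)
  qed
  have "fmod f (x + y) = (\<lambda>b. fmod f x b + fmod f y b)" for x y
    by (auto simp: fmod_def distrib_right dual_add[OF f])
  moreover have "fmod f (cscale c x) = (\<lambda>b. c * fmod f x b)" for c x
    by (auto simp: fmod_def cscale_eq_mult_left dual_cscale[OF f])
  ultimately show "Fmod F f \<in> dual"
    by (intro dualI[OF _ _ b]) (simp_all add: Fmod_def bidual_add[OF F m m] bidual_mult[OF F m])
  show "dnorm (Fmod F f) \<le> bnorm F * dnorm f"
    by (rule dnorm_leI'[OF b]) (simp add: bnorm_nonneg dnorm_nonneg F f)
qed

text \<open>The mirror image of \<open>Fmod\<close>, from which the second Arens product is built.\<close>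

definition Fmod2 :: "(('a::cstar_algebra \<Rightarrow> complex) \<Rightarrow> complex) \<Rightarrow> ('a \<Rightarrow> complex) \<Rightarrow> ('a \<Rightarrow> complex)" where
  "Fmod2 F f = (\<lambda>z. F (\<lambda>b. f (b * z)))"

lemma Fmod2_dual:
  assumes F: "F \<in> bidual" and f: "f \<in> dual"
  shows "Fmod2 F f \<in> dual"
proof -
  have m: "(\<lambda>b. f (b * z)) \<in> dual" for z by (rule dual_rmult[OF f])
  have b: "cmod (Fmod2 F f a) \<le> (bnorm F * dnorm f) * norm a" for a
  proof -
    have "dnorm (\<lambda>b. f (b * a)) \<le> dnorm f * norm a"
    proof (rule dnorm_leI')
      show "cmod (f (x * a)) \<le> dnorm f * norm a * norm x" for x
        using order_trans[OF dual_bound[OF f] mult_left_mono[OF norm_mult_ineq dnorm_nonneg[OF f]], of x a]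
        by (simp add: mult_ac)
    qed (simp add: dnorm_nonneg[OF f])
    then have "bnorm F * dnorm (\<lambda>b. f (b * a)) \<le> bnorm F * (dnorm f * norm a)"
      by (intro mult_left_mono bnorm_nonneg F)
    then show ?thesis using bidual_bound[OF F m, of a] by (simp add: Fmod2_def mult.assoc)
  qed
  show ?thesis
    by (rule dualI[OF _ _ b])
       (simp_all add: Fmod2_def distrib_left dual_add[OF f] bidual_add[OF F m m] cscale_eq_mult_right
         dual_cscale[OF f] bidual_mult[OF F m])
qed

lemma Fmod_linear:
  assumes "F \<in> bidual" "f \<in> dual" "g \<in> dual"
  shows "Fmod F (\<lambda>x. f x + g x) = (\<lambda>a. Fmod F f a + Fmod F g a)"
    "Fmod F (\<lambda>x. c * f x) = (\<lambda>a. c * Fmod F f a)"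
  unfolding Fmod_def fmod_def
  by (simp_all add: bidual_add[OF assms(1) dual_lmult[OF assms(2)] dual_lmult[OF assms(3)]]
      bidual_mult[OF assms(1) dual_lmult[OF assms(2)]])

lemma Fmod2_linear:
  assumes "F \<in> bidual" "f \<in> dual" "g \<in> dual"
  shows "Fmod2 F (\<lambda>x. f x + g x) = (\<lambda>a. Fmod2 F f a + Fmod2 F g a)"
    "Fmod2 F (\<lambda>x. c * f x) = (\<lambda>a. c * Fmod2 F f a)"
  unfolding Fmod2_def
  by (simp_all add: bidual_add[OF assms(1) dual_rmult[OF assms(2)] dual_rmult[OF assms(3)]]
      bidual_mult[OF assms(1) dual_rmult[OF assms(2)]])

text \<open>The value of \<open>G\<close> at \<open>\<lambda>b. g (cstar z * b)\<close> is conjugate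
  linear in \<open>z\<close>. Its complex conjugate is linear and bounded in the GNS seminorm, so
  the approximate Riesz representation applies to that.\<close>

lemma riesz_right:
  assumes g: "fpositive g" and G: "G \<in> bidual" and \<delta>: "\<delta> > 0"
  obtains y where "\<And>z. cmod (G (\<lambda>b. g (cstar z * b)) - g (cstar z * y)) \<le> \<delta> * gnorm g z"
    "gnorm g y \<le> bnorm G * sqrt (dnorm g) + \<delta>"
proof -
  note gd = fpositive_dual[OF g]
  have m: "(\<lambda>b. g (a * b)) \<in> dual" for a by (rule dual_lmult[OF gd])
  let ?k = "\<lambda>z. cnj (G (\<lambda>b. g (cstar z * b)))"
  have K: "bnorm G * sqrt (dnorm g) \<ge> 0" by (simp add: bnorm_nonneg dnorm_nonneg G gd)
  have bound: "cmod (?k z) \<le> bnorm G * sqrt (dnorm g) * gnorm g z" for z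
  proof -
    have "dnorm (\<lambda>b. g (cstar z * b)) \<le> sqrt (dnorm g) * gnorm g z"
    proof (rule dnorm_leI')
      show "cmod (g (cstar z * x)) \<le> sqrt (dnorm g) * gnorm g z * norm x" for x
        using order_trans[OF cauchy_schwarz[OF g] mult_left_mono[OF gnorm_le[OF g] gnorm_nonneg[OF g]], of z x]
        by (simp add: mult_ac)
    qed (simp add: dnorm_nonneg gnorm_nonneg g gd)
    then have "bnorm G * dnorm (\<lambda>b. g (cstar z * b)) \<le> bnorm G * (sqrt (dnorm g) * gnorm g z)"
      by (intro mult_left_mono bnorm_nonneg G)
    then show ?thesis using bidual_bound[OF G m, of "cstar z"] by (simp add: mult.assoc)
  qed
  have add: "?k (x + y) = ?k x + ?k y" for x y
    by (simp add: cstar_add distrib_right dual_add[OF gd] bidual_add[OF G m m])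
  have sc: "?k (cscale c x) = c * ?k x" for c x
    by (simp add: cstar_cscale cscale_eq_mult_left dual_cscale[OF gd] bidual_mult[OF G m])
  obtain y where y: "\<And>z. cmod (?k z - g (cstar y * z)) \<le> \<delta> * gnorm g z"
      "gnorm g y \<le> bnorm G * sqrt (dnorm g) + \<delta>"
    using riesz_approx[OF g add sc bound K \<delta>] by blast
  have "cmod (G (\<lambda>b. g (cstar z * b)) - g (cstar z * y)) = cmod (?k z - g (cstar y * z))" for z
    by (metis complex_cnj_cnj complex_cnj_diff complex_mod_cnj fpositive_form_sym[OF g])
  with y show thesis by (intro that) auto
qed

text \<open>Both sides are close to \<open>g(u\<^sup>* y)\<close>, where \<open>y\<close> and \<open>u\<close> approximately represent \<open>G\<close> and \<open>F\<close>.\<close>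

lemma arens_regular_pos:
  assumes g: "fpositive g" and F: "F \<in> bidual" and G: "G \<in> bidual"
  shows "F (Fmod G g) = G (Fmod2 F g)"
proof -
  note gd = fpositive_dual[OF g]
  define D where "D = sqrt (dnorm g)"
  have D0: "D \<ge> 0" by (simp add: D_def dnorm_nonneg gd)
  define C where "C = bnorm F * D + (bnorm G * D + 1) + (bnorm F * D + 1) + bnorm G * D"
  have nn: "bnorm F \<ge> 0" "bnorm G \<ge> 0" by (simp_all add: bnorm_nonneg F G)
  have C0: "C > 0" using mult_nonneg_nonneg[OF nn(1) D0] mult_nonneg_nonneg[OF nn(2) D0] unfolding C_def by linarith
  have est: "cmod (F (Fmod G g) - G (Fmod2 F g)) \<le> \<delta> * C" if \<delta>: "\<delta> > 0" "\<delta> \<le> 1" for \<delta>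
  proof -
    obtain y where y: "\<And>z. cmod (G (\<lambda>b. g (cstar z * b)) - g (cstar z * y)) \<le> \<delta> * gnorm g z"
        "gnorm g y \<le> bnorm G * D + \<delta>"
      using riesz_right[OF g G \<delta>(1)] unfolding D_def by blast
    have kb: "cmod (Fmod2 F g z) \<le> bnorm F * D * gnorm g z" for z
    proof -
      have "dnorm (\<lambda>b. g (b * z)) \<le> D * gnorm g z"
      proof (rule dnorm_leI')
        show "cmod (g (x * z)) \<le> D * gnorm g z * norm x" for x
          using cauchy_schwarz_norm[OF g, of x z] by (simp add: D_def mult_ac)
      qed (simp add: D0 gnorm_nonneg g)
      then have "bnorm F * dnorm (\<lambda>b. g (b * z)) \<le> bnorm F * (D * gnorm g z)"
        by (intro mult_left_mono nn)
      then show ?thesis using bidual_bound[OF F dual_rmult[OF gd], of z] by (simp add: Fmod2_def mult.assoc)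
    qed
    note kd = Fmod2_dual[OF F gd]
    obtain u where u: "\<And>z. cmod (Fmod2 F g z - g (cstar u * z)) \<le> \<delta> * gnorm g z"
        "gnorm g u \<le> bnorm F * D + \<delta>"
      using riesz_approx[OF g dual_add[OF kd] dual_cscale[OF kd] kb _ \<delta>(1)] nn D0 by auto
    \<comment> \<open>The four estimates link \<open>F (Fmod G g)\<close>,
      \<open>F (\<lambda>b. g (b * y))\<close>, \<open>g (cstar u * y)\<close>,
      \<open>G (\<lambda>b. g (cstar u * b))\<close> and \<open>G (Fmod2 F g)\<close> in this order;
      each link costs a multiple of \<open>\<delta>\<close>, and \<open>C\<close> collects the
      factors.\<close>
    have e1: "cmod (F (Fmod G g) - F (\<lambda>b. g (b * y))) \<le> bnorm F * (\<delta> * D)"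
    proof (rule bidual_close[OF F Fmod_dual(1)[OF G gd] dual_rmult[OF gd]])
      show "cmod (Fmod G g x - g (x * y)) \<le> \<delta> * D * norm x" for x
        using order_trans[OF y(1)[of "cstar x"] mult_left_mono[OF gnorm_le[OF g, of "cstar x"], of \<delta>]] \<delta>(1)
        by (simp add: Fmod_def fmod_def cstar_cstar D_def mult_ac)
    qed (simp add: D0 less_imp_le \<delta>)
    have e2: "cmod (F (\<lambda>b. g (b * y)) - g (cstar u * y)) \<le> \<delta> * (bnorm G * D + 1)"
      using order_trans[OF u(1)[of y] mult_left_mono[OF order_trans[OF y(2)], of "bnorm G * D + 1" \<delta>]] \<delta>
      by (simp add: Fmod2_def)
    have e3: "cmod (G (\<lambda>b. g (cstar u * b)) - g (cstar u * y)) \<le> \<delta> * (bnorm F * D + 1)"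
      using order_trans[OF y(1)[of u] mult_left_mono[OF order_trans[OF u(2)], of "bnorm F * D + 1" \<delta>]] \<delta>
      by simp
    have e4: "cmod (G (Fmod2 F g) - G (\<lambda>b. g (cstar u * b))) \<le> bnorm G * (\<delta> * D)"
    proof (rule bidual_close[OF G kd dual_lmult[OF gd]])
      show "cmod (Fmod2 F g x - g (cstar u * x)) \<le> \<delta> * D * norm x" for x
        using order_trans[OF u(1)[of x] mult_left_mono[OF gnorm_le[OF g, of x], of \<delta>]] \<delta>(1)
        by (simp add: D_def mult_ac)
    qed (simp add: D0 less_imp_le \<delta>)
    have tri: "cmod (a - d) \<le> cmod (a - b) + cmod (b - e) + cmod (c - e) + cmod (d - c)" for a b c d e :: complex
    proof -
      have "cmod (a - d) = cmod ((a - b) + (b - e) - (c - e) - (d - c))" by (rule arg_cong) simp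
      then show ?thesis
        using norm_triangle_ineq4[of "(a - b) + (b - e) - (c - e)" "d - c"]
          norm_triangle_ineq4[of "(a - b) + (b - e)" "c - e"] norm_triangle_ineq[of "a - b" "b - e"]
        by linarith
    qed
    have "cmod (F (Fmod G g) - G (Fmod2 F g)) \<le> bnorm F * (\<delta> * D) + \<delta> * (bnorm G * D + 1)
        + \<delta> * (bnorm F * D + 1) + bnorm G * (\<delta> * D)"
      using tri[of "F (Fmod G g)" "G (Fmod2 F g)" "F (\<lambda>b. g (b * y))" "g (cstar u * y)"
          "G (\<lambda>b. g (cstar u * b))"] e1 e2 e3 e4 by linarith
    also have "\<dots> = \<delta> * C" by (simp add: C_def algebra_simps)
    finally show ?thesis .
  qed
  have "cmod (F (Fmod G g) - G (Fmod2 F g)) \<le> 0 + e" if e: "e > 0" for e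
  proof -
    have "min 1 (e / C) * C \<le> e" using C0 by (simp add: min_def field_simps)
    moreover have "cmod (F (Fmod G g) - G (Fmod2 F g)) \<le> min 1 (e / C) * C"
      using C0 e by (intro est) auto
    ultimately show ?thesis by linarith
  qed
  then have "cmod (F (Fmod G g) - G (Fmod2 F g)) \<le> 0" by (rule field_le_epsilon)
  then show ?thesis by simp
qed

lemma arens_regular:
  assumes "f \<in> dual" and F: "F \<in> bidual" and G: "G \<in> bidual"
  shows "F (Fmod G f) = G (Fmod2 F f)"
  using assms(1)
proof (induction rule: dual_induct)
  case (pos g) then show ?case using arens_regular_pos F G by blast
next
  case (add f g)
  then show ?case
    by (simp add: Fmod_linear[OF G] Fmod2_linear[OF F] bidual_add[OF F] bidual_add[OF G]
        Fmod_dual(1)[OF G] Fmod2_dual[OF F])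
next
  case (mult c f)
  then show ?case
    by (simp add: Fmod_linear(2)[OF G] Fmod2_linear(2)[OF F] bidual_mult[OF F] bidual_mult[OF G]
        Fmod_dual(1)[OF G] Fmod2_dual[OF F])
qed

section \<open>The Arens product and the involution\<close>

lemma arens_bidual:
  assumes F: "F \<in> bidual" and G: "G \<in> bidual"
  shows "arens F G \<in> bidual" "bnorm (arens F G) \<le> bnorm F * bnorm G"
proof -
  have b: "cmod (arens F G f) \<le> (bnorm F * bnorm G) * dnorm f" if f: "f \<in> dual" for f
  proof -
    have "cmod (F (Fmod G f)) \<le> bnorm F * dnorm (Fmod G f)" by (intro bidual_bound F Fmod_dual G f)
    also have "\<dots> \<le> bnorm F * (bnorm G * dnorm f)"
      by (intro mult_left_mono bnorm_nonneg F Fmod_dual G f)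
    finally show ?thesis using f by (simp add: arens_def mult.assoc)
  qed
  show "bnorm (arens F G) \<le> bnorm F * bnorm G"
    by (rule bnorm_leI[OF b]) (simp_all add: bnorm_nonneg F G)
  show "arens F G \<in> bidual"
    by (rule bidualI[OF _ _ b])
       (simp_all add: arens_def dual_plus dual_mult Fmod_linear[OF G] Fmod_linear(2)[OF G, of _ _ ]
         bidual_add[OF F] bidual_mult[OF F] Fmod_dual(1)[OF G])
qed

lemma dstar_dstar: "dstar (dstar f) = f"
  by (simp add: dstar_def cstar_cstar)

lemma dnorm_dstar: assumes "f \<in> dual" shows "dnorm (dstar f) = dnorm f"
proof -
  have le: "dnorm (dstar f) \<le> dnorm f" if "f \<in> dual" for f :: "'a \<Rightarrow> complex"
    by (rule dnorm_leI') (use dual_bound[OF that, of "cstar _"] dnorm_nonneg[OF that] in \<open>auto simp: dstar_def\<close>)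
  show ?thesis using le[OF assms] le[OF dual_dstar[OF assms]] by (simp add: dstar_dstar)
qed

lemma bstar_bidual:
  assumes F: "F \<in> bidual"
  shows "bstar F \<in> bidual" "bnorm (bstar F) \<le> bnorm F"
proof -
  have b: "cmod (bstar F f) \<le> bnorm F * dnorm f" if f: "f \<in> dual" for f
    using bidual_bound[OF F dual_dstar[OF f]] f by (simp add: bstar_def dnorm_dstar)
  show "bnorm (bstar F) \<le> bnorm F" by (rule bnorm_leI[OF b]) (simp_all add: bnorm_nonneg F)
  have "dstar (\<lambda>x. f x + g x) = (\<lambda>x. dstar f x + dstar g x)" "dstar (\<lambda>x. c * f x) = (\<lambda>x. cnj c * dstar f x)"
    for f g :: "'a \<Rightarrow> complex" and c by (simp_all add: dstar_def)
  then show "bstar F \<in> bidual"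
    by (intro bidualI[OF _ _ b])
       (simp_all add: bstar_def dual_plus dual_mult dual_dstar bidual_add[OF F] bidual_mult[OF F])
qed

lemma bstar_bstar: "F \<in> bidual \<Longrightarrow> bstar (bstar F) = F"
  by (rule bidual_eqI) (simp_all add: bstar_bidual, simp add: bstar_def dual_dstar dstar_dstar)

lemma Fmod_bstar:
  assumes F: "F \<in> bidual" and f: "f \<in> dual"
  shows "Fmod (bstar F) f = dstar (Fmod2 F (dstar f))"
proof
  fix z
  have "dstar (\<lambda>b. f (z * b)) = (\<lambda>b. dstar f (b * cstar z))"
    by (simp add: dstar_def cstar_mult cstar_cstar)
  then show "Fmod (bstar F) f z = dstar (Fmod2 F (dstar f)) z"
    by (simp add: Fmod_def fmod_def bstar_def dual_lmult[OF f]) (simp add: dstar_def Fmod2_def)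
qed

text \<open>The involution exchanges the two Arens products, so antimultiplicativity is a form of
  regularity.\<close>

lemma bstar_arens:
  assumes F: "F \<in> bidual" and G: "G \<in> bidual"
  shows "bstar (arens F G) = arens (bstar G) (bstar F)"
proof (rule bidual_eqI)
  fix f :: "'a \<Rightarrow> complex" assume f: "f \<in> dual"
  have "bstar (arens F G) f = cnj (F (Fmod G (dstar f)))" using f by (simp add: bstar_def arens_def dual_dstar)
  also have "\<dots> = cnj (G (Fmod2 F (dstar f)))" using arens_regular[OF dual_dstar[OF f] F G] by simp
  also have "\<dots> = arens (bstar G) (bstar F) f"
    using f F by (simp add: arens_def Fmod_bstar bstar_def[of G] dual_dstar Fmod2_dual dstar_dstar)
  finally show "bstar (arens F G) f = arens (bstar G) (bstar F) f" .
qed (intro bstar_bidual arens_bidual F G)+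

lemma Fmod_arens:
  assumes "F \<in> bidual" "G \<in> bidual" "f \<in> dual"
  shows "Fmod (arens F G) f = Fmod F (Fmod G f)"
proof
  fix a
  have "Fmod G (\<lambda>b. f (a * b)) = (\<lambda>b. Fmod G f (a * b))"
    by (simp add: Fmod_def fmod_def mult.assoc)
  then show "Fmod (arens F G) f a = Fmod F (Fmod G f) a"
    unfolding Fmod_def[of "arens F G"] Fmod_def[of F] fmod_def
    by (simp add: arens_def dual_lmult[OF assms(3)])
qed

lemma arens_assoc:
  assumes "F \<in> bidual" "G \<in> bidual" "H \<in> bidual"
  shows "arens (arens F G) H = arens F (arens G H)"
proof (rule bidual_eqI)
  fix f :: "'a \<Rightarrow> complex" assume f: "f \<in> dual"
  have "arens (arens F G) H f = F (Fmod G (Fmod H f))"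
    using f assms by (simp add: arens_def Fmod_dual)
  also have "\<dots> = F (Fmod (arens G H) f)" using f assms by (simp only: Fmod_arens)
  also have "\<dots> = arens F (arens G H) f" using f by (simp add: arens_def[of F])
  finally show "arens (arens F G) H f = arens F (arens G H) f" .
qed (intro arens_bidual assms)+

lemma iota_bidual: "iota a \<in> bidual"
  by (rule bidualI[where K="norm a"])
     (auto simp: iota_def dual_plus dual_mult intro: order_trans[OF dual_bound])

lemma bstar_iota: "bstar (iota a) = iota (cstar a)"
  by (rule ext) (simp add: bstar_def iota_def dual_dstar, simp add: dstar_def)

lemma arens_iota_left: "f \<in> dual \<Longrightarrow> F \<in> bidual \<Longrightarrow> arens (iota a) F f = F (\<lambda>b. f (a * b))"
  by (simp add: arens_def iota_def Fmod_dual) (simp add: Fmod_def fmod_def)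

lemma arens_iota_right: "f \<in> dual \<Longrightarrow> arens F (iota a) f = F (\<lambda>b. f (b * a))"
  by (simp add: arens_def iota_def Fmod_def fmod_def dual_lmult)

lemma arens_iota_iota: "arens (iota a) (iota b) = iota (a * b)"
  by (rule bidual_eqI)
     (simp_all add: arens_bidual iota_bidual arens_iota_left, simp add: iota_def dual_lmult)

text \<open>If \<open>y\<close> approximately represents \<open>W\<close> with respect to
  \<open>g\<close>, the value in question is close to \<open>g (cstar y * y)\<close>, a nonnegative
  real.\<close>

lemma bidual_positive:
  assumes g: "fpositive g" and W: "W \<in> bidual"
  shows "Im (arens (bstar W) W g) = 0" "Re (arens (bstar W) W g) \<ge> 0"
proof -
  note gd = fpositive_dual[OF g]
  define D where "D = sqrt (dnorm g)"
  have D0: "D \<ge> 0" by (simp add: D_def dnorm_nonneg gd)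
  have nn: "bnorm W \<ge> 0" by (simp add: bnorm_nonneg W)
  let ?v = "arens (bstar W) W g"
  define C where "C = bnorm W * D + (bnorm W * D + 1)"
  have C0: "C > 0" using mult_nonneg_nonneg[OF nn D0] unfolding C_def by linarith
  have est: "\<exists>r\<ge>0. cmod (?v - complex_of_real r) \<le> \<delta> * C" if \<delta>: "\<delta> > 0" "\<delta> \<le> 1" for \<delta>
  proof -
    obtain y where y: "\<And>z. cmod (W (\<lambda>b. g (cstar z * b)) - g (cstar z * y)) \<le> \<delta> * gnorm g z"
        "gnorm g y \<le> bnorm W * D + \<delta>"
      using riesz_right[OF g W \<delta>(1)] unfolding D_def by blast
    have "cmod (bstar W (Fmod W g) - bstar W (\<lambda>b. g (b * y))) \<le> bnorm (bstar W) * (\<delta> * D)"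
    proof (rule bidual_close[OF bstar_bidual(1)[OF W] Fmod_dual(1)[OF W gd] dual_rmult[OF gd]])
      show "cmod (Fmod W g x - g (x * y)) \<le> \<delta> * D * norm x" for x
        using order_trans[OF y(1)[of "cstar x"] mult_left_mono[OF gnorm_le[OF g, of "cstar x"], of \<delta>]] \<delta>(1)
        by (simp add: Fmod_def fmod_def cstar_cstar D_def mult_ac)
    qed (simp add: D0 less_imp_le \<delta>)
    also have "\<dots> \<le> bnorm W * (\<delta> * D)" using \<delta> D0 by (intro mult_right_mono bstar_bidual W) auto
    finally have e1: "cmod (?v - bstar W (\<lambda>b. g (b * y))) \<le> bnorm W * (\<delta> * D)"
      by (simp add: arens_def gd)
    have "dstar (\<lambda>b. g (b * y)) = (\<lambda>b. g (cstar y * b))"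
      by (rule ext) (metis (no_types, lifting) dstar_def complex_cnj_cnj fpositive_form_sym[OF g] cstar_cstar)
    then have b: "bstar W (\<lambda>b. g (b * y)) = cnj (W (\<lambda>b. g (cstar y * b)))"
      by (simp add: bstar_def dual_rmult[OF gd])
    have "cmod (cnj (W (\<lambda>b. g (cstar y * b))) - complex_of_real ((gnorm g y)\<^sup>2))
        = cmod (W (\<lambda>b. g (cstar y * b)) - g (cstar y * y))"
      unfolding fpositive_self[OF g] by (metis complex_cnj_complex_of_real complex_cnj_diff complex_mod_cnj)
    also have "\<dots> \<le> \<delta> * (bnorm W * D + 1)"
      using order_trans[OF y(1)[of y] mult_left_mono[OF order_trans[OF y(2)], of "bnorm W * D + 1" \<delta>]] \<delta> by simp
    finally have e2: "cmod (bstar W (\<lambda>b. g (b * y)) - complex_of_real ((gnorm g y)\<^sup>2)) \<le> \<delta> * (bnorm W * D + 1)"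
      using b by simp
    have "cmod (?v - complex_of_real ((gnorm g y)\<^sup>2)) \<le> bnorm W * (\<delta> * D) + \<delta> * (bnorm W * D + 1)"
      using norm_diff_triangle_le[OF e1 e2] .
    also have "\<dots> = \<delta> * C" by (simp add: C_def algebra_simps)
    finally show ?thesis by (intro exI[of _ "(gnorm g y)\<^sup>2"]) auto
  qed
  have small: "\<exists>r\<ge>0. cmod (?v - complex_of_real r) \<le> e" if e: "e > 0" for e
  proof -
    have "min 1 (e / C) * C \<le> e" using C0 by (simp add: min_def field_simps)
    then show ?thesis using est[of "min 1 (e / C)"] C0 e by (meson divide_pos_pos min.cobounded1 min_less_iff_conj order_trans zero_less_one)
  qed
  have "\<bar>Im ?v\<bar> \<le> 0 + e" if e: "e > 0" for e
  proof -
    obtain r where "cmod (?v - complex_of_real r) \<le> e" using small[OF e] by blast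
    then show ?thesis using abs_Im_le_cmod[of "?v - complex_of_real r"] by simp
  qed
  then have "\<bar>Im ?v\<bar> \<le> 0" by (rule field_le_epsilon)
  then show "Im ?v = 0" by simp
  have "0 \<le> Re ?v + e" if e: "e > 0" for e
  proof -
    obtain r where "r \<ge> 0" "cmod (?v - complex_of_real r) \<le> e" using small[OF e] by blast
    then show ?thesis using abs_Re_le_cmod[of "?v - complex_of_real r"] by simp
  qed
  then show "0 \<le> Re ?v" by (rule field_le_epsilon)
qed

subsection \<open>The unit\<close>

text \<open>The limit exists because on a positive functional it is the norm, and these span the
  dual. The value 0 outside \<open>dual\<close> is imposed by membership in
  \<open>bidual\<close>.\<close>

definition bunit :: "('a::cstar_algebra \<Rightarrow> complex) \<Rightarrow> complex" where
  "bunit f = (if f \<in> dual then Lim AU f else 0)"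

lemma bunit_tendsto:
  assumes "f \<in> dual" shows "(f \<longlongrightarrow> bunit f) AU"
proof -
  have "\<exists>l. (f \<longlongrightarrow> l) AU" using assms
  proof (induction rule: dual_induct)
    case (pos g) then show ?case using fpositive_tendsto_dnorm by blast
  next
    case (add f g) then show ?case using tendsto_add by blast
  next
    case (mult c f) then show ?case using tendsto_mult_left by blast
  qed
  then show ?thesis using assms tendsto_Lim[OF AU_neq_bot] by (fastforce simp: bunit_def)
qed

lemma bunit_unique: "f \<in> dual \<Longrightarrow> (f \<longlongrightarrow> l) AU \<Longrightarrow> bunit f = l"
  using tendsto_unique[OF AU_neq_bot bunit_tendsto] by blast

lemma bunit_bidual: "bunit \<in> bidual"
proof (rule bidualI[where K=1])
  fix f g :: "'a \<Rightarrow> complex" assume f: "f \<in> dual"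
  show "bunit (\<lambda>x. c * f x) = c * bunit f" for c
    by (intro bunit_unique dual_mult tendsto_mult tendsto_const bunit_tendsto f)
  show "bunit (\<lambda>x. f x + g x) = bunit f + bunit g" if g: "g \<in> dual"
    by (intro bunit_unique dual_plus tendsto_add bunit_tendsto f g)
  have "cmod (bunit f) \<le> dnorm f"
  proof (rule tendsto_upperbound[OF tendsto_norm[OF bunit_tendsto[OF f]] _ AU_neq_bot])
    show "eventually (\<lambda>e. cmod (f e) \<le> dnorm f) AU"
      using eventually_AU_basic
    proof eventually_elim
      case (elim e)
      then show ?case using dual_bound[OF f, of e] mult_left_le[of "norm e" "dnorm f"] dnorm_nonneg[OF f] by simp
    qed
  qed
  then show "cmod (bunit f) \<le> 1 * dnorm f" by simp
qed (simp add: bunit_def)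

lemma bunit_fpositive: "fpositive g \<Longrightarrow> bunit g = complex_of_real (dnorm g)"
  by (intro bunit_unique fpositive_dual fpositive_tendsto_dnorm)

lemma Fmod_bunit: assumes f: "f \<in> dual" shows "Fmod bunit f = f"
proof
  fix a
  have "((\<lambda>e. f (a * e)) \<longlongrightarrow> f a) AU" by (intro tendsto_dual[OF f] tendsto_AU_right)
  then show "Fmod bunit f a = f a"
    unfolding Fmod_def fmod_def by (intro bunit_unique dual_lmult f)
qed

lemma bstar_bunit: "bstar bunit = (bunit :: ('a::cstar_algebra \<Rightarrow> complex) \<Rightarrow> complex)"
proof (rule bidual_eqI)
  fix f :: "'a \<Rightarrow> complex" assume f: "f \<in> dual"
  have "((\<lambda>e. cnj (dstar f e)) \<longlongrightarrow> cnj (bunit (dstar f))) AU"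
    by (intro tendsto_cnj bunit_tendsto dual_dstar f)
  moreover have "eventually (\<lambda>e. cnj (dstar f e) = f e) AU"
    using eventually_AU_basic by eventually_elim (simp add: dstar_def)
  ultimately have "(f \<longlongrightarrow> cnj (bunit (dstar f))) AU" by (rule Lim_transform_eventually)
  then show "bstar bunit f = bunit f" using bunit_unique[OF f] by (simp add: bstar_def f)
qed (simp_all add: bstar_bidual bunit_bidual)

text \<open>The right unit law is a direct limit along approximate units; the left one follows by
  taking adjoints, as \<open>bunit\<close> is self-adjoint.\<close>

lemma arens_bunit:
  assumes F: "F \<in> bidual" shows "arens F bunit = F" "arens bunit F = F"
proof -
  have r: "arens F bunit = F" if F: "F \<in> bidual" for F
    by (rule bidual_eqI) (use F in \<open>simp_all add: arens_bidual bunit_bidual\<close>, simp add: arens_def Fmod_bunit)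
  show "arens F bunit = F" by (rule r[OF F])
  have "bstar (arens bunit F) = bstar F"
    using r[OF bstar_bidual(1)[OF F]] by (simp add: bstar_arens bunit_bidual F bstar_bunit)
  then show "arens bunit F = F"
    by (metis F arens_bidual(1) bstar_bstar bunit_bidual)
qed

lemma bone_eq_bunit: "bone = bunit"
  unfolding bone_def
proof (rule the_equality)
  show "bunit \<in> bidual \<and> (\<forall>X\<in>bidual. arens bunit X = X \<and> arens X bunit = X)"
    using arens_bunit bunit_bidual by blast
  fix E :: "('a \<Rightarrow> complex) \<Rightarrow> complex"
  assume "E \<in> bidual \<and> (\<forall>X\<in>bidual. arens E X = X \<and> arens X E = X)"
  then show "E = bunit" using arens_bunit bunit_bidual by metis
qed

section \<open>The bidual as a ring with involution\<close>

text \<open>As a type, the bidual becomes a \<open>ring\<close>, which makes associativity and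
  distributivity of the Arens product available to simplification. Its norm remains a plain function
  \<open>bn\<close>, used through inequalities.\<close>

typedef (overloaded) 'a bid = "bidual :: (('a::cstar_algebra \<Rightarrow> complex) \<Rightarrow> complex) set"
  morphisms ev Bid
  using bunit_bidual by blast

lemma ev_bidual: "ev F \<in> bidual" by (rule ev)

lemma bidual_combination:
  assumes F: "F \<in> bidual" and G: "G \<in> bidual"
  shows "(\<lambda>f. F f + c * G f) \<in> bidual"
proof (rule bidualI[where K="bnorm F + cmod c * bnorm G"])
  fix f :: "'a \<Rightarrow> complex" assume f: "f \<in> dual"
  have "cmod (F f + c * G f) \<le> cmod (F f) + cmod c * cmod (G f)"
    by (metis norm_mult norm_triangle_ineq)
  also have "\<dots> \<le> bnorm F * dnorm f + cmod c * (bnorm G * dnorm f)"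
    by (intro add_mono mult_left_mono bidual_bound F G f) simp
  finally show "cmod (F f + c * G f) \<le> (bnorm F + cmod c * bnorm G) * dnorm f" by (simp add: algebra_simps)
qed (auto simp: bidual_add[OF F] bidual_add[OF G] bidual_mult[OF F] bidual_mult[OF G] algebra_simps
    bidual_outside[OF F] bidual_outside[OF G])

instantiation bid :: (cstar_algebra) "{zero, plus, minus, uminus, times}"
begin

definition zero_bid :: "'a bid" where "0 = Bid (\<lambda>_. 0)"
definition plus_bid :: "'a bid \<Rightarrow> 'a bid \<Rightarrow> 'a bid" where "F + G = Bid (\<lambda>f. ev F f + ev G f)"
definition minus_bid :: "'a bid \<Rightarrow> 'a bid \<Rightarrow> 'a bid" where "F - G = Bid (\<lambda>f. ev F f - ev G f)"
definition uminus_bid :: "'a bid \<Rightarrow> 'a bid" where "- F = Bid (\<lambda>f. - ev F f)"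
definition times_bid :: "'a bid \<Rightarrow> 'a bid \<Rightarrow> 'a bid" where "F * G = Bid (arens (ev F) (ev G))"

instance ..

end

lemma ev_zero: "ev (0::'a::cstar_algebra bid) = (\<lambda>_. 0)"
proof -
  have "(\<lambda>_. 0) \<in> (bidual :: (('a \<Rightarrow> complex) \<Rightarrow> complex) set)" by (rule bidualI[where K=0]) auto
  then show ?thesis by (simp add: zero_bid_def Bid_inverse)
qed

lemma ev_plus: "ev (F + G) = (\<lambda>f. ev F f + ev G f)"
  using bidual_combination[OF ev_bidual ev_bidual, of F 1 G] by (simp add: plus_bid_def Bid_inverse)

lemma ev_minus: "ev (F - G) = (\<lambda>f. ev F f - ev G f)"
  using bidual_combination[OF ev_bidual ev_bidual, of F "-1" G] by (simp add: minus_bid_def Bid_inverse)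

lemma ev_uminus: "ev (- F) = (\<lambda>f. - ev F f)"
  using bidual_combination[OF ev_bidual ev_bidual, of 0 "-1" F] by (simp add: uminus_bid_def Bid_inverse ev_zero)

lemma ev_times: "ev (F * G) = arens (ev F) (ev G)"
  by (simp add: times_bid_def Bid_inverse arens_bidual ev_bidual)

lemma bid_eqI: "(\<And>f. f \<in> dual \<Longrightarrow> ev F f = ev G f) \<Longrightarrow> F = G"
  using bidual_eqI[OF ev_bidual ev_bidual] ev_inject by blast

instance bid :: (cstar_algebra) ring
proof
  fix F G H :: "'a bid"
  show "F + G + H = F + (G + H)" "F + G = G + F" "0 + F = F" "- F + F = 0" "F - G = F + - G"
    by (rule bid_eqI; simp add: ev_plus ev_zero ev_uminus ev_minus)+
  show "F * G * H = F * (G * H)"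
    by (simp add: ev_inject[symmetric] ev_times arens_assoc ev_bidual)
  show "(F + G) * H = F * H + G * H"
    by (rule bid_eqI) (simp add: ev_times ev_plus arens_def)
  show "F * (G + H) = F * G + F * H"
  proof (rule bid_eqI)
    fix f :: "'a \<Rightarrow> complex" assume f: "f \<in> dual"
    have "Fmod (ev (G + H)) f = (\<lambda>a. Fmod (ev G) f a + Fmod (ev H) f a)"
      by (simp add: Fmod_def ev_plus)
    then show "ev (F * (G + H)) f = ev (F * G + F * H) f"
      using f by (simp add: ev_times ev_plus[of "F * G"] arens_def bidual_add ev_bidual Fmod_dual)
  qed
qed

definition bs :: "'a::cstar_algebra bid \<Rightarrow> 'a bid" where "bs F = Bid (bstar (ev F))"
definition io :: "'a::cstar_algebra \<Rightarrow> 'a bid" where "io a = Bid (iota a)"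
definition un :: "'a::cstar_algebra bid" where "un = Bid bunit"
definition bn :: "'a::cstar_algebra bid \<Rightarrow> real" where "bn F = bnorm (ev F)"

lemma ev_bs: "ev (bs F) = bstar (ev F)" by (simp add: bs_def Bid_inverse bstar_bidual ev_bidual)
lemma ev_io: "ev (io a) = iota a" by (simp add: io_def Bid_inverse iota_bidual)
lemma ev_un: "ev un = bunit" by (simp add: un_def Bid_inverse bunit_bidual)

lemma bs_mult: "bs (F * G) = bs G * bs F"
  by (simp add: ev_inject[symmetric] ev_bs ev_times bstar_arens ev_bidual)
lemma bs_minus: "bs (F - G) = bs F - bs G"
  by (rule bid_eqI) (simp add: ev_bs ev_minus bstar_def)
lemma bs_io: "bs (io a) = io (cstar a)"
  by (simp add: ev_inject[symmetric] ev_bs ev_io bstar_iota)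
lemma un_mult [simp]: "un * F = F" "F * un = F"
  by (simp_all add: ev_inject[symmetric] ev_times ev_un arens_bunit ev_bidual)
lemma io_mult: "io (a * b) = io a * io b"
  by (simp add: ev_inject[symmetric] ev_times ev_io arens_iota_iota)
lemma ev_io_apply: "f \<in> dual \<Longrightarrow> ev (io a) f = f a"
  by (simp add: ev_io iota_def)

lemma bn_nonneg: "bn F \<ge> 0" by (simp add: bn_def bnorm_nonneg ev_bidual)
lemma bn_mult: "bn (F * G) \<le> bn F * bn G" by (simp add: bn_def ev_times arens_bidual ev_bidual)
lemma bn_bs: "bn (bs F) \<le> bn F" by (simp add: bn_def ev_bs bstar_bidual ev_bidual)
lemma ev_bound: "f \<in> dual \<Longrightarrow> cmod (ev F f) \<le> bn F * dnorm f" by (simp add: bn_def bidual_bound ev_bidual)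

lemma bn_add: "bn (F + G) \<le> bn F + bn G"
  unfolding bn_def[of "F + G"]
proof (rule bnorm_leI)
  fix f :: "'a \<Rightarrow> complex" assume f: "f \<in> dual"
  show "cmod (ev (F + G) f) \<le> (bn F + bn G) * dnorm f"
    using norm_triangle_ineq[of "ev F f" "ev G f"] ev_bound[OF f, of F] ev_bound[OF f, of G]
    by (simp add: ev_plus distrib_right)
qed (simp add: bn_nonneg)

lemma bn_minus: "bn (F - G) \<le> bn F + bn G"
proof -
  have "bn (- G) \<le> bn G" unfolding bn_def[of "- G"]
    by (rule bnorm_leI) (simp_all add: ev_uminus ev_bound bn_nonneg)
  then show ?thesis using bn_add[of F "- G"] by simp
qed

lemma ev_positive: "fpositive g \<Longrightarrow> Im (ev (bs W * W) g) = 0 \<and> Re (ev (bs W * W) g) \<ge> 0"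
  using bidual_positive[OF _ ev_bidual] by (auto simp: ev_times ev_bs)

text \<open>The functional sending \<open>x\<close> to the value of \<open>bs W * io x * W\<close>
  at \<open>g\<close>. Built from the two module maps, it is bounded by construction.\<close>

definition cfun :: "'a::cstar_algebra bid \<Rightarrow> ('a \<Rightarrow> complex) \<Rightarrow> 'a \<Rightarrow> complex" where
  "cfun W g = Fmod2 (ev (bs W)) (Fmod (ev W) g)"

lemma cfun_dual: "g \<in> dual \<Longrightarrow> cfun W g \<in> dual"
  unfolding cfun_def by (intro Fmod2_dual Fmod_dual ev_bidual)

lemma cfun_apply: assumes g: "g \<in> dual" shows "cfun W g x = ev (bs W * io x * W) g"
proof -
  have "Fmod (iota x) (Fmod (ev W) g) = (\<lambda>b. Fmod (ev W) g (b * x))"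
    unfolding Fmod_def[of "iota x"] by (simp add: iota_def fmod_def dual_lmult Fmod_dual ev_bidual g)
  then have "Fmod (arens (iota x) (ev W)) g = (\<lambda>b. Fmod (ev W) g (b * x))"
    by (simp add: Fmod_arens iota_bidual ev_bidual g)
  then have "ev (bs W * (io x * W)) g = cfun W g x"
    by (simp add: ev_times ev_io arens_def[of "ev (bs W)"] g cfun_def Fmod2_def)
  then show ?thesis by (simp add: mult.assoc)
qed

text \<open>The unit disappears from the first Arens product, while \<open>cfun\<close> is formed
  with the second; regularity identifies the two.\<close>

lemma ev_un_cfun: assumes g: "g \<in> dual" shows "ev un (cfun W g) = ev (bs W * W) g"
proof -
  have "ev (bs W) (Fmod bunit (Fmod (ev W) g)) = bunit (cfun W g)"
    unfolding cfun_def by (intro arens_regular Fmod_dual ev_bidual g bunit_bidual)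
  then show ?thesis by (simp add: ev_un ev_times arens_def g Fmod_bunit Fmod_dual ev_bidual)
qed

lemma fpositive_cfun: assumes g: "fpositive g" shows "fpositive (cfun W g)"
  unfolding fpositive_def
proof (intro conjI allI)
  note gd = fpositive_dual[OF g]
  show "cfun W g \<in> dual" by (rule cfun_dual[OF gd])
  fix a
  have "cfun W g (cstar a * a) = ev (bs (io a * W) * (io a * W)) g"
    by (simp add: cfun_apply[OF gd] bs_mult bs_io io_mult mult.assoc)
  then show "Im (cfun W g (cstar a * a)) = 0" "0 \<le> Re (cfun W g (cstar a * a))"
    using ev_positive[OF g, of "io a * W"] by simp_all
qed

text \<open>A positive functional takes its norm as value at the unit, so bounds on
  \<open>bs W * W\<close> become bounds on the norm of a functional on \<open>A\<close>.\<close>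

lemma dnorm_cfun: assumes g: "fpositive g" shows "dnorm (cfun W g) = Re (ev (bs W * W) g)"
  using ev_un_cfun[OF fpositive_dual[OF g], of W] bunit_fpositive[OF fpositive_cfun[OF g], of W]
  by (simp add: ev_un complex_eq_iff)

lemma cfun_io: assumes g: "g \<in> dual" shows "cfun (io x) g = (\<lambda>y. g (cstar x * y * x))"
  by (rule ext) (simp add: cfun_apply[OF g] bs_io io_mult[symmetric] ev_io_apply g)

section \<open>Proof of the theorem\<close>

definition supports :: "'a::cstar_algebra set \<Rightarrow> 'a bid \<Rightarrow> bool" where
  "supports B Q \<longleftrightarrow> bs Q = Q \<and> Q * Q = Q \<and>
     (\<forall>b\<in>B. Q * io b = io b \<and> io b * Q = io b) \<and>
     (\<forall>K \<subseteq> dual. finite K \<longrightarrow> (\<forall>e>0. \<exists>b\<in>B. \<forall>f\<in>K. cmod (ev Q f - f b) < e))"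

text \<open>\<open>Q\<close> lies in the weak* closure of \<open>B\<close>; the approximation is
  applied to the single functional \<open>f\<close> with error \<open>cmod (ev Q f)\<close>.\<close>

lemma supports_vanish:
  assumes "supports B Q" "f \<in> dual" "\<And>b. b \<in> B \<Longrightarrow> f b = 0" shows "ev Q f = 0"
proof (rule ccontr)
  assume "ev Q f \<noteq> 0"
  then obtain b where "b \<in> B" "cmod (ev Q f - f b) < cmod (ev Q f)"
    using assms(1,2) unfolding supports_def
    by (meson empty_subsetI finite.emptyI finite.insertI insertI1 insert_subset zero_less_norm_iff)
  then show False using assms(3) by simp
qed

section \<open>Elements dominated by a pair of subalgebras\<close>

lemma gnorm_add_power2:
  assumes g: "fpositive g"
  shows "(gnorm g (u + v))\<^sup>2 \<le> 2 * (gnorm g u)\<^sup>2 + 2 * (gnorm g v)\<^sup>2"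
proof -
  \<comment> \<open>The parallelogram law; the factor \<open>cscale 1\<close> brings the sum into
    the shape of the expansion lemma.\<close>
  have "(gnorm g (u + cscale 1 v))\<^sup>2 + (gnorm g (u + cscale (-1) v))\<^sup>2 = 2 * (gnorm g u)\<^sup>2 + 2 * (gnorm g v)\<^sup>2"
    unfolding gnorm_power2[OF g] fpositive_form_expand[OF g] by simp
  then show ?thesis using zero_le_power2[of "gnorm g (u + cscale (-1) v)"] unfolding cscale_one by linarith
qed

lemma gnorm_cscale_power2:
  assumes g: "fpositive g" shows "(gnorm g (cscale t u))\<^sup>2 = (cmod t)\<^sup>2 * (gnorm g u)\<^sup>2"
proof -
  have "g (cstar (cscale t u) * cscale t u) = complex_of_real ((cmod t)\<^sup>2) * g (cstar u * u)"
    unfolding complex_norm_square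
    by (simp add: cstar_cscale cscale_eq_mult_left cscale_eq_mult_right cscale_mult
        dual_cscale[OF fpositive_dual[OF g]] mult.commute del: of_real_power)
  then show ?thesis by (simp add: gnorm_power2[OF g] del: of_real_power)
qed

definition star_subalgebra :: "'a::cstar_algebra set \<Rightarrow> bool" where
  "star_subalgebra B \<longleftrightarrow> 0 \<in> B \<and> (\<forall>x\<in>B. \<forall>y\<in>B. x + y \<in> B \<and> x * y \<in> B) \<and>
     (\<forall>c. \<forall>x\<in>B. cscale c x \<in> B) \<and> (\<forall>x\<in>B. cstar x \<in> B)"

lemma star_subalgebra_scaleR: "star_subalgebra B \<Longrightarrow> x \<in> B \<Longrightarrow> r *\<^sub>R x \<in> B"
  unfolding star_subalgebra_def by (metis cscale_of_real)

text \<open>For star subalgebras this is a linear subspace containing the left ideals generated by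
  \<open>B\<close> and by \<open>C\<close>, so density of their sum passes to it. Unlike a
  decomposition of \<open>u\<close> it has no mixed terms, and the part from \<open>C\<close> is a
  single element that can be annihilated.\<close>

definition dominated :: "'a::cstar_algebra set \<Rightarrow> 'a set \<Rightarrow> 'a set" where
  "dominated B C = {u. \<exists>b\<in>B. \<exists>c\<in>C. \<forall>g. fpositive g \<longrightarrow> (gnorm g u)\<^sup>2 \<le> Re (g b) + Re (g c)}"

lemma dominatedI:
  assumes "b \<in> B" "c \<in> C" "\<And>g. fpositive g \<Longrightarrow> (gnorm g u)\<^sup>2 \<le> Re (g b) + Re (g c)"
  shows "u \<in> dominated B C"
  using assms unfolding dominated_def by blast

lemma dominated_commute: "dominated B C = dominated C B"
proof -
  have "dominated B C \<subseteq> dominated C B" for B C :: "'a set"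
    unfolding dominated_def by (force simp: add.commute)
  then show ?thesis by blast
qed

lemma dominated_add:
  assumes B: "star_subalgebra B" and C: "star_subalgebra C"
    and "u \<in> dominated B C" "v \<in> dominated B C"
  shows "u + v \<in> dominated B C"
proof -
  obtain b c where bc: "b \<in> B" "c \<in> C" "\<And>g. fpositive g \<Longrightarrow> (gnorm g u)\<^sup>2 \<le> Re (g b) + Re (g c)"
    using assms(3) unfolding dominated_def by blast
  obtain b' c' where bc': "b' \<in> B" "c' \<in> C" "\<And>g. fpositive g \<Longrightarrow> (gnorm g v)\<^sup>2 \<le> Re (g b') + Re (g c')"
    using assms(4) unfolding dominated_def by blast
  show ?thesis
  proof (rule dominatedI)
    show "2 *\<^sub>R (b + b') \<in> B" "2 *\<^sub>R (c + c') \<in> C"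
      using B C bc bc' by (auto intro!: star_subalgebra_scaleR simp: star_subalgebra_def)
    fix g :: "'a \<Rightarrow> complex" assume g: "fpositive g"
    show "(gnorm g (u + v))\<^sup>2 \<le> Re (g (2 *\<^sub>R (b + b'))) + Re (g (2 *\<^sub>R (c + c')))"
      using gnorm_add_power2[OF g, of u v] bc(3)[OF g] bc'(3)[OF g] fpositive_dual[OF g]
      by (simp add: dual_scaleR dual_add del: scaleR_add_right)
  qed
qed

lemma dominated_cscale:
  assumes B: "star_subalgebra B" and C: "star_subalgebra C" and "u \<in> dominated B C"
  shows "cscale t u \<in> dominated B C"
proof -
  obtain b c where bc: "b \<in> B" "c \<in> C" "\<And>g. fpositive g \<Longrightarrow> (gnorm g u)\<^sup>2 \<le> Re (g b) + Re (g c)"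
    using assms(3) unfolding dominated_def by blast
  show ?thesis
  proof (rule dominatedI)
    show "(cmod t)\<^sup>2 *\<^sub>R b \<in> B" "(cmod t)\<^sup>2 *\<^sub>R c \<in> C"
      using B C bc by (auto intro!: star_subalgebra_scaleR)
    fix g :: "'a \<Rightarrow> complex" assume g: "fpositive g"
    have "(cmod t)\<^sup>2 * (gnorm g u)\<^sup>2 \<le> (cmod t)\<^sup>2 * (Re (g b) + Re (g c))"
      by (intro mult_left_mono bc(3) g) simp
    then show "(gnorm g (cscale t u))\<^sup>2 \<le> Re (g ((cmod t)\<^sup>2 *\<^sub>R b)) + Re (g ((cmod t)\<^sup>2 *\<^sub>R c))"
      using fpositive_dual[OF g] by (simp add: gnorm_cscale_power2[OF g] dual_scaleR distrib_left del: of_real_power)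
  qed
qed

lemma dominated_mult:
  assumes B: "star_subalgebra B" and C: "star_subalgebra C" and b: "b \<in> B"
  shows "x * b \<in> dominated B C"
proof (rule dominatedI)
  show "(norm x)\<^sup>2 *\<^sub>R (cstar b * b) \<in> B" "0 \<in> C"
    using B C b by (auto intro!: star_subalgebra_scaleR simp: star_subalgebra_def)
  fix g :: "'a \<Rightarrow> complex" assume g: "fpositive g"
  have "(gnorm g (x * b))\<^sup>2 \<le> (norm x * gnorm g b)\<^sup>2"
    by (intro power_mono gnorm_mult_le gnorm_nonneg g)
  then show "(gnorm g (x * b))\<^sup>2 \<le> Re (g ((norm x)\<^sup>2 *\<^sub>R (cstar b * b))) + Re (g 0)"
    using fpositive_dual[OF g]
    by (simp add: dual_scaleR dual_zero power_mult_distrib gnorm_power2[OF g] del: of_real_power)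
qed

lemma dominated_dense:
  fixes B C :: "'a::cstar_algebra set"
  assumes B: "star_subalgebra B" "supports B Q" and C: "star_subalgebra C" "supports C (un - P)"
    and PQ: "bn (P - Q) < 1" and \<delta>: "\<delta> > 0"
  obtains u where "u \<in> dominated B C" "norm (a - u) < \<delta>"
proof (rule ccontr)
  assume "\<not> thesis"
  then have far: "\<delta> \<le> norm (a - u)" if "u \<in> dominated B C" for u using that \<open>\<And>u. _ \<Longrightarrow> _ \<Longrightarrow> thesis\<close> by force
  have 0: "0 \<in> dominated B C"
  proof -
    have "0 \<in> B" using B(1) by (simp add: star_subalgebra_def)
    from dominated_mult[OF B(1) C(1) this, of 0] show ?thesis by simp
  qed
  obtain \<phi> where \<phi>: "\<phi> \<in> dual" "\<And>d. d \<in> dominated B C \<Longrightarrow> \<phi> d = 0" "\<phi> a \<noteq> 0"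
    using dual_separates_subspace[OF 0 dominated_add[OF B(1) C(1)] dominated_cscale[OF B(1) C(1)] \<delta> far]
    by blast
  have m: "(\<lambda>b. \<phi> (x * b)) \<in> dual" for x by (rule dual_lmult[OF \<phi>(1)])
  \<comment> \<open>\<open>\<phi>\<close> vanishes on \<open>x B\<close> and on \<open>x C\<close>,
    so its translate by \<open>x\<close> is killed by \<open>Q\<close> and by \<open>un - P\<close>;
    what remains of \<open>P - Q\<close> is the unit.\<close>
  have "Fmod (ev (P - Q)) \<phi> x = \<phi> x" for x
  proof -
    have "ev Q (\<lambda>b. \<phi> (x * b)) = 0"
      by (rule supports_vanish[OF B(2) m]) (intro \<phi>(2) dominated_mult B C)
    moreover have "ev (un - P) (\<lambda>b. \<phi> (x * b)) = 0"
      by (rule supports_vanish[OF C(2) m])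
         (rule \<phi>(2), subst dominated_commute, intro dominated_mult B C)
    moreover have "ev un (\<lambda>b. \<phi> (x * b)) = \<phi> x"
      using fun_cong[OF Fmod_bunit[OF \<phi>(1)], of x] by (simp add: ev_un Fmod_def fmod_def)
    ultimately show ?thesis by (simp add: Fmod_def fmod_def ev_minus)
  qed
  then have "Fmod (ev (P - Q)) \<phi> = \<phi>" by blast
  then have "dnorm \<phi> \<le> bn (P - Q) * dnorm \<phi>" using Fmod_dual(2)[OF ev_bidual \<phi>(1), of "P - Q"] by (simp add: bn_def)
  then have "(1 - bn (P - Q)) * dnorm \<phi> \<le> 0" by (simp add: algebra_simps)
  then have "dnorm \<phi> \<le> 0" using PQ by (simp add: mult_le_0_iff)
  then have "cmod (\<phi> a) \<le> 0"
    using dual_bound[OF \<phi>(1), of a] dnorm_nonneg[OF \<phi>(1)] by simp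
  then show False using \<phi>(3) by simp
qed

text \<open>The functional \<open>h = cfun (P * V) g\<close> kills \<open>c\<close>, and its norm
  \<open>D\<close> is at most \<open>Re (h a)\<close>. Cauchy-Schwarz at the unit gives
  \<open>D \<le> (gnorm h a)^2\<close>, and replacing \<open>a\<close> by \<open>u\<close> leads to
  \<open>D \<le> 4 * Re (h b)\<close>. The form \<open>Q * P * V\<close> is chosen because it can be
  made to approach \<open>Q\<close>, and because \<open>b\<close> is unchanged under compression by
  \<open>Q\<close>.\<close>

lemma compression_lower_bound:
  fixes P Q :: "'a::cstar_algebra bid"
  assumes B: "star_subalgebra B" "supports B Q" and C: "star_subalgebra C" "supports C (un - P)"
    and P: "bs P = P" "P * P = P" and PQ: "bn (P - Q) < 1"
    and Y: "P * io a * P - P = bs Y * Y"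
  obtains b where "b \<in> B" "\<And>g V. fpositive g \<Longrightarrow>
    Re (ev (bs (Q * P * V) * (Q * P * V)) g) \<le> 4 * Re (ev (bs (Q * P * V) * io b * (Q * P * V)) g)"
proof -
  \<comment> \<open>The error enters as \<open>2 * (1/2)^2 * D = D/2\<close> and is absorbed on the
    left; the remaining \<open>D/2 \<le> 2 * (gnorm h u)^2\<close> is the origin of the factor
    4.\<close>
  obtain u where u: "u \<in> dominated B C" "norm (a - u) < 1/2"
    using dominated_dense[OF B C PQ, of "1/2" a] by auto
  then obtain b c where bc: "b \<in> B" "c \<in> C" "\<And>g. fpositive g \<Longrightarrow> (gnorm g u)\<^sup>2 \<le> Re (g b) + Re (g c)"
    unfolding dominated_def by blast
  have Q: "bs Q = Q" "Q * Q = Q" "Q * io b = io b" "io b * Q = io b" using B(2) bc by (auto simp: supports_def)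
  have "io c * (un - P) = io c" using C(2) bc by (auto simp: supports_def)
  then have cP: "io c * P = 0" by (simp add: right_diff_distrib)
  have "Re (ev (bs (Q * P * V) * (Q * P * V)) g) \<le> 4 * Re (ev (bs (Q * P * V) * io b * (Q * P * V)) g)"
    if g: "fpositive g" for g V
  proof -
    note gd = fpositive_dual[OF g]
    define W where "W = P * V"
    have PW: "P * W = W" by (simp add: W_def mult.assoc[symmetric] P)
    have WP: "bs W * P = bs W" using arg_cong[OF PW, of bs] by (simp add: bs_mult P)
    define h where "h = cfun W g"
    have h: "fpositive h" unfolding h_def by (rule fpositive_cfun[OF g])
    define D where "D = dnorm h"
    have D: "D = Re (ev (bs W * W) g)" by (simp add: D_def h_def dnorm_cfun[OF g])
    have D0: "D \<ge> 0" unfolding D_def by (rule dnorm_nonneg[OF fpositive_dual[OF h]])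
    have hc: "h c = 0"
    proof -
      have "bs W * io c * W = bs W * (io c * P) * V" by (simp add: W_def mult.assoc)
      then show ?thesis by (simp add: h_def cfun_apply[OF gd] cP ev_zero)
    qed
    have "bs W * io a * W = bs W * (P * io a * P) * W"
      by (metis PW WP mult.assoc)
    also have "P * io a * P = P + bs Y * Y" using Y by (metis add.commute diff_add_cancel)
    also have "bs W * (P + bs Y * Y) * W = bs W * W + bs (Y * W) * (Y * W)"
      by (simp add: distrib_left distrib_right WP bs_mult mult.assoc)
    finally have "D \<le> Re (h a)"
      using ev_positive[OF g, of "Y * W"] by (simp add: D h_def cfun_apply[OF gd] ev_plus)
    also have "\<dots> \<le> sqrt D * gnorm h a"
      using cauchy_schwarz_unit[OF h, of a] complex_Re_le_cmod[of "h a"] by (simp add: D_def)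
    finally have "sqrt D * sqrt D \<le> sqrt D * gnorm h a" using D0 by simp
    then have "D = 0 \<or> sqrt D \<le> gnorm h a"
      using D0 by (simp only: mult_le_cancel_left) auto
    then have "sqrt D \<le> gnorm h a" using gnorm_nonneg[OF h, of a] by auto
    then have "D \<le> (gnorm h a)\<^sup>2" using D0 power_mono[of "sqrt D" "gnorm h a" 2] by simp
    also have "\<dots> \<le> 2 * (gnorm h u)\<^sup>2 + 2 * (gnorm h (a - u))\<^sup>2"
      using gnorm_add_power2[OF h, of u "a - u"] by simp
    also have "(gnorm h (a - u))\<^sup>2 \<le> (sqrt D * (1/2))\<^sup>2"
      using order_trans[OF gnorm_le[OF h, of "a - u"] mult_left_mono[OF less_imp_le[OF u(2)]]] D0
      by (intro power_mono gnorm_nonneg h) (simp add: D_def)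
    finally have "D \<le> 4 * (gnorm h u)\<^sup>2" using D0 by (simp add: power_mult_distrib power_divide)
    then have "D \<le> 4 * Re (h b)" using bc(3)[OF h] hc by simp
    moreover have "bs W * io b * W = bs (Q * P * V) * io b * (Q * P * V)"
    proof -
      have "bs (Q * P * V) * io b * (Q * P * V) = bs W * (Q * io b * Q) * W"
        by (simp add: W_def bs_mult Q(1) mult.assoc)
      then show ?thesis by (simp add: Q)
    qed
    moreover have "Re (ev (bs (Q * P * V) * (Q * P * V)) g) \<le> D"
    proof -
      \<comment> \<open>Because \<open>Q\<close> is a projection, the loss in passing from
        \<open>W\<close> to \<open>Q * W\<close> is itself of the form \<open>bs Z * Z\<close>,
        hence nonnegative at \<open>g\<close>.\<close>
      have "bs (W - Q * W) * (W - Q * W) = bs W * W - bs (Q * W) * (Q * W)"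
      proof -
        have "bs W * Q * (Q * W) = bs W * (Q * Q) * W" by (simp add: mult.assoc)
        then show ?thesis by (simp add: bs_minus bs_mult Q algebra_simps)
      qed
      then show ?thesis
        using ev_positive[OF g, of "W - Q * W"] by (simp add: D ev_minus W_def mult.assoc)
    qed
    ultimately show ?thesis by (simp add: h_def cfun_apply[OF gd])
  qed
  then show thesis using that bc(1) by blast
qed

text \<open>Neumann iteration for the inverse of \<open>Q P Q\<close> in the corner of \<open>Q\<close>; the contraction factor is
  that of \<open>(P - Q)\<^sup>2\<close>, which commutes with \<open>Q\<close>.\<close>

lemma corner_inverse_approx:
  fixes P Q :: "'a::cstar_algebra bid"
  assumes P: "P * P = P" and Q: "Q * Q = Q"
  shows "\<exists>V. Q * (Q - Q * P * V) = Q - Q * P * V \<and> bn (Q - Q * P * V) \<le> (bn (P - Q) * bn (P - Q)) ^ n * (bn Q + bn (Q * P * Q))"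
proof (induction n)
  case 0
  have "Q * (Q - Q * P * Q) = Q - Q * P * Q" by (simp add: right_diff_distrib mult.assoc[symmetric] Q)
  then show ?case using bn_minus[of Q "Q * P * Q"] by auto
next
  case (Suc n)
  define k where "k = bn (P - Q) * bn (P - Q)"
  obtain V where V: "Q * (Q - Q * P * V) = Q - Q * P * V"
      "bn (Q - Q * P * V) \<le> k ^ n * (bn Q + bn (Q * P * Q))" using Suc by (auto simp: k_def)
  define R where "R = Q - Q * P * V"
  have QR: "Q * R = R" using V by (simp add: R_def)
  \<comment> \<open>Adding the residual \<open>R\<close> to \<open>V\<close> leaves the residual
    \<open>R - Q * P * R\<close>; by \<open>Q * R = R\<close> this is the square of
    \<open>P - Q\<close> applied to \<open>R\<close>.\<close>
  have e: "Q - Q * P * (V + R) = R - Q * P * R" by (simp add: R_def distrib_left)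
  have "(P - Q) * ((P - Q) * R) = P * (P * R) - P * (Q * R) - Q * (P * R) + Q * (Q * R)"
    by (simp add: algebra_simps)
  also have "\<dots> = R - Q * P * R" by (simp add: QR mult.assoc[symmetric] P)
  finally have "R - Q * P * R = (P - Q) * ((P - Q) * R)" by simp
  then have "bn (R - Q * P * R) \<le> bn (P - Q) * (bn (P - Q) * bn R)"
    by (metis (no_types, lifting) bn_mult bn_nonneg mult_left_mono order_trans)
  also have "\<dots> = k * bn R" by (simp add: k_def)
  also have "\<dots> \<le> k * (k ^ n * (bn Q + bn (Q * P * Q)))"
    using V(2) by (intro mult_left_mono) (auto simp: R_def k_def bn_nonneg)
  finally have "bn (R - Q * P * R) \<le> k ^ Suc n * (bn Q + bn (Q * P * Q))" by (simp add: mult.assoc)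
  moreover have "Q * (R - Q * P * R) = R - Q * P * R"
    by (simp add: right_diff_distrib QR mult.assoc[symmetric] Q)
  ultimately show ?case by (intro exI[of _ "V + R"]) (simp add: e k_def)
qed

text \<open>The difference expands into three terms, each with a factor \<open>R n\<close> or its
  adjoint. The cases needed are \<open>X = un\<close> and \<open>X = io b\<close>.\<close>

lemma ev_conj_tendsto:
  assumes g: "g \<in> dual" and R: "(\<lambda>n. bn (R n)) \<longlonglongrightarrow> 0"
  shows "(\<lambda>n. ev (bs (Q - R n) * X * (Q - R n)) g) \<longlonglongrightarrow> ev (bs Q * X * Q) g"
proof -
  have bn3: "bn (F * G * H) \<le> bn F * bn G * bn H" for F G H :: "'a bid"
    by (rule order_trans[OF bn_mult mult_right_mono[OF bn_mult bn_nonneg]])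
  have est: "cmod (ev (bs (Q - R n) * X * (Q - R n)) g - ev (bs Q * X * Q) g)
      \<le> (bn Q * bn X * bn (R n) + bn (R n) * bn X * bn Q + bn (R n) * bn X * bn (R n)) * dnorm g" for n
  proof -
    let ?R = "R n"
    have eq: "bs (Q - ?R) * X * (Q - ?R) - bs Q * X * Q
        = bs ?R * X * ?R - bs Q * X * ?R - bs ?R * X * Q"
      by (simp add: bs_minus algebra_simps)
    have "bn (bs F * X * G) \<le> bn F * bn X * bn G" for F G
      by (rule order_trans[OF bn3]) (intro mult_right_mono bn_bs bn_nonneg)
    then have "bn (bs ?R * X * ?R - bs Q * X * ?R - bs ?R * X * Q)
        \<le> bn Q * bn X * bn ?R + bn ?R * bn X * bn Q + bn ?R * bn X * bn ?R"
      using bn_minus[of "bs ?R * X * ?R - bs Q * X * ?R" "bs ?R * X * Q"]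
        bn_minus[of "bs ?R * X * ?R" "bs Q * X * ?R"] by (smt (verit))
    then have "cmod (ev (bs (Q - ?R) * X * (Q - ?R) - bs Q * X * Q) g)
        \<le> (bn Q * bn X * bn ?R + bn ?R * bn X * bn Q + bn ?R * bn X * bn ?R) * dnorm g"
      unfolding eq by (intro order_trans[OF ev_bound[OF g]] mult_right_mono dnorm_nonneg g)
    then show ?thesis by (simp add: ev_minus)
  qed
  have "(\<lambda>n. (bn Q * bn X * bn (R n) + bn (R n) * bn X * bn Q + bn (R n) * bn X * bn (R n)) * dnorm g)
      \<longlonglongrightarrow> (bn Q * bn X * 0 + 0 * bn X * bn Q + 0 * bn X * 0) * dnorm g"
    by (intro tendsto_intros R)
  then have lim: "(\<lambda>n. (bn Q * bn X * bn (R n) + bn (R n) * bn X * bn Q + bn (R n) * bn X * bn (R n)) * dnorm g) \<longlonglongrightarrow> 0"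
    by simp
  have "(\<lambda>n. ev (bs (Q - R n) * X * (Q - R n)) g - ev (bs Q * X * Q) g) \<longlonglongrightarrow> 0"
    by (rule tendsto_0_le[OF lim, where K=1]) (auto intro!: always_eventually order_trans[OF est])
  then show ?thesis by (rule LIM_zero_cancel)
qed

text \<open>With \<open>Q * P * V n = Q - R n\<close> and \<open>R n\<close> tending to 0, the
  compressed inequality passes to the limit; it then says \<open>Q \<le> 4 b\<close> on positive
  functionals, and \<open>P\<close> has disappeared.\<close>

lemma support_dominated:
  fixes P Q :: "'a::cstar_algebra bid"
  assumes B: "star_subalgebra B" "supports B Q" and C: "star_subalgebra C" "supports C (un - P)"
    and P: "bs P = P" "P * P = P" and PQ: "bn (P - Q) < 1"
    and Y: "P * io a * P - P = bs Y * Y"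
  obtains b where "b \<in> B" "\<And>g. fpositive g \<Longrightarrow> Re (ev Q g) \<le> 4 * Re (g b)"
proof -
  obtain b where b: "b \<in> B" "\<And>g V. fpositive g \<Longrightarrow>
      Re (ev (bs (Q * P * V) * (Q * P * V)) g) \<le> 4 * Re (ev (bs (Q * P * V) * io b * (Q * P * V)) g)"
    using compression_lower_bound[OF assms] by blast
  have Q: "bs Q = Q" "Q * Q = Q" "Q * io b = io b" "io b * Q = io b" using B(2) b(1) by (auto simp: supports_def)
  define k where "k = bn (P - Q) * bn (P - Q)"
  have k: "0 \<le> k" "k < 1" using PQ bn_nonneg[of "P - Q"] by (auto simp: k_def mult_less_cancel_left1 intro: le_less_trans[OF mult_left_le])
  obtain V where V: "\<And>n. bn (Q - Q * P * V n) \<le> k ^ n * (bn Q + bn (Q * P * Q))"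
    using corner_inverse_approx[OF P(2) Q(2)] unfolding k_def by metis
  define R where "R n = Q - Q * P * V n" for n
  have R: "(\<lambda>n. bn (R n)) \<longlonglongrightarrow> 0"
  proof (rule tendsto_sandwich[OF _ _ tendsto_const])
    have "(\<lambda>n. k ^ n * (bn Q + bn (Q * P * Q))) \<longlonglongrightarrow> 0 * (bn Q + bn (Q * P * Q))"
      by (intro tendsto_mult tendsto_const LIMSEQ_power_zero) (use k in auto)
    then show "(\<lambda>n. k ^ n * (bn Q + bn (Q * P * Q))) \<longlonglongrightarrow> 0" by simp
  qed (auto simp: bn_nonneg R_def V)
  have "Re (ev Q g) \<le> 4 * Re (g b)" if g: "fpositive g" for g
  proof (rule LIMSEQ_le)
    note gd = fpositive_dual[OF g]
    \<comment> \<open>\<open>un\<close> is inserted so that the same limit statement also covers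
      \<open>bs Q * Q\<close>.\<close>
    have "(\<lambda>n. Re (ev (bs (Q - R n) * un * (Q - R n)) g)) \<longlonglongrightarrow> Re (ev (bs Q * un * Q) g)"
      by (intro tendsto_Re ev_conj_tendsto gd R)
    then show "(\<lambda>n. Re (ev (bs (Q - R n) * (Q - R n)) g)) \<longlonglongrightarrow> Re (ev Q g)" by (simp add: Q)
    have "(\<lambda>n. 4 * Re (ev (bs (Q - R n) * io b * (Q - R n)) g)) \<longlonglongrightarrow> 4 * Re (ev (bs Q * io b * Q) g)"
      by (intro tendsto_mult tendsto_const tendsto_Re ev_conj_tendsto gd R)
    then show "(\<lambda>n. 4 * Re (ev (bs (Q - R n) * io b * (Q - R n)) g)) \<longlonglongrightarrow> 4 * Re (g b)"
      by (simp add: Q ev_io_apply gd)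
    have "Q - R n = Q * P * V n" for n by (simp add: R_def)
    then show "\<exists>N. \<forall>n\<ge>N. Re (ev (bs (Q - R n) * (Q - R n)) g) \<le> 4 * Re (ev (bs (Q - R n) * io b * (Q - R n)) g)"
      using b(2)[OF g] by simp
  qed
  with b(1) show thesis by (rule that)
qed

text \<open>A positive functional norming \<open>cstar x * x\<close> is conjugated by
  \<open>x\<close>. As \<open>Q\<close> is a unit on \<open>B\<close>, the domination bounds
  \<open>(norm x)^2\<close> by \<open>4 * Re (g (cstar x * b * x))\<close>, which is at most
  \<open>4 * norm x * norm (b * x)\<close>.\<close>

lemma norm_lower_bound:
  assumes B: "supports B Q" and b: "\<And>g. fpositive g \<Longrightarrow> Re (ev Q g) \<le> 4 * Re (g b)" and x: "x \<in> B"
  shows "norm x \<le> 4 * norm (b * x)"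
proof -
  obtain g where g: "fpositive g" "\<And>y. cmod (g y) \<le> norm y" "norm (cstar x * x) \<le> Re (g (cstar x * x))"
    using fpositive_norming[OF apositive_cstar_mult_self[of x]] by blast
  note gd = fpositive_dual[OF g(1)]
  have cf: "cfun (io x) g = (\<lambda>y. g (cstar x * y * x))" by (rule cfun_io[OF gd])
  have "ev Q (\<lambda>y. g (cstar x * y * x)) = arens (ev Q) (iota x) (\<lambda>y. g (cstar x * y))"
    by (simp add: arens_iota_right dual_lmult[OF gd] mult.assoc)
  also have "arens (ev Q) (iota x) = iota x"
    using B x unfolding supports_def by (metis ev_io ev_times)
  also have "iota x (\<lambda>y. g (cstar x * y)) = g (cstar x * x)" by (simp add: iota_def dual_lmult[OF gd])
  finally have "Re (g (cstar x * x)) \<le> 4 * Re (g (cstar x * b * x))"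
    using b[OF fpositive_cfun[OF g(1)], of "io x"] by (simp add: cf)
  also have "\<dots> \<le> 4 * norm (cstar x * (b * x))"
    using g(2)[of "cstar x * b * x"] complex_Re_le_cmod[of "g (cstar x * b * x)"] by (simp add: mult.assoc)
  also have "\<dots> \<le> 4 * (norm x * norm (b * x))"
    using norm_mult_ineq[of "cstar x" "b * x"] by simp
  finally have "norm x * norm x \<le> norm x * (4 * norm (b * x))"
    using g(3) by (simp add: cstar_identity power2_eq_square)
  then show ?thesis by (cases "x = 0") auto
qed

text \<open>A positive multiple \<open>h\<close> of \<open>cstar b * b\<close> is again bounded
  below on \<open>B\<close>. The elements \<open>e n = 1 - (1 - h)^n\<close> lie in
  \<open>B\<close>, and \<open>h * e n\<close> tends to \<open>h\<close>. The lower bound makes them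
  Cauchy, and for the limit \<open>e'\<close> it cancels \<open>h\<close> in
  \<open>h * (e' * x - x) = 0\<close>.\<close>

lemma unital_of_norm_lower_bound:
  fixes B :: "'a::cstar_algebra set"
  assumes B: "star_subalgebra B" "closed B" and b: "b \<in> B"
    and K: "K > 0" "\<And>x. x \<in> B \<Longrightarrow> norm x \<le> K * norm (b * x)"
  obtains e where "e \<in> B" "\<And>x. x \<in> B \<Longrightarrow> e * x = x"
proof -
  have sc: "r *\<^sub>R x \<in> B" if "x \<in> B" for r x using star_subalgebra_scaleR[OF B(1) that] .
  have alg: "x + y \<in> B" "x * y \<in> B" "cstar x \<in> B" if "x \<in> B" "y \<in> B" for x y
    using B(1) that by (auto simp: star_subalgebra_def)
  have diff: "x - y \<in> B" if "x \<in> B" "y \<in> B" for x y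
    using alg(1)[OF that(1) sc[OF that(2), of "- 1"]] by simp
  define h0 where "h0 = cstar b * b"
  define t where "t = norm h0 + 1"
  have t: "t > 0" "norm h0 \<le> t" by (auto simp: t_def add_nonneg_pos)
  define h where "h = (1/t) *\<^sub>R h0"
  have hB: "h \<in> B" unfolding h_def h0_def by (intro sc alg(2) alg(3)[OF b b] b)
  have hpos: "apositive h" unfolding h_def h0_def using t by (intro apositive_scaleR apositive_cstar_mult_self) simp
  have hnorm: "norm h \<le> 1" using t by (simp add: h_def divide_le_eq)
  \<comment> \<open>Cancelling \<open>norm x\<close> in \<open>norm x ^ 2 \<le> K^2 * norm (b * x)^2
    \<le> K^2 * norm x * norm (h0 * x)\<close> leaves the square of \<open>K\<close>; the factor
    \<open>t\<close> undoes the scaling of \<open>h0\<close>.\<close>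
  define L where "L = K\<^sup>2 * t"
  have L: "L > 0" using K(1) t by (simp add: L_def)
  have low: "norm x \<le> L * norm (h * x)" if x: "x \<in> B" for x
  proof -
    have "(norm (b * x))\<^sup>2 = norm (cstar x * (h0 * x))"
      using cstar_identity[of "b * x"] by (simp add: cstar_mult h0_def mult.assoc)
    also have "\<dots> \<le> norm x * norm (h0 * x)" using norm_mult_ineq[of "cstar x" "h0 * x"] by simp
    finally have "K\<^sup>2 * (norm (b * x))\<^sup>2 \<le> K\<^sup>2 * (norm x * norm (h0 * x))" by (intro mult_left_mono) auto
    moreover have "(norm x)\<^sup>2 \<le> (K * norm (b * x))\<^sup>2" by (intro power_mono K(2) x) simp
    ultimately have "norm x * norm x \<le> norm x * (K\<^sup>2 * norm (h0 * x))"
      by (simp add: power_mult_distrib power2_eq_square[of "norm x"] mult_ac)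
    then have "norm x \<le> K\<^sup>2 * norm (h0 * x)" by (cases "x = 0") auto
    also have "\<dots> = L * norm (h * x)" using t by (simp add: L_def h_def)
    finally show ?thesis .
  qed
  define e where "e n = uelt (1 - (1 - emb h) ^ n)" for n
  have emb_e: "emb (e n) = 1 - (1 - emb h) ^ n" for n
    unfolding e_def by (rule emb_uelt) (simp add: uscal_power emb_simps)
  have eB: "e n \<in> B" for n
  proof (induction n)
    case 0
    have "e 0 = 0" by (simp add: e_def)
    then show ?case using B(1) by (simp add: star_subalgebra_def)
  next
    case (Suc n)
    \<comment> \<open>The recursion stays inside \<open>B\<close>, although the powers are formed in
      the unitization.\<close>
    have "emb (e (Suc n)) = emb (e n + h - h * e n)" by (simp add: emb_e emb_simps algebra_simps)
    then have "e (Suc n) = e n + h - h * e n" by (simp only: emb_eq_iff)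
    then show ?case using Suc hB alg diff by simp
  qed
  have lim0: "(\<lambda>n. h - h * e n) \<longlonglongrightarrow> 0"
  proof (rule tendsto_0_le[OF lim_1_over_n, where K = 1])
    have "norm (h - h * e n) \<le> 1 / real n" if "n > 0" for n
    proof -
      have "emb (h - h * e n) = emb h * (1 - emb h) ^ n" by (simp add: emb_simps emb_e algebra_simps)
      then have "real n * norm (h - h * e n) \<le> 1"
        using norm_mult_one_minus_power_emb[OF hpos hnorm, of n] by (metis norm_emb)
      then show ?thesis using that by (simp add: field_simps)
    qed
    \<comment> \<open>\<open>1 / real 0\<close> is 0 by convention, so the bound is claimed only
      from 1 on.\<close>
    then show "\<forall>\<^sub>F n in sequentially. norm (h - h * e n) \<le> norm (1 / real n) * 1"
      by (intro eventually_sequentiallyI[of 1]) simp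
  qed
  have limh: "(\<lambda>n. h * e n) \<longlonglongrightarrow> h" using tendsto_diff[OF tendsto_const[of h] lim0] by simp
  then have cau: "Cauchy (\<lambda>n. h * e n)" by (rule LIMSEQ_imp_Cauchy)
  have "Cauchy e"
  proof (rule CauchyI)
    fix \<epsilon> :: real assume "0 < \<epsilon>"
    then have "0 < \<epsilon> / L" using L by simp
    then obtain M where M: "\<forall>m\<ge>M. \<forall>n\<ge>M. norm (h * e m - h * e n) < \<epsilon> / L" using CauchyD[OF cau] by blast
    have "norm (e m - e n) < \<epsilon>" if "m \<ge> M" "n \<ge> M" for m n
    proof -
      have "norm (e m - e n) \<le> L * norm (h * (e m - e n))" by (intro low diff eB)
      also have "\<dots> < L * (\<epsilon> / L)"
        using M that L by (intro mult_strict_left_mono) (auto simp: right_diff_distrib)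
      finally show ?thesis using L by simp
    qed
    then show "\<exists>M. \<forall>m\<ge>M. \<forall>n\<ge>M. norm (e m - e n) < \<epsilon>" by blast
  qed
  then obtain e' where e': "e \<longlonglongrightarrow> e'" using Cauchy_convergent convergent_def by blast
  have e'B: "e' \<in> B" using closed_sequentially[OF B(2) _ e'] eB by blast
  have "(\<lambda>n. h * e n) \<longlonglongrightarrow> h * e'" by (intro tendsto_mult tendsto_const e')
  then have he: "h * e' = h" using LIMSEQ_unique limh by blast
  have "e' * x = x" if x: "x \<in> B" for x
  proof -
    have "h * (e' * x - x) = 0" by (simp add: right_diff_distrib mult.assoc[symmetric] he)
    then have "norm (e' * x - x) \<le> 0" using low[OF diff[OF alg(2)[OF e'B x] x]] by simp
    then show ?thesis by simp
  qed
  with e'B show thesis by (rule that)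
qed

text \<open>Positivity, \<open>f e = 1\<close> and \<open>dnorm f \<le> 1\<close> are weak* closed
  conditions. The reverse bound on the norm follows from \<open>f e = 1\<close> and
  \<open>norm e \<le> 1\<close>, so no mass is lost in a limit.\<close>

lemma compact_proj_iota:
  fixes e :: "'a::cstar_algebra"
  assumes e: "cstar e = e" "e * e = e"
  shows "compact_proj (iota e)"
proof -
  define S where "S = {f. fpositive f \<and> dnorm f = 1 \<and> f e = 1}"
  \<comment> \<open>At a state the unit has the value 1, so \<open>(bone - iota e) f = 0\<close>
    reads \<open>f e = 1\<close>.\<close>
  have S: "FP (iota e) \<inter> SA = (S :: ('a \<Rightarrow> complex) set)"
    by (auto simp: FP_def SA_def QA_def S_def bone_eq_bunit bunit_fpositive iota_def fpositive_dual fun_diff_def)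
  have "(norm e)\<^sup>2 = norm e" using cstar_identity[of e] e by simp
  then have ne: "norm e \<le> 1" by (cases "norm e = 0") (auto simp: power2_eq_square)
  have "\<exists>K. finite K \<and> (\<exists>\<epsilon>>0. \<forall>g\<in>S. \<exists>a\<in>K. cmod (g a - f a) \<ge> \<epsilon>)" if f: "f \<in> dual - S" for f
  proof -
    have single: ?thesis if "\<epsilon> > 0" "\<And>g. g \<in> S \<Longrightarrow> cmod (g a - f a) \<ge> \<epsilon>" for a \<epsilon>
      using that by (intro exI[of _ "{a}"]) auto
    consider "f e \<noteq> 1" | "\<not> fpositive f" | "fpositive f" "f e = 1" "dnorm f \<noteq> 1" using f by (auto simp: S_def)
    then show ?thesis
    proof cases
      case 1
      then show ?thesis by (intro single[of "cmod (1 - f e)" e]) (auto simp: S_def)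
    next
      case 2
      then obtain a where "Im (f (cstar a * a)) \<noteq> 0 \<or> Re (f (cstar a * a)) < 0"
        using f by (auto simp: fpositive_def not_le)
      then show ?thesis
      proof
        assume "Im (f (cstar a * a)) \<noteq> 0"
        then show ?thesis
        proof (intro single[of "\<bar>Im (f (cstar a * a))\<bar>" "cstar a * a"])
          fix g assume "g \<in> S"
          then have "Im (g (cstar a * a)) = 0" by (simp add: S_def fpositive_def)
          then show "\<bar>Im (f (cstar a * a))\<bar> \<le> cmod (g (cstar a * a) - f (cstar a * a))"
            using abs_Im_le_cmod[of "g (cstar a * a) - f (cstar a * a)"] by simp
        qed simp
      next
        assume "Re (f (cstar a * a)) < 0"
        then show ?thesis
        proof (intro single[of "- Re (f (cstar a * a))" "cstar a * a"])
          fix g assume "g \<in> S"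
          then have "Re (g (cstar a * a)) \<ge> 0" by (simp add: S_def fpositive_def)
          then show "- Re (f (cstar a * a)) \<le> cmod (g (cstar a * a) - f (cstar a * a))"
            using complex_Re_le_cmod[of "g (cstar a * a) - f (cstar a * a)"] by simp
        qed simp
      qed
    next
      case 3
      have fd: "f \<in> dual" using f by simp
      have "1 \<le> dnorm f * norm e" using dual_bound[OF fd, of e] 3 by simp
      also have "\<dots> \<le> dnorm f" using ne dnorm_nonneg[OF fd] by (simp add: mult_left_le)
      finally have "1 < dnorm f" using 3 by simp
      then obtain x where x: "norm x \<le> 1" "1 < cmod (f x)" using dnorm_approx[OF fd] by blast
      then show ?thesis
      proof (intro single[of "cmod (f x) - 1" x])
        fix g assume g: "g \<in> S"
        then have "cmod (g x) \<le> 1"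
          using dual_bound[of g x] x(1) by (auto simp: S_def fpositive_dual)
        then show "cmod (f x) - 1 \<le> cmod (g x - f x)"
          using norm_triangle_ineq2[of "f x" "g x"] by (simp add: norm_minus_commute)
      qed simp
    qed
  qed
  then show ?thesis
    unfolding compact_proj_def S weakstar_closed_def by (auto simp: S_def fpositive_dual)
qed

section \<open>Identification of the open projection with the unit of its subalgebra\<close>

lemma supports_support_projection:
  assumes "support_projection B q" shows "supports B (Bid q)" "ev (Bid q) = q"
proof -
  have q: "q \<in> bidual" "bstar q = q" "arens q q = q"
    using assms by (auto simp: support_projection_def bprojection_def)
  show ev: "ev (Bid q) = q" by (rule Bid_inverse[OF q(1)])
  show "supports B (Bid q)"
    using assms q unfolding supports_def support_projection_def
    by (simp add: ev_inject[symmetric] ev_bs ev_times ev_io ev)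
qed

lemma star_subalgebra_hereditary: "hereditary_subalgebra B \<Longrightarrow> star_subalgebra B \<and> closed B"
  by (auto simp: hereditary_subalgebra_def star_subalgebra_def)

theorem theorem5p1:
  fixes p q :: "('a::cstar_algebra \<Rightarrow> complex) \<Rightarrow> complex"
  assumes "bprojection p" and "bprojection q"
    and "closed_proj p" and "open_proj q"
    and "alpha p < \<infinity>"
    and "bnorm (p - q) < 1"
  shows "compact_proj q \<and> q \<in> range iota"
proof -
  define P Q where "P = Bid p" and "Q = Bid q"
  have p: "p \<in> bidual" "bstar p = p" "arens p p = p" using assms(1) by (auto simp: bprojection_def)
  have evP: "ev P = p" unfolding P_def by (rule Bid_inverse[OF p(1)])
  have P: "bs P = P" "P * P = P" by (simp_all add: ev_inject[symmetric] ev_bs ev_times evP p)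
  obtain B where B: "hereditary_subalgebra B" "support_projection B q" using assms(4) by (auto simp: open_proj_def)
  have sB: "supports B Q" and evQ: "ev Q = q" unfolding Q_def using supports_support_projection[OF B(2)] by auto
  obtain C where C: "hereditary_subalgebra C" "support_projection C (bone - p)"
    using assms(3) by (auto simp: closed_proj_def open_proj_def)
  have "bone - p = ev (un - P)" by (simp add: ev_minus ev_un evP bone_eq_bunit fun_diff_def)
  then have "Bid (bone - p) = un - P" by (simp add: ev_inverse)
  then have sC: "supports C (un - P)" using supports_support_projection(1)[OF C(2)] by simp
  have PQ: "bn (P - Q) < 1" using assms(6) by (simp add: bn_def ev_minus evP evQ fun_diff_def)
  have "\<exists>a Y. P * io a * P - P = bs Y * Y"
  proof (cases "p = (\<lambda>_. 0)")
    \<comment> \<open>Here \<open>alpha\<close> is 1 by convention and supplies no element, but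
      \<open>a = 0\<close> and \<open>Y = 0\<close> will do.\<close>
    case True
    then have "P = 0" by (simp add: ev_inject[symmetric] evP ev_zero)
    then show ?thesis by (intro exI[of _ 0]) simp
  next
    case False
    \<comment> \<open>The infimum of the empty set is \<open>\<infinity>\<close>, so finiteness of
      \<open>alpha p\<close> provides an \<open>a\<close>.\<close>
    have "{ereal (norm a) | a. cstar a = a \<and> ble p (arens (arens p (iota a)) p)} \<noteq> {}"
    proof
      assume empty: "{ereal (norm a) | a. cstar a = a \<and> ble p (arens (arens p (iota a)) p)} = {}"
      have "alpha p = \<infinity>" unfolding alpha_def empty using False by (simp add: top_ereal_def)
      then show False using assms(5) by simp
    qed
    then obtain a where "ble p (arens (arens p (iota a)) p)" by blast
    then obtain Y where Y: "Y \<in> bidual" "arens (arens p (iota a)) p - p = arens (bstar Y) Y"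
      by (auto simp: ble_def bpositive_def)
    have "ev (P * io a * P - P) = ev (bs (Bid Y) * Bid Y)"
      using Y by (simp add: ev_minus ev_times ev_io evP ev_bs Bid_inverse fun_diff_def)
    then show ?thesis by (auto simp: ev_inject)
  qed
  then obtain a Y where Y: "P * io a * P - P = bs Y * Y" by blast
  have saB: "star_subalgebra B" "closed B" and saC: "star_subalgebra C"
    using star_subalgebra_hereditary B(1) C(1) by blast+
  obtain b where b: "b \<in> B" "\<And>g. fpositive g \<Longrightarrow> Re (ev Q g) \<le> 4 * Re (g b)"
    using support_dominated[OF saB(1) sB saC sC P PQ Y] by blast
  have "norm x \<le> 4 * norm (b * x)" if "x \<in> B" for x by (rule norm_lower_bound[OF sB b(2) that])
  then obtain e where e: "e \<in> B" "\<And>x. x \<in> B \<Longrightarrow> e * x = x"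
    using unital_of_norm_lower_bound[OF saB b(1), of 4] by auto
  have "cstar e \<in> B" using saB e(1) by (auto simp: star_subalgebra_def)
  \<comment> \<open>\<open>e * cstar e\<close> is self-adjoint, so this makes the left unit
    \<open>e\<close> a projection.\<close>
  then have "e * cstar e = cstar e" by (rule e(2))
  then have es: "cstar e = e" by (metis cstar_cstar cstar_mult)
  have "q = iota e"
  proof (rule bidual_eqI)
    show "q \<in> bidual" using ev_bidual[of Q] by (simp add: evQ)
    show "iota e \<in> bidual" by (rule iota_bidual)
    fix f :: "'a \<Rightarrow> complex" assume f: "f \<in> dual"
    have m: "(\<lambda>b. f (e * b)) \<in> dual" by (rule dual_lmult[OF f])
    \<comment> \<open>The functional vanishes on \<open>B\<close>, hence at \<open>q\<close>; this
      gives \<open>q = e q\<close>, while \<open>e q = e\<close> because \<open>q\<close> acts as a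
      unit on \<open>B\<close>.\<close>
    have "ev Q (\<lambda>x. f x - f (e * x)) = 0"
      by (rule supports_vanish[OF sB dual_minus_fun[OF f m]]) (simp add: e(2))
    then have "q f = q (\<lambda>b. f (e * b))" using bidual_diff[OF ev_bidual f m, of Q] by (simp add: evQ)
    also have "\<dots> = arens (iota e) q f" using arens_iota_left[OF f ev_bidual, of e Q] by (simp add: evQ)
    also have "arens (iota e) q = iota e" using B(2) e(1) by (simp add: support_projection_def)
    finally show "q f = iota e f" .
  qed
  then show ?thesis using compact_proj_iota[OF es e(2)[OF e(1)]] by blast
qed

end
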